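(* Let $\Omega_0,\ldots,\Omega_N$, $\tilde\Omega_0$, $n_b$, $\tilde n_0$, $k$, $\tilde k_0$, $G$, $D$, $n$, $m$ be as described in the context, and let $x_0\in\tilde\Omega_0\setminus\overline{(\tilde\Omega_0\cap D)}$. Suppose that $u^s(\cdot;x_0)\in C^1(\mathbb{R}^2)$, with $\Delta u^s(\cdot;x_0)\in C^1(\overline{\Omega}_i)$ for all $i=0,\ldots,N$, is a solution of the scattering problem $$\begin{cases}\Delta_x u(x;x_0)+k^2n(x)\,u(x;x_0)=-\delta(x-x_0) & \text{for } x\in\mathbb{R}^2,\\ u(x;x_0)=u^i(x;x_0)+u^s(x;x_0), & \\ \displaystyle\lim_{r\to\infty}\left[\sqrt r\left(\frac{\partial u^s}{\partial r}-\mathrm{i}\,\tilde k_0u^s\right)\right]=0, & \end{cases}$$ where $u^i(x;x_0)=G(x;x_0)$ is the incident field, $r=|x|$, and the limit holds uniformly in all directions $\hat x=x/|x|$. Then $u^s(\cdot;x_0)$ satisfies the integral equation $$u^s(x;x_0)=-\tilde k_0^2\int_{\mathbb{R}^2}G(x;y)\,m(y)\,u(y;x_0)\,dy\qquad\text{for all } x\in\tilde\Omega_0 .$$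
   Context: **Background medium.** Let $\varepsilon_0>0$ be the vacuum permittivity, $\omega>0$ the angular frequency, $c>0$ the speed of light in free space, and $k=\omega/c$. The background refractive index is $$n_b(x)=\frac1{\varepsilon_0}\left[\varepsilon(x)+\mathrm{i}\frac{\sigma(x)}{\omega}\right],\qquad x\in\mathbb{R}^2,\quad \varepsilon(x)\ge 1,\ \sigma(x)\ge 0 \text{ real-valued}.$$ There are $N+1$ open connected $C^2$-domains $\Omega_0,\ldots,\Omega_N\subset\mathbb{R}^2$ (not necessarily simply connected) such that: 1) $\Omega_i\cap\Omega_j=\emptyset$ for $i\ne j$; 2) $\mathbb{R}^2=\bigcup_{i=0}^N\overline{\Omega}_i$; 3) $\Omega_i$ is bounded for each $i\neq0$; 4) $n_b|_{\Omega_i}\in C^1(\overline\Omega_i)$ for all $i=0,\dots,N$; 5) $n_b(x)=\tilde n_0\in\mathbb{C}$ for $x\in\Omega_0$, where $\tilde n_0$ is a constant with $\mathrm{Im}\,\tilde n_0\ge0$; 6) there is a (possibly empty) subset $J_0\subset\{1,\ldots,N\}$ such that $\tilde\Omega_0:=\mathrm{int}\{x\in\mathbb{R}^2: n_b(x)=\tilde n_0\}=\Omega_0\cup\bigcup_{j\in J_0}\Omega_j$. The boundaries $\partial\Omega_i$ may be either curves where $n_b$ is discontinuous or boundaries of virtual domains inside a homogeneous region. Set $\tilde k_0:=k\sqrt{\tilde n_0}$, with the branch $\mathrm{Im}\sqrt{\tilde n_0}\ge0$. **Scatterer.** $D=\bigcup_{i=1}^M\Omega_i$ with $1\le M\le N$.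 The whole medium (background plus scatterer) is described by a complex-valued refractive index $n$ with $n|_{\Omega_i}\in C^1(\overline\Omega_i)$ for all $i=0,\ldots,N$ and $n=n_b$ outside $\overline D$, while in general $n\neq n_b$ in $\Omega_1,\dots,\Omega_M$. Set $m(x):=[n_b(x)-n(x)]/\tilde n_0$, so that $\mathrm{supp}\,m=\overline D$, which is compact. **Green's function.** $G(\cdot;y)$ is the radiating solution of $$\Delta_xG(x;y)+k^2n_b(x)G(x;y)=-\delta(x-y),\qquad x\in\mathbb{R}^2,$$ where "radiating" means that it satisfies $\lim_{r\to\infty}\sqrt r(\partial_r G-\mathrm{i}\tilde k_0G)=0$ uniformly in all directions; $G(\cdot;y)\in C^1(\mathbb{R}^2\setminus\{y\})$. For $y\in\tilde\Omega_0$ one has $G(x;y)=\Phi(x;y)+u_b^s(x;y)$, where $\Phi(x;y)=\frac{\mathrm{i}}4H_0^{(1)}(\tilde k_0|x-y|)$ ($H_0^{(1)}$ is the Hankel function of the first kind of order zero) and $u_b^s(\cdot;y)\in C^1(\mathbb{R}^2)$. Existence and uniqueness of $G$ are taken as known. **Conventions.** The equation for $G$ and the equation for $u$ are each understood as a set of $N+1$ equations, one in each $\Omega_i$, linked by the transmission conditions that the function and its normal derivative be continuous across each $\partial\Omega_i$, with the singularity at the source point given by the $\delta$. The total field $u(\cdot;x_0)$ is in $C^1(\mathbb{R}^2\setminus\{x_0\})$. For a function $f$ and $p\in\{0,1\}$, $f\in C^p(\overline\Omega_i)$ means that $f$ restricted to $\Omega_i$ is $C^p$ and extends, together with its derivatives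 up to order $p$, continuously to $\overline\Omega_i$; $\Delta u^s\in C^1(\overline\Omega_i)$ means that the Laplacian of $u^s$ on the open set $\Omega_i$ (in the distributional sense if $u^s$ is not $C^2$) is such a function. *)

theory Defs
  imports "HOL-Analysis.Analysis"
begin

section \<open>Classes of differentiable functions\<close>

text \<open>Meaningful for open \<open>U\<close>: \<open>f\<close> is of class $C^p$ on \<open>U\<close>.\<close>

primrec C_on :: "nat \<Rightarrow> 'a::euclidean_space set \<Rightarrow> ('a \<Rightarrow> 'b::real_normed_vector) \<Rightarrow> bool" where
  "C_on 0 U f \<longleftrightarrow> continuous_on U f"
| "C_on (Suc p) U f \<longleftrightarrow> (\<forall>x\<in>U. f differentiable (at x)) \<and>
     (\<forall>b\<in>Basis. C_on p U (\<lambda>x. frechet_derivative f (at x) b))"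

definition extends_continuously ::
    "'a::euclidean_space set \<Rightarrow> ('a \<Rightarrow> 'b::real_normed_vector) \<Rightarrow> bool" where
  "extends_continuously U f \<longleftrightarrow>
     (\<exists>g. continuous_on (closure U) g \<and> (\<forall>x\<in>U. g x = f x))"

text \<open>
  \<open>C_closure p U f\<close> is $f|_U \in C^p(\overline U)$ for open \<open>U\<close>; the values
  of \<open>f\<close> outside \<open>U\<close>, in particular on the boundary of \<open>U\<close>, play no role.
\<close>

primrec C_closure :: "nat \<Rightarrow> 'a::euclidean_space set \<Rightarrow> ('a \<Rightarrow> 'b::real_normed_vector) \<Rightarrow> bool" where
  "C_closure 0 U f \<longleftrightarrow> extends_continuously U f"
| "C_closure (Suc p) U f \<longleftrightarrow> (\<forall>x\<in>U. f differentiable (at x)) \<and> extends_continuously U f \<and>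
     (\<forall>b\<in>Basis. C_closure p U (\<lambda>x. frechet_derivative f (at x) b))"

text \<open>
  Near each boundary point and in suitably rotated or reflected coordinates, the domain
  is the region lying strictly below the graph of a $C^2$ function.
\<close>

definition C2_domain :: "(real^2) set \<Rightarrow> bool" where
  "C2_domain U \<longleftrightarrow> open U \<and> connected U \<and> U \<noteq> {} \<and>
     (\<forall>p\<in>frontier U. \<exists>V (T :: real^2 \<Rightarrow> real^2) (g :: real \<Rightarrow> real).
        open V \<and> p \<in> V \<and> orthogonal_transformation T \<and> C_on 2 UNIV g \<and>
        U \<inter> V = {x \<in> V. T x $ 2 < g (T x $ 1)})"


section \<open>Distributional equations\<close>

definition laplacian :: "(real^2 \<Rightarrow> complex) \<Rightarrow> real^2 \<Rightarrow> complex" where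
  "laplacian f x =
     (\<Sum>b\<in>Basis. frechet_derivative (\<lambda>z. frechet_derivative f (at z) b) (at x) b)"

definition test_function :: "(real^2) set \<Rightarrow> (real^2 \<Rightarrow> complex) \<Rightarrow> bool" where
  "test_function U \<phi> \<longleftrightarrow> (\<forall>p. C_on p UNIV \<phi>) \<and>
     compact (closure {x. \<phi> x \<noteq> 0}) \<and> closure {x. \<phi> x \<noteq> 0} \<subseteq> U"

definition locally_integrable :: "(real^2) set \<Rightarrow> (real^2 \<Rightarrow> complex) \<Rightarrow> bool" where
  "locally_integrable U v \<longleftrightarrow>
     (\<forall>K. compact K \<and> K \<subseteq> U \<longrightarrow> set_integrable lebesgue K v)"

text \<open>$\Delta v = f$ in the sense of distributions on the open set \<open>U\<close>.\<close>

definition distr_laplacian ::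
    "(real^2) set \<Rightarrow> (real^2 \<Rightarrow> complex) \<Rightarrow> (real^2 \<Rightarrow> complex) \<Rightarrow> bool" where
  "distr_laplacian U v f \<longleftrightarrow> locally_integrable U v \<and> locally_integrable U f \<and>
     (\<forall>\<phi>. test_function U \<phi> \<longrightarrow>
        (\<integral>x. v x * laplacian \<phi> x \<partial>lebesgue) = (\<integral>x. f x * \<phi> x \<partial>lebesgue))"

text \<open>
  $\Delta v + k^2 q\,v = -\delta(\cdot - y)$ in the sense of distributions on the open set
  \<open>U\<close>. If \<open>y\<close> is not in \<open>U\<close>, test functions vanish at \<open>y\<close> and the
  equation is the homogeneous one.
\<close>

definition distr_point_source ::
    "real \<Rightarrow> (real^2 \<Rightarrow> complex) \<Rightarrow> (real^2) set \<Rightarrow> real^2 \<Rightarrow> (real^2 \<Rightarrow> complex) \<Rightarrow> bool" where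
  "distr_point_source k q U y v \<longleftrightarrow> locally_integrable U v \<and>
     (\<forall>\<phi>. test_function U \<phi> \<longrightarrow>
        (\<integral>x. v x * (laplacian \<phi> x + of_real (k\<^sup>2) * q x * \<phi> x) \<partial>lebesgue) = - \<phi> y)"

text \<open>
  The equation $\Delta v + k^2 q\,v = -\delta(\cdot - y)$ on the plane, for a medium made of
  the pieces \<open>\<Omega> 0, \<dots>, \<Omega> N\<close>: one equation in each piece, the transmission
  conditions (continuity of \<open>v\<close> and its normal derivative across the interfaces) being
  contained in \<open>v\<close> being $C^1$ away from the source. The last conjunct follows from the
  equations in the pieces when \<open>y\<close> lies in one of them; it fixes the singularity at
  \<open>y\<close> also when \<open>y\<close> lies on an interface.
\<close>

definition point_source_solution ::
    "real \<Rightarrow> (real^2 \<Rightarrow> complex) \<Rightarrow> (nat \<Rightarrow> (real^2) set) \<Rightarrow> nat \<Rightarrow> real^2 \<Rightarrow>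
       (real^2 \<Rightarrow> complex) \<Rightarrow> bool" where
  "point_source_solution k q \<Omega> N y v \<longleftrightarrow>
     C_on 1 (UNIV - {y}) v \<and>
     (\<forall>i\<le>N. distr_point_source k q (\<Omega> i) y v) \<and>
     (\<exists>\<rho>>0. distr_point_source k q (ball y \<rho>) y v)"

text \<open>
  The Sommerfeld condition, uniform with respect to the direction \<open>d\<close>; the Frechet
  derivative in direction \<open>d\<close> at the point \<open>r d\<close> is the radial derivative.
\<close>

definition radiating :: "complex \<Rightarrow> (real^2 \<Rightarrow> complex) \<Rightarrow> bool" where
  "radiating \<kappa> v \<longleftrightarrow>
     uniform_limit (sphere 0 1)
       (\<lambda>r d. of_real (sqrt r) *
          (frechet_derivative v (at (r *\<^sub>R d)) d - \<i> * \<kappa> * v (r *\<^sub>R d)))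
       (\<lambda>_. 0) at_top"


section \<open>The free-space fundamental solution\<close>

definition bessel_J0 :: "complex \<Rightarrow> complex" where
  "bessel_J0 z = (\<Sum>j. (-1) ^ j * (z / 2) ^ (2 * j) / (fact j)\<^sup>2)"

text \<open>Principal branch; \<open>harm j\<close> is the \<open>j\<close>-th harmonic number, \<open>harm 0 = 0\<close>.\<close>

definition bessel_Y0 :: "complex \<Rightarrow> complex" where
  "bessel_Y0 z = 2 / of_real pi *
     ((Ln (z / 2) + euler_mascheroni) * bessel_J0 z
        - (\<Sum>j. (-1) ^ j * harm j * (z / 2) ^ (2 * j) / (fact j)\<^sup>2))"

definition hankel1_0 :: "complex \<Rightarrow> complex" where
  "hankel1_0 z = bessel_J0 z + \<i> * bessel_Y0 z"

definition Phi :: "complex \<Rightarrow> real^2 \<Rightarrow> real^2 \<Rightarrow> complex" where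
  "Phi \<kappa> x y = \<i> / 4 * hankel1_0 (\<kappa> * of_real (dist x y))"


section \<open>Green's function of the background medium\<close>

text \<open>
  \<open>k\<close> is the wavenumber, \<open>\<kappa>\<close> the one in the outer region, \<open>q\<close> the
  refractive index of the background and \<open>W\<close> the region in which it has its outer
  value. The value of \<open>G y y\<close> is irrelevant.
\<close>

definition green_function ::
    "real \<Rightarrow> complex \<Rightarrow> (real^2 \<Rightarrow> complex) \<Rightarrow> (nat \<Rightarrow> (real^2) set) \<Rightarrow> nat \<Rightarrow> (real^2) set \<Rightarrow>
       (real^2 \<Rightarrow> real^2 \<Rightarrow> complex) \<Rightarrow> bool" where
  "green_function k \<kappa> q \<Omega> N W G \<longleftrightarrow>
     (\<forall>y. point_source_solution k q \<Omega> N y (\<lambda>x. G x y) \<and> radiating \<kappa> (\<lambda>x. G x y)) \<and>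
     (\<forall>y\<in>W. \<exists>w. C_on 1 UNIV w \<and> (\<forall>x. x \<noteq> y \<longrightarrow> G x y = Phi \<kappa> x y + w x))"

end

theory Submission
  imports Defs
begin

text \<open>
  All fields are tested in weak form, so neither the singularity of the Green function nor surface
  integrals enter. A distributional equation for a $C^1$ function may be tested with $C^1$ functions
  (mollify the test function), and a $C^1$ function that solves the equation off a graph solves it
  across the graph; hence the equations in the pieces give one weak equation on the plane away from
  the source. Conversely, the point source equation may be tested with a $C^1$ function whose
  distributional Laplacian is bounded. Combining this near the source with Green's second identity
  elsewhere expresses a field at the source point by a flux through a large annulus, which
  vanishes in the limit: testing the Helmholtz equation with the conjugate field shows that the
  radiation condition bounds the $L^2$ norm on annuli. For a pair of Green functions this yields
  the reciprocity \<open>G x y = G y x\<close>; for \<open>G (\<cdot>, x)\<close> and the scattered field it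
  yields the integral equation with \<open>G y x\<close> in place of \<open>G x y\<close>.
\<close>

section \<open>Partial derivatives and integration by parts\<close>

text \<open>The index jumps across the interfaces, so a field is only known to be C^1 there and its
  second derivatives exist only as distributions. Hence one derivative stays on the field and the
  other is carried by a cutoff or test function: a circle is replaced by the annulus on which a
  cutoff falls from 1 to 0, and its normal by the gradient of that cutoff. Two families are used:
  piecewise polynomial cutoffs of class C^2, whose slope has a sign and an explicit bound, and
  smooth exponential kernels, because a distributional equation accepts only smooth test functions.

  Reciprocity enters because the equation of \<open>G\<close> is given in the first argument, with
  the second as source, while the integral to be found runs over the second argument.

  The radiation condition restrains only \<open>\<partial>\<^sub>r v - \<i> * \<kappa> * v\<close>,
  not \<open>v\<close> itself. The flux between two radiating fields combines such defects with the
  fields as coefficients, so the fields must first be bounded in mean square; that bound rests on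
  the sign of \<open>Im \<kappa>\<close>.\<close>

definition pd :: "'a::euclidean_space \<Rightarrow> ('a \<Rightarrow> 'b::real_normed_vector) \<Rightarrow> 'a \<Rightarrow> 'b" where
  "pd b f z = frechet_derivative f (at z) b"

definition supp :: "('a::topological_space \<Rightarrow> 'b::zero) \<Rightarrow> 'a set" where
  "supp f = closure {x. f x \<noteq> 0}"

definition C1_on :: "'a::euclidean_space set \<Rightarrow> ('a \<Rightarrow> 'b::real_normed_vector) \<Rightarrow> bool" where
  "C1_on W f \<longleftrightarrow>
    (\<forall>x\<in>W. f differentiable (at x)) \<and> (\<forall>b\<in>Basis. continuous_on W (pd b f))"

text \<open>The test space of all weak equations below. As a single derivative falls on the test
  function, C^1 is enough, and the class is stable under multiplication by functions that are C^1 on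
  \<open>W\<close> only.\<close>

definition C1c :: "'a::euclidean_space set \<Rightarrow> ('a \<Rightarrow> 'b::real_normed_vector) \<Rightarrow> bool" where
  "C1c W f \<longleftrightarrow> C1_on UNIV f \<and> compact (supp f) \<and> supp f \<subseteq> W"

lemma closed_supp [simp]: "closed (supp f)"
  by (simp add: supp_def)

lemma not_in_supp: "z \<notin> supp f \<Longrightarrow> f z = 0"
  unfolding supp_def using closure_subset[of "{x. f x \<noteq> 0}"] by blast

lemma supp_subset_closed: "closed K \<Longrightarrow> (\<And>x. x \<notin> K \<Longrightarrow> f x = 0) \<Longrightarrow> supp f \<subseteq> K"
  unfolding supp_def by (rule closure_minimal) auto

lemma C_on_1: "C_on 1 W f \<longleftrightarrow> C1_on W f"
  by (simp add: pd_def[abs_def] C1_on_def)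

lemma pd_eqI: "(f has_derivative f') (at z) \<Longrightarrow> pd b f z = f' b"
  unfolding pd_def using frechet_derivative_at by metis

lemma has_derivative_pd: "f differentiable (at z) \<Longrightarrow> (f has_derivative (\<lambda>h. pd h f z)) (at z)"
  by (simp add: pd_def frechet_derivative_works[THEN iffD1])

lemma linear_pd: "f differentiable (at z) \<Longrightarrow> linear (\<lambda>h. pd h f z)"
  using has_derivative_pd has_derivative_linear by blast

lemma pd_sum_Basis: "f differentiable (at z) \<Longrightarrow> pd h f z = (\<Sum>b\<in>Basis. (h \<bullet> b) *\<^sub>R pd b f z)"
proof -
  assume "f differentiable (at z)"
  then interpret linear "\<lambda>h. pd h f z" by (rule linear_pd)
  have "pd (\<Sum>b\<in>Basis. (h \<bullet> b) *\<^sub>R b) f z = (\<Sum>b\<in>Basis. (h \<bullet> b) *\<^sub>R pd b f z)"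
    by (simp add: sum scale)
  then show ?thesis by (simp add: euclidean_representation)
qed

lemma C1_on_continuous: "C1_on W f \<Longrightarrow> continuous_on W f"
  unfolding C1_on_def by (simp add: continuous_at_imp_continuous_on differentiable_imp_continuous_within)

lemma C1_on_subset: "C1_on W f \<Longrightarrow> V \<subseteq> W \<Longrightarrow> C1_on V f"
  unfolding C1_on_def by (meson continuous_on_subset subsetD)

text \<open>\<open>frechet_derivative\<close> is a choice among the derivatives. Functions that
  agree near \<open>z\<close> have the same derivatives there, hence the same choice, even when
  there is no derivative to choose.\<close>

lemma pd_cong_open:
  assumes "open S" "z \<in> S" "\<And>x. x \<in> S \<Longrightarrow> f x = g x"
  shows "pd b f z = pd b g z"
proof -
  have "(f has_derivative F) (at z) \<longleftrightarrow> (g has_derivative F) (at z)" for F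
    using has_derivative_transform_within_open[of f F z UNIV S g]
      has_derivative_transform_within_open[of g F z UNIV S f] assms by auto
  then show ?thesis unfolding pd_def frechet_derivative_def by simp
qed

lemma differentiable_cong_open:
  assumes "open S" "z \<in> S" "\<And>x. x \<in> S \<Longrightarrow> f x = g x" "f differentiable (at z)"
  shows "g differentiable (at z)"
  using assms has_derivative_transform_within_open[of f _ z UNIV S g] unfolding differentiable_def by auto

lemma pd_const [simp]: "pd b (\<lambda>x. c) z = 0"
  using pd_eqI[OF has_derivative_const] .

lemma pd_not_in_supp:
  assumes "z \<notin> supp f" shows "pd b f z = 0"
  using pd_cong_open[of "- supp f" z f "\<lambda>_. 0" b] assms not_in_supp by (auto simp: open_Compl)

lemma pd_mult:
  fixes f g :: "'a::euclidean_space \<Rightarrow> 'b::real_normed_algebra"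
  assumes "f differentiable (at z)" "g differentiable (at z)"
  shows "pd b (\<lambda>x. f x * g x) z = pd b f z * g z + f z * pd b g z"
  using pd_eqI[OF has_derivative_mult[OF has_derivative_pd[OF assms(1)] has_derivative_pd[OF assms(2)]]]
  by (simp add: algebra_simps)

lemma pd_add:
  assumes "f differentiable (at z)" "g differentiable (at z)"
  shows "pd b (\<lambda>x. f x + g x) z = pd b f z + pd b g z"
  using pd_eqI[OF has_derivative_add[OF has_derivative_pd[OF assms(1)] has_derivative_pd[OF assms(2)]]] .

lemma pd_diff:
  assumes "f differentiable (at z)" "g differentiable (at z)"
  shows "pd b (\<lambda>x. f x - g x) z = pd b f z - pd b g z"
  using pd_eqI[OF has_derivative_diff[OF has_derivative_pd[OF assms(1)] has_derivative_pd[OF assms(2)]]] .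

lemma pd_of_real:
  assumes "f differentiable (at z)"
  shows "pd b (\<lambda>x. of_real (f x) :: complex) z = of_real (pd b f z)"
  using pd_eqI[OF has_derivative_of_real[OF has_derivative_pd[OF assms]]] .

lemma C1_on_mult:
  fixes f g :: "'a::euclidean_space \<Rightarrow> 'b::real_normed_algebra"
  assumes "C1_on W f" "C1_on W g"
  shows "C1_on W (\<lambda>x. f x * g x)"
proof -
  have "continuous_on W (pd b (\<lambda>x. f x * g x))" if "b \<in> Basis" for b
  proof (rule continuous_on_eq)
    show "continuous_on W (\<lambda>z. pd b f z * g z + f z * pd b g z)"
      using assms that C1_on_continuous[OF assms(1)] C1_on_continuous[OF assms(2)]
      unfolding C1_on_def by (intro continuous_intros) auto
  qed (use assms in \<open>auto simp: C1_on_def pd_mult\<close>)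
  then show ?thesis using assms unfolding C1_on_def by auto
qed

lemma C1_on_diff:
  assumes "C1_on W f" "C1_on W g"
  shows "C1_on W (\<lambda>x. f x - g x)"
proof -
  have "continuous_on W (pd b (\<lambda>x. f x - g x))" if "b \<in> Basis" for b
    by (rule continuous_on_eq[where f="\<lambda>z. pd b f z - pd b g z"])
      (use assms that in \<open>auto simp: C1_on_def pd_diff intro!: continuous_intros\<close>)
  then show ?thesis using assms unfolding C1_on_def by auto
qed

lemma C1_on_const [simp]: "C1_on W (\<lambda>_. c)"
  unfolding C1_on_def by (auto simp: pd_const[abs_def])

lemma C1_on_of_real:
  assumes "C1_on W f" shows "C1_on W (\<lambda>x. of_real (f x) :: complex)"
proof -
  have "continuous_on W (pd b (\<lambda>x. of_real (f x) :: complex))" if "b \<in> Basis" for b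
    by (rule continuous_on_eq[where f="\<lambda>z. of_real (pd b f z)"])
      (use assms that in \<open>auto simp: C1_on_def pd_of_real intro!: continuous_intros\<close>)
  moreover have "(\<lambda>x. of_real (f x) :: complex) differentiable (at x)" if "x \<in> W" for x
    using assms that has_derivative_of_real unfolding C1_on_def differentiable_def by blast
  ultimately show ?thesis unfolding C1_on_def by auto
qed

text \<open>The open sets \<open>W\<close> and \<open>- K\<close> cover the space.\<close>

lemma continuous_on_extend_zero:
  fixes g :: "'a::t2_space \<Rightarrow> 'b::{topological_space,zero}"
  assumes "open W" "closed K" "K \<subseteq> W" "continuous_on W g" "\<And>x. x \<notin> K \<Longrightarrow> g x = 0"
  shows "continuous_on UNIV g"
proof -
  have "continuous_on (- K) g"
    by (rule continuous_on_eq[where f="\<lambda>_. 0"]) (use assms in auto)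
  then have "continuous_on (W \<union> - K) g"
    using assms by (intro continuous_on_open_Un) (auto simp: open_Compl)
  moreover have "W \<union> - K = UNIV" using assms by auto
  ultimately show ?thesis by simp
qed

lemma C1c_differentiable: "C1c W f \<Longrightarrow> f differentiable (at z)"
  unfolding C1c_def C1_on_def by auto

lemma C1c_pd_continuous: "C1c W f \<Longrightarrow> b \<in> Basis \<Longrightarrow> continuous_on UNIV (pd b f)"
  unfolding C1c_def C1_on_def by auto

lemma C1c_continuous: "C1c W f \<Longrightarrow> continuous_on UNIV f"
  unfolding C1c_def using C1_on_continuous by auto

lemma C1c_compact: "C1c W f \<Longrightarrow> compact (supp f)" by (simp add: C1c_def)
lemma C1c_supp: "C1c W f \<Longrightarrow> supp f \<subseteq> W" by (simp add: C1c_def)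
lemma C1c_C_on: "C1c W f \<Longrightarrow> C1_on V f" unfolding C1c_def using C1_on_subset by blast
lemma C1c_mono: "C1c W f \<Longrightarrow> supp f \<subseteq> V \<Longrightarrow> C1c V f" by (simp add: C1c_def)

lemma C1cI:
  assumes "C1_on UNIV f" "compact K" "K \<subseteq> W" "\<And>x. x \<notin> K \<Longrightarrow> f x = 0"
  shows "C1c W f"
proof -
  have "supp f \<subseteq> K" using assms by (intro supp_subset_closed) (auto simp: compact_imp_closed)
  then show ?thesis using assms unfolding C1c_def
    by (metis closed_supp closed_Int_compact inf.absorb1 subset_trans)
qed

text \<open>The product rule holds at every point although \<open>v\<close> is differentiable on
  \<open>W\<close> only: elsewhere the product vanishes locally and the unspecified value
  \<open>pd b v z\<close> is multiplied by 0.\<close>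

lemma C1c_mult_pd:
  fixes v \<psi> :: "'a::euclidean_space \<Rightarrow> 'b::real_normed_algebra"
  assumes "open W" "C1_on W v" "C1c W \<psi>"
  shows "pd b (\<lambda>x. v x * \<psi> x) z = pd b v z * \<psi> z + v z * pd b \<psi> z"
proof (cases "z \<in> W")
  case True
  then show ?thesis using assms C1c_differentiable[OF assms(3)] by (intro pd_mult) (auto simp: C1_on_def)
next
  case False
  then have z: "z \<notin> supp \<psi>" using assms C1c_supp by blast
  moreover have "pd b (\<lambda>x. v x * \<psi> x) z = pd b (\<lambda>x. 0) z"
    by (rule pd_cong_open[of "- supp \<psi>"]) (use z not_in_supp[of _ \<psi>] in \<open>auto simp: open_Compl\<close>)
  ultimately show ?thesis by (simp add: not_in_supp pd_not_in_supp)
qed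

lemma C1c_mult:
  fixes v \<psi> :: "'a::euclidean_space \<Rightarrow> 'b::real_normed_algebra"
  assumes "open W" "C1_on W v" "C1c W \<psi>"
  shows "C1c W (\<lambda>x. v x * \<psi> x)"
proof (rule C1cI[where K="supp \<psi>"])
  let ?P = "\<lambda>x. v x * \<psi> x"
  have "?P differentiable (at z)" for z
  proof (cases "z \<in> W")
    case True
    then show ?thesis using assms C1c_differentiable[OF assms(3)] by (auto simp: C1_on_def)
  next
    case False
    then have "z \<notin> supp \<psi>" using assms C1c_supp by blast
    then show ?thesis
      by (intro differentiable_cong_open[of "- supp \<psi>" z "\<lambda>_. 0" ?P])
        (use not_in_supp[of _ \<psi>] in \<open>auto simp: open_Compl\<close>)
  qed
  moreover have "continuous_on UNIV (pd b ?P)" if b: "b \<in> Basis" for b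
  proof (rule continuous_on_extend_zero[OF assms(1)])
    show "closed (supp \<psi>)" by simp
    show "supp \<psi> \<subseteq> W" using assms C1c_supp by auto
    have "continuous_on W (\<lambda>z. pd b v z * \<psi> z + v z * pd b \<psi> z)"
      using assms b C1_on_continuous[OF assms(2)] C1_on_continuous[OF C1c_C_on[OF assms(3)]]
        continuous_on_subset[OF C1c_pd_continuous[OF assms(3) b], of W]
      by (intro continuous_intros) (auto simp: C1_on_def)
    then show "continuous_on W (pd b ?P)"
      by (rule continuous_on_eq) (simp add: C1c_mult_pd[OF assms])
    show "pd b ?P x = 0" if "x \<notin> supp \<psi>" for x
      using that by (simp add: C1c_mult_pd[OF assms] not_in_supp pd_not_in_supp)
  qed
  ultimately show "C1_on UNIV ?P" by (simp add: C1_on_def)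
qed (use assms not_in_supp[of _ \<psi>] in \<open>auto simp: C1c_compact C1c_supp\<close>)

section \<open>Integrals of compactly supported functions and of their derivatives\<close>

lemma integrable_continuous_compact:
  fixes g :: "'a::euclidean_space \<Rightarrow> 'b::{banach,second_countable_topology}"
  assumes "continuous_on UNIV g" "compact K" "\<And>x. x \<notin> K \<Longrightarrow> g x = 0"
  shows "integrable lebesgue g" "integrable lborel g"
proof -
  have "integrable lborel (\<lambda>x. indicator K x *\<^sub>R g x)"
    using assms by (intro borel_integrable_compact) (auto intro: continuous_on_subset)
  moreover have "(\<lambda>x. indicator K x *\<^sub>R g x) = g"
    using assms by (auto simp: indicator_def)
  ultimately show *: "integrable lborel g" by simp
  then show "integrable lebesgue g"
    using integrable_completion[of g lborel] borel_measurable_integrable[OF *] by simp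
qed

lemma integrable_indicator_compact:
  fixes C :: real
  assumes "compact K" shows "integrable lebesgue (\<lambda>z. C * indicator K z)"
  using lmeasurable_compact[OF assms]
  by (intro integrable_mult_right integrable_real_indicator) (auto simp: fmeasurable_def)

lemma integral_shift:
  fixes g :: "'a::euclidean_space \<Rightarrow> 'b::{banach,second_countable_topology}"
  assumes "g \<in> borel_measurable borel"
  shows "(\<integral>x. g (x + a) \<partial>lebesgue) = (\<integral>x. g x \<partial>lebesgue)"
proof -
  have "(\<integral>x. g x \<partial>lborel) = (\<integral>x. g x \<partial>(distr lborel borel ((+) a)))"
    by (simp add: lborel_distr_plus)
  also have "\<dots> = (\<integral>x. g (a + x) \<partial>lborel)"
    using assms by (subst integral_distr) auto
  finally have "(\<integral>x. g (x + a) \<partial>lborel) = (\<integral>x. g x \<partial>lborel)"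
    by (simp add: add.commute)
  then show ?thesis using assms by (simp add: integral_completion)
qed

lemma has_derivative_line:
  assumes "f differentiable (at (z + t *\<^sub>R h))"
  shows "((\<lambda>t. f (z + t *\<^sub>R h)) has_derivative (\<lambda>s. s *\<^sub>R pd h f (z + t *\<^sub>R h))) (at t)"
proof -
  have "((\<lambda>t. z + t *\<^sub>R h) has_derivative (\<lambda>s. s *\<^sub>R h)) (at t)"
    by (auto intro!: derivative_eq_intros)
  then have "((\<lambda>t. f (z + t *\<^sub>R h)) has_derivative (\<lambda>s. pd (s *\<^sub>R h) f (z + t *\<^sub>R h))) (at t)"
    using has_derivative_compose[of "\<lambda>t. z + t *\<^sub>R h" "\<lambda>s. s *\<^sub>R h" t UNIV f "\<lambda>h'. pd h' f (z + t *\<^sub>R h)"]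
      has_derivative_pd[OF assms] by blast
  then show ?thesis using linear_scale[OF linear_pd[OF assms], of _ h] by simp
qed

text \<open>The mean value inequality for \<open>f (z + t *\<^sub>R h) - t *\<^sub>R a\<close>. With
  \<open>a = 0\<close> it bounds an increment, with \<open>a\<close> the derivative at
  \<open>z\<close> it bounds the remainder of the linearisation.\<close>

lemma increment_bound:
  fixes f :: "'a::euclidean_space \<Rightarrow> 'b::real_inner"
  assumes d: "\<And>z. f differentiable (at z)"
    and C: "\<And>t. t \<in> {0<..<1} \<Longrightarrow> norm (pd h f (z + t *\<^sub>R h) - a) \<le> C"
  shows "norm (f (z + h) - f z - a) \<le> C"
proof -
  define F where "F t = f (z + t *\<^sub>R h) - t *\<^sub>R a" for t :: real
  have D: "(F has_derivative (\<lambda>s. s *\<^sub>R (pd h f (z + t *\<^sub>R h) - a))) (at t)" for t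
  proof -
    show ?thesis unfolding F_def using has_derivative_line[OF d[of "z + t *\<^sub>R h"]]
      by (auto intro!: derivative_eq_intros simp: algebra_simps)
  qed
  have "\<exists>x\<in>{0<..<1}. norm (F 1 - F 0) \<le> norm ((1 - 0) *\<^sub>R (pd h f (z + x *\<^sub>R h) - a))"
    by (rule mvt_general[of 0 1 F])
      (auto intro!: D continuous_at_imp_continuous_on has_derivative_continuous[OF D])
  then show ?thesis using C unfolding F_def by (auto simp: algebra_simps intro: order_trans)
qed

lemma compact_bound:
  fixes g :: "'a::topological_space \<Rightarrow> 'b::real_normed_vector"
  assumes "continuous_on K g" "compact K"
  obtains C where "C > 0" "\<And>x. x \<in> K \<Longrightarrow> norm (g x) \<le> C"
  using compact_imp_bounded[OF compact_continuous_image[OF assms]] unfolding bounded_pos by auto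

lemma compact_supp_bound:
  fixes g :: "'a::topological_space \<Rightarrow> 'b::real_normed_vector"
  assumes "continuous_on UNIV g" "compact K" "\<And>x. x \<notin> K \<Longrightarrow> g x = 0"
  obtains C where "C > 0" "\<And>x. norm (g x) \<le> C"
proof -
  obtain C where "C > 0" "\<And>x. x \<in> K \<Longrightarrow> norm (g x) \<le> C"
    using compact_bound[of K g] assms by (auto intro: continuous_on_subset)
  then show ?thesis using that[of C] assms by (metis less_le norm_zero)
qed

lemma C1c_bound:
  assumes "C1c W f" obtains C where "C > 0" "\<And>x. norm (f x) \<le> C"
  using compact_supp_bound[OF C1c_continuous[OF assms] C1c_compact[OF assms]] not_in_supp by blast

lemma C1c_pd_bound:
  assumes "C1c W f" "b \<in> Basis" obtains C where "C > 0" "\<And>x. norm (pd b f x) \<le> C"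
  using compact_supp_bound[OF C1c_pd_continuous[OF assms] C1c_compact[OF assms(1)]] pd_not_in_supp by blast

text \<open>The difference quotients have integral zero by translation invariance.\<close>

lemma integral_pd_zero:
  fixes g :: "'a::euclidean_space \<Rightarrow> complex"
  assumes g: "C1c W g" and b: "b \<in> Basis"
  shows "(\<integral>x. pd b g x \<partial>lebesgue) = 0"
proof -
  define h where "h n = 1 / real (Suc n)" for n
  have h: "0 < h n" "h n \<le> 1" for n by (auto simp: h_def)
  have h0: "h \<longlonglongrightarrow> 0" unfolding h_def using LIMSEQ_inverse_real_of_nat by (simp add: inverse_eq_divide)
  define q where "q n z = (g (z + h n *\<^sub>R b) - g z) /\<^sub>R h n" for n z
  obtain C where C: "C > 0" "\<And>x. norm (pd b g x) \<le> C" using C1c_pd_bound[OF g b] by blast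
  note d = C1c_differentiable[OF g]
  have cg: "continuous_on UNIV g" by (rule C1c_continuous[OF g])
  \<comment> \<open>Contains the supports of \<open>g\<close> and of all difference quotients,
    because \<open>h n \<le> 1\<close>; it carries the majorant for dominated convergence.\<close>
  define K where "K = (\<lambda>(x, y). x + y) ` (supp g \<times> cball 0 1)"
  have K: "compact K" unfolding K_def
    using C1c_compact[OF g] by (intro compact_continuous_image compact_Times continuous_intros)
        (auto simp: case_prod_unfold intro!: continuous_intros)
  have inK: "x \<in> K" if "x + a \<in> supp g" "norm a \<le> 1" for x a
  proof -
    have "(x + a, - a) \<in> supp g \<times> cball 0 1" using that by auto
    then show ?thesis unfolding K_def by (rule image_eqI[rotated]) simp
  qed
  have qb: "norm (q n z) \<le> C * indicator K z" for n z
  proof (cases "z \<in> K")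
    case True
    have "norm (g (z + h n *\<^sub>R b) - g z - 0) \<le> h n * C"
    proof (rule increment_bound[OF d])
      fix t :: real
      show "norm (pd (h n *\<^sub>R b) g (z + t *\<^sub>R h n *\<^sub>R b) - 0) \<le> h n * C"
        using C(2) h(1)[of n] linear_scale[OF linear_pd[OF d], of "h n" b] by (simp add: less_imp_le)
    qed
    moreover have "norm (q n z) = norm (g (z + h n *\<^sub>R b) - g z) / h n"
      using h(1)[of n] by (simp add: q_def divide_inverse_commute)
    ultimately show ?thesis using h(1)[of n] True by (simp add: pos_divide_le_eq mult.commute)
  next
    case False
    then have "z \<notin> supp g" "z + h n *\<^sub>R b \<notin> supp g"
      using inK[of z 0] inK[of z "h n *\<^sub>R b"] h[of n] b by (auto simp: less_imp_le)
    then show ?thesis by (simp add: q_def not_in_supp False)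
  qed
  have qm: "continuous_on UNIV (q n)" for n
    unfolding q_def by (intro continuous_intros continuous_on_compose2[OF cg]) auto
  have q0: "(\<integral>x. q n x \<partial>lebesgue) = 0" for n
  proof -
    have "integrable lebesgue g" using cg C1c_compact[OF g] not_in_supp[of _ g] integrable_continuous_compact by blast
    moreover have "integrable lebesgue (\<lambda>z. g (z + h n *\<^sub>R b))"
    proof (rule integrable_continuous_compact(1))
      show "continuous_on UNIV (\<lambda>z. g (z + h n *\<^sub>R b))"
        by (intro continuous_intros continuous_on_compose2[OF cg]) auto
      show "g (x + h n *\<^sub>R b) = 0" if "x \<notin> K" for x
        using inK[of x "h n *\<^sub>R b"] that not_in_supp[of _ g] h[of n] b by (auto simp: less_imp_le)
    qed (rule K)
    moreover have "g \<in> borel_measurable borel" using cg by (rule borel_measurable_continuous_onI)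
    ultimately show ?thesis unfolding q_def using integral_shift[of g "h n *\<^sub>R b"] by simp
  qed
  have lim: "(\<lambda>n. q n z) \<longlonglongrightarrow> pd b g z" for z
  proof -
    let ?f = "\<lambda>t. g (z + t *\<^sub>R b)"
    have "(?f has_derivative (\<lambda>s. s *\<^sub>R pd b g z)) (at 0)"
      using has_derivative_line[OF d[of "z + 0 *\<^sub>R b"]] by simp
    then have "((\<lambda>t. norm (?f (0 + t) - ?f 0 - t *\<^sub>R pd b g z) / norm t) \<longlongrightarrow> 0) (at 0)"
      unfolding has_derivative_at by blast
    moreover have "filterlim h (at 0) sequentially"
      using h0 h(1) by (auto simp: filterlim_at less_imp_neq[symmetric])
    ultimately have "((\<lambda>n. norm (?f (0 + h n) - ?f 0 - h n *\<^sub>R pd b g z) / norm (h n)) \<longlonglongrightarrow> 0)"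
      by (rule filterlim_compose)
    moreover have "norm (?f (0 + h n) - ?f 0 - h n *\<^sub>R pd b g z) / norm (h n) = norm (q n z - pd b g z)" for n
    proof -
      have "q n z - pd b g z = (?f (0 + h n) - ?f 0 - h n *\<^sub>R pd b g z) /\<^sub>R h n"
        using h(1)[of n] by (simp add: q_def scaleR_diff_right)
      then show ?thesis using h(1)[of n] by (simp add: divide_inverse_commute)
    qed
    ultimately have "(\<lambda>n. norm (q n z - pd b g z)) \<longlonglongrightarrow> 0" by (simp only:)
    then show ?thesis by (rule LIM_zero_cancel[OF tendsto_norm_zero_cancel])
  qed
  have "(\<lambda>n. \<integral>x. q n x \<partial>lebesgue) \<longlonglongrightarrow> (\<integral>x. pd b g x \<partial>lebesgue)"
  proof (rule integral_dominated_convergence[where w="\<lambda>z. C * indicator K z"])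
    show "integrable lebesgue (\<lambda>z. C * indicator K z)"
      by (rule integrable_indicator_compact[OF K])
    show "pd b g \<in> borel_measurable lebesgue"
      using C1c_pd_continuous[OF g b] by (auto intro!: measurable_completion borel_measurable_continuous_onI)
    show "q n \<in> borel_measurable lebesgue" for n
      using qm by (auto intro!: measurable_completion borel_measurable_continuous_onI)
  qed (use qb lim in auto)
  then show ?thesis by (simp add: q0 LIMSEQ_const_iff)
qed

section \<open>Cutoffs and mollifiers\<close>

text \<open>An exponent of at least 2 smooths the kink. At \<open>s = 0\<close> the slope function
  of Caratheodory's criterion is the truncated power of one degree less, which is continuous and
  vanishes there.\<close>

lemma power_max_zero_deriv:
  "((\<lambda>s::real. (max 0 s) ^ Suc (Suc n)) has_real_derivative (real n + 2) * (max 0 s) ^ Suc n) (at s)"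
proof -
  consider "s > 0" | "s < 0" | "s = 0" by linarith
  then show ?thesis
  proof cases
    case 1
    have "((\<lambda>s. s ^ Suc (Suc n)) has_real_derivative (real n + 2) * s ^ Suc n) (at s)"
      using DERIV_pow[of "Suc (Suc n)" s] by (simp add: algebra_simps)
    then have "((\<lambda>s. s ^ Suc (Suc n)) has_real_derivative (real n + 2) * (max 0 s) ^ Suc n) (at s)"
      using 1 by simp
    then show ?thesis
      by (rule has_field_derivative_transform_within_open[of _ _ s "{0<..}"]) (use 1 in auto)
  next
    case 2
    have "((\<lambda>s::real. 0) has_real_derivative (real n + 2) * (max 0 s) ^ Suc n) (at s)"
      using 2 by simp
    then show ?thesis
      by (rule has_field_derivative_transform_within_open[of _ _ s "{..<0}"]) (use 2 in auto)
  next
    case 3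
    have "isCont (\<lambda>z::real. (max 0 z) ^ Suc n) s" by (intro continuous_intros)
    moreover have "\<forall>z. (max 0 z) ^ Suc (Suc n) - (max 0 s) ^ Suc (Suc n) = (max 0 z) ^ Suc n * (z - s)"
      using 3 by (auto simp: max_def)
    ultimately have "\<exists>g. (\<forall>z. (max 0 z) ^ Suc (Suc n) - (max 0 s) ^ Suc (Suc n) = g z * (z - s)) \<and> isCont g s
        \<and> g s = (real n + 2) * (max 0 s) ^ Suc n"
      using 3 by (intro exI[of _ "\<lambda>z. (max 0 z) ^ Suc n"]) auto
    then show ?thesis by (simp only: CARAT_DERIV)
  qed
qed

text \<open>Descends from 1 for \<open>s \<le> 0\<close> to 0 for \<open>s \<ge> 1\<close>. The
  inner cube makes it C^2 at 0 and the outer cube at 1; two continuous derivatives are what the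
  Laplacian of a cutoff requires. The bound 9 for the slope is the product of the two
  exponents.\<close>

definition cut :: "real \<Rightarrow> real" where
  "cut s = (max 0 (1 - (max 0 s) ^ 3)) ^ 3"

definition cut' :: "real \<Rightarrow> real" where
  "cut' s = - 9 * (max 0 (1 - (max 0 s) ^ 3)) ^ 2 * (max 0 s) ^ 2"

definition cut'' :: "real \<Rightarrow> real" where
  "cut'' s = 54 * max 0 (1 - (max 0 s) ^ 3) * (max 0 s) ^ 4 - 18 * (max 0 (1 - (max 0 s) ^ 3)) ^ 2 * max 0 s"

lemma cut_deriv: "(cut has_real_derivative cut' s) (at s)"
proof -
  have 3: "((\<lambda>s::real. (max 0 s)^3) has_real_derivative 3 * (max 0 s)^2) (at s)" for s
    using power_max_zero_deriv[of 1 s] by (simp add: numeral_3_eq_3 numeral_2_eq_2)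
  have "((\<lambda>s. 1 - (max 0 s)^3) has_real_derivative - (3 * (max 0 s)^2)) (at s)"
    using DERIV_diff[OF DERIV_const 3] by simp
  from DERIV_chain2[OF 3 this]
  show ?thesis unfolding cut_def[abs_def] cut'_def
    by (rule DERIV_cong) simp
qed

lemma cut'_deriv: "(cut' has_real_derivative cut'' s) (at s)"
proof -
  have 2: "((\<lambda>s::real. (max 0 s)^2) has_real_derivative 2 * max 0 s) (at s)" for s
    using power_max_zero_deriv[of 0 s] by (simp add: numeral_2_eq_2)
  have 3: "((\<lambda>s::real. (max 0 s)^3) has_real_derivative 3 * (max 0 s)^2) (at s)" for s
    using power_max_zero_deriv[of 1 s] by (simp add: numeral_3_eq_3 numeral_2_eq_2)
  have "((\<lambda>s. 1 - (max 0 s)^3) has_real_derivative - (3 * (max 0 s)^2)) (at s)"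
    using DERIV_diff[OF DERIV_const 3] by simp
  from DERIV_chain2[OF 2 this]
  have "((\<lambda>s. (max 0 (1 - (max 0 s)^3))^2) has_real_derivative
      2 * max 0 (1 - (max 0 s)^3) * - (3 * (max 0 s)^2)) (at s)" .
  from DERIV_mult[OF DERIV_cmult[OF this, of "-9"] 2]
  show ?thesis unfolding cut'_def[abs_def] cut''_def
    by (rule DERIV_cong) (simp add: algebra_simps power4_eq_xxxx power2_eq_square)
qed

lemma cut_nonneg: "0 \<le> cut s" and cut_le_1: "cut s \<le> 1"
  unfolding cut_def by (auto intro!: power_le_one)

lemma cut_eq_1: "s \<le> 0 \<Longrightarrow> cut s = 1" and cut_eq_0: "1 \<le> s \<Longrightarrow> cut s = 0"
  unfolding cut_def by (auto simp: max_absorb1)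

lemma cut'_eq_0: "s \<le> 0 \<or> 1 \<le> s \<Longrightarrow> cut' s = 0"
  unfolding cut'_def by (auto simp: max_absorb1)

lemma cut'_nonpos: "cut' s \<le> 0" and cut'_ge: "- 9 \<le> cut' s"
proof -
  show "cut' s \<le> 0" unfolding cut'_def by simp
  show "- 9 \<le> cut' s"
  proof (cases "s \<le> 0 \<or> 1 \<le> s")
    case False
    then have "(max 0 (1 - (max 0 s) ^ 3)) ^ 2 * (max 0 s) ^ 2 \<le> 1 * 1"
      by (intro mult_mono power_le_one) auto
    then show ?thesis unfolding cut'_def by simp
  qed (simp add: cut'_eq_0)
qed

lemma isCont_cut': "isCont cut' s" using cut'_deriv DERIV_isCont by blast
lemma isCont_cut'': "isCont cut'' s"
  unfolding cut''_def[abs_def] by (intro continuous_intros)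

text \<open>A function of the squared distance, hence regular at the centre. The argument of
  \<open>cut\<close> is 0 at distance \<open>r\<close> and 1 at distance \<open>sqrt 2 * r\<close>;
  the rounder outer radius \<open>2 * r\<close> is used throughout.\<close>

definition bump :: "'a::euclidean_space \<Rightarrow> real \<Rightarrow> 'a \<Rightarrow> real" where
  "bump x r z = cut ((z - x) \<bullet> (z - x) / r\<^sup>2 - 1)"

lemma radial_derivative:
  fixes p :: "real \<Rightarrow> real" and x :: "'a::euclidean_space"
  assumes "\<And>s. (p has_real_derivative p' s) (at s)"
  shows "((\<lambda>z. p ((z - x) \<bullet> (z - x) / r - 1)) has_derivative
    (\<lambda>h. p' ((z - x) \<bullet> (z - x) / r - 1) * (2 / r * ((z - x) \<bullet> h)))) (at z)"
proof -
  have "((\<lambda>z. (z - x) \<bullet> (z - x) / r - 1) has_derivative (\<lambda>h. 2 / r * ((z - x) \<bullet> h))) (at z)"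
    unfolding divide_inverse by (auto intro!: derivative_eq_intros simp: inner_commute algebra_simps)
  then show ?thesis
    by (rule has_derivative_compose[OF _ assms[unfolded has_field_derivative_def]])
qed

lemma radial_C1_on:
  fixes p :: "real \<Rightarrow> real" and x :: "'a::euclidean_space"
  assumes "\<And>s. (p has_real_derivative p' s) (at s)" "\<And>s. isCont p' s"
  shows "C1_on UNIV (\<lambda>z. p ((z - x) \<bullet> (z - x) / r - 1))"
proof -
  have "continuous_on UNIV (pd b (\<lambda>z. p ((z - x) \<bullet> (z - x) / r - 1)))" for b
  proof -
    have c: "continuous_on UNIV p'" using assms(2) by (simp add: continuous_at_imp_continuous_on)
    have "continuous_on UNIV (\<lambda>z. p' ((z - x) \<bullet> (z - x) / r - 1) * (2 / r * ((z - x) \<bullet> b)))"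
      unfolding divide_inverse by (intro continuous_intros continuous_on_compose2[OF c]) auto
    moreover have "pd b (\<lambda>z. p ((z - x) \<bullet> (z - x) / r - 1)) = (\<lambda>z. p' ((z - x) \<bullet> (z - x) / r - 1) * (2 / r * ((z - x) \<bullet> b)))"
      using pd_eqI[OF radial_derivative[OF assms(1)]] by (rule ext)
    ultimately show ?thesis by simp
  qed
  moreover have "(\<lambda>z. p ((z - x) \<bullet> (z - x) / r - 1)) differentiable (at z)" for z
    unfolding differentiable_def by (rule exI) (rule radial_derivative[OF assms(1)])
  ultimately show ?thesis unfolding C1_on_def by simp
qed

lemma bump_C1: "C1_on UNIV (bump x r)"
  unfolding bump_def[abs_def] by (rule radial_C1_on[OF cut_deriv isCont_cut'])

lemma pd_bump: "pd h (bump x r) z = cut' ((z - x) \<bullet> (z - x) / r\<^sup>2 - 1) * (2 / r\<^sup>2 * ((z - x) \<bullet> h))"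
  unfolding bump_def[abs_def] by (rule pd_eqI[OF radial_derivative[OF cut_deriv]])

lemma C1_on_linear: "C1_on UNIV (\<lambda>z::'a::euclidean_space. c * ((z - x) \<bullet> b) :: real)"
proof -
  have D: "((\<lambda>z. c * ((z - x) \<bullet> b)) has_derivative (\<lambda>h. c * (h \<bullet> b))) (at z)" for z
    by (auto intro!: derivative_eq_intros)
  then have "(\<lambda>z. pd h (\<lambda>z. c * ((z - x) \<bullet> b)) z) = (\<lambda>z. c * (h \<bullet> b))" for h
    using pd_eqI by blast
  then show ?thesis unfolding C1_on_def differentiable_def using D by auto
qed

lemma pd_bump_C1: "C1_on UNIV (pd h (bump x r))"
proof -
  have "C1_on UNIV (\<lambda>z. cut' ((z - x) \<bullet> (z - x) / r\<^sup>2 - 1) * (2 / r\<^sup>2 * ((z - x) \<bullet> h)))"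
    by (intro C1_on_mult radial_C1_on[OF cut'_deriv isCont_cut''] C1_on_linear)
  then show ?thesis by (simp add: pd_bump[abs_def])
qed

lemma bump_nonneg: "0 \<le> bump x r z" and bump_le_1: "bump x r z \<le> 1"
  by (simp_all add: bump_def cut_nonneg cut_le_1)

lemma bump_arg_le: "r > 0 \<Longrightarrow> dist x z \<le> r \<Longrightarrow> (z - x) \<bullet> (z - x) / r\<^sup>2 - 1 \<le> 0"
  by (simp add: dot_square_norm dist_norm norm_minus_commute power_mono)

lemma bump_arg_ge: "r > 0 \<Longrightarrow> 2 * r \<le> dist x z \<Longrightarrow> 1 \<le> (z - x) \<bullet> (z - x) / r\<^sup>2 - 1"
proof -
  assume "r > 0" "2 * r \<le> dist x z"
  then have "(2 * r)\<^sup>2 \<le> (norm (z - x))\<^sup>2" by (intro power_mono) (auto simp: dist_norm norm_minus_commute)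
  then have "4 * r\<^sup>2 \<le> (norm (z - x))\<^sup>2" by (simp add: power_mult_distrib)
  then have "2 * r\<^sup>2 \<le> (norm (z - x))\<^sup>2" using zero_le_power2[of r] by linarith
  then show ?thesis using \<open>r > 0\<close> by (simp add: dot_square_norm field_simps)
qed

lemma bump_eq_1: "r > 0 \<Longrightarrow> dist x z \<le> r \<Longrightarrow> bump x r z = 1"
  unfolding bump_def by (rule cut_eq_1[OF bump_arg_le])

lemma bump_eq_0: "r > 0 \<Longrightarrow> 2 * r \<le> dist x z \<Longrightarrow> bump x r z = 0"
  unfolding bump_def by (rule cut_eq_0[OF bump_arg_ge])

lemma pd_bump_eq_0: "r > 0 \<Longrightarrow> dist x z \<le> r \<or> 2 * r \<le> dist x z \<Longrightarrow> pd h (bump x r) z = 0"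
  unfolding pd_bump using cut'_eq_0 bump_arg_le[of r x z] bump_arg_ge[of r x z] by auto

definition cbump :: "'a::euclidean_space \<Rightarrow> real \<Rightarrow> 'a \<Rightarrow> complex" where
  "cbump x r z = of_real (bump x r z)"

lemma cbump_C1c:
  assumes "r > 0" "cball x (2 * r) \<subseteq> W" shows "C1c W (cbump x r)"
proof (rule C1cI[of _ "cball x (2 * r)"])
  show "C1_on UNIV (cbump x r)" unfolding cbump_def[abs_def] by (intro C1_on_of_real bump_C1)
qed (use assms in \<open>auto simp: cbump_def bump_eq_0\<close>)

lemma pd_cbump: "pd h (cbump x r) z = of_real (pd h (bump x r) z)"
  unfolding cbump_def[abs_def] using bump_C1[of x r] by (intro pd_of_real) (simp add: C1_on_def)

lemma pd_cbump_C1c: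
  assumes "r > 0" "cball x (2 * r) \<subseteq> W" shows "C1c W (pd h (cbump x r))"
proof (rule C1cI[of _ "cball x (2 * r)"])
  show "C1_on UNIV (pd h (cbump x r))" unfolding pd_cbump[abs_def] by (intro C1_on_of_real pd_bump_C1)
qed (use assms in \<open>auto simp: pd_cbump pd_bump_eq_0\<close>)


section \<open>Smooth kernels\<close>

definition hexp :: "nat \<Rightarrow> real \<Rightarrow> real" where
  "hexp k s = (if s > 0 then (1 / s) ^ k * exp (- 1 / s) else 0)"

lemma hexp_tendsto_0: "(hexp k \<longlongrightarrow> 0) (at 0)"
proof -
  have "((\<lambda>s. (inverse s) ^ k / exp (inverse s)) \<longlongrightarrow> (0::real)) (at_right 0)"
    by (rule filterlim_compose[OF tendsto_power_div_exp_0 filterlim_inverse_at_top_right])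
  then have "(hexp k \<longlongrightarrow> 0) (at_right 0)"
    by (rule Lim_transform_eventually)
      (auto simp: eventually_at_filter hexp_def exp_minus field_simps intro!: always_eventually)
  moreover have "(hexp k \<longlongrightarrow> 0) (at_left 0)"
    by (rule Lim_transform_eventually[OF tendsto_const])
      (auto simp: eventually_at_filter hexp_def intro!: always_eventually)
  ultimately show ?thesis by (simp add: filterlim_split_at)
qed

text \<open>The powers of \<open>1 / s\<close> make the family closed under differentiation. At 0
  the slope function is \<open>hexp (Suc k)\<close>, continuous because the exponential beats every
  power.\<close>

lemma hexp_deriv: "(hexp k has_real_derivative hexp (k + 2) s - real k * hexp (k + 1) s) (at s)"
proof -
  consider "s > 0" | "s < 0" | "s = 0" by linarith
  then show ?thesis
  proof cases
    case 1
    have "((\<lambda>s. (1 / s) ^ k * exp (- 1 / s)) has_real_derivative hexp (k + 2) s - real k * hexp (k + 1) s) (at s)"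
    proof -
      have i: "((\<lambda>s. 1 / s) has_real_derivative - ((1 / s)\<^sup>2)) (at s)"
        using 1 by (auto intro!: derivative_eq_intros simp: power2_eq_square)
      then have "((\<lambda>s. - 1 / s) has_real_derivative (1 / s)\<^sup>2) (at s)"
        using DERIV_minus[OF i] by simp
      from DERIV_fun_exp[OF this]
      have e: "((\<lambda>s. exp (- 1 / s)) has_real_derivative exp (- 1 / s) * (1 / s)\<^sup>2) (at s)" .
      have "((\<lambda>s. (1 / s) ^ k) has_real_derivative - real k * (1 / s) ^ (k + 1)) (at s)"
      proof (cases k)
        case (Suc j)
        from DERIV_power_Suc[OF i, of j] show ?thesis
          unfolding Suc by (rule DERIV_cong) (simp add: power2_eq_square divide_inverse, simp add: algebra_simps)
      qed simp
      from DERIV_mult[OF this e] show ?thesis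
        by (rule DERIV_cong) (use 1 in \<open>simp add: hexp_def power_add power2_eq_square algebra_simps\<close>)
    qed
    then show ?thesis
      by (rule has_field_derivative_transform_within_open[of _ _ s "{0<..}"]) (use 1 in \<open>auto simp: hexp_def\<close>)
  next
    case 2
    have "((\<lambda>s::real. 0) has_real_derivative hexp (k + 2) s - real k * hexp (k + 1) s) (at s)"
      using 2 by (simp add: hexp_def)
    then show ?thesis
      by (rule has_field_derivative_transform_within_open[of _ _ s "{..<0}"]) (use 2 in \<open>auto simp: hexp_def\<close>)
  next
    case 3
    have "isCont (hexp (Suc k)) 0"
      using hexp_tendsto_0[of "Suc k"] unfolding isCont_def by (simp add: hexp_def)
    then have "\<exists>g. (\<forall>z. hexp k z - hexp k s = g z * (z - s)) \<and> isCont g s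
        \<and> g s = hexp (k + 2) s - real k * hexp (k + 1) s"
      using 3 by (intro exI[of _ "hexp (Suc k)"]) (auto simp: hexp_def)
    then show ?thesis by (simp only: CARAT_DERIV)
  qed
qed

text \<open>The mollifiers belong to this algebra; as it is closed under partial derivatives, they are smooth.\<close>

inductive bump_algebra :: "real \<Rightarrow> ('a::euclidean_space \<Rightarrow> real) \<Rightarrow> bool" for c where
  const: "bump_algebra c (\<lambda>_. a)"
| lin: "bump_algebra c (\<lambda>x. x \<bullet> b)"
| add: "bump_algebra c f \<Longrightarrow> bump_algebra c g \<Longrightarrow> bump_algebra c (\<lambda>x. f x + g x)"
| mult: "bump_algebra c f \<Longrightarrow> bump_algebra c g \<Longrightarrow> bump_algebra c (\<lambda>x. f x * g x)"
| hexp: "bump_algebra c (\<lambda>x. hexp k (c - x \<bullet> x))"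

lemma bump_algebra_derivative:
  assumes "bump_algebra c f"
  obtains f' where "\<And>x. (f has_derivative f' x) (at x)" "\<And>b. bump_algebra c (\<lambda>x. f' x b)"
proof -
  have "\<exists>f'. (\<forall>x. (f has_derivative f' x) (at x)) \<and> (\<forall>b. bump_algebra c (\<lambda>x. f' x b))"
    using assms
  proof induction
    case (const a)
    then show ?case by (intro exI[of _ "\<lambda>x h. 0"]) (auto intro: bump_algebra.intros)
  next
    case (lin b)
    then show ?case
      by (intro exI[of _ "\<lambda>x h. h \<bullet> b"]) (auto intro: bump_algebra.intros intro!: derivative_eq_intros)
  next
    case (add f g)
    then obtain f' g' where "\<And>x. (f has_derivative f' x) (at x)" "\<And>b. bump_algebra c (\<lambda>x. f' x b)"
       "\<And>x. (g has_derivative g' x) (at x)" "\<And>b. bump_algebra c (\<lambda>x. g' x b)" by blast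
    then show ?case
      by (intro exI[of _ "\<lambda>x h. f' x h + g' x h"]) (auto intro: bump_algebra.intros has_derivative_add)
  next
    case (mult f g)
    then obtain f' g' where *: "\<And>x. (f has_derivative f' x) (at x)" "\<And>b. bump_algebra c (\<lambda>x. f' x b)"
       "\<And>x. (g has_derivative g' x) (at x)" "\<And>b. bump_algebra c (\<lambda>x. g' x b)" by blast
    then have "((\<lambda>x. f x * g x) has_derivative (\<lambda>h. f x * g' x h + f' x h * g x)) (at x)" for x
      by (intro has_derivative_mult)
    then show ?case using * mult.hyps
      by (intro exI[of _ "\<lambda>x h. f x * g' x h + f' x h * g x"]) (auto intro!: bump_algebra.intros)
  next
    case (hexp k)
    have D: "((\<lambda>x. hexp k (c - x \<bullet> x)) has_derivative
       (\<lambda>h. (hexp (k + 2) (c - x \<bullet> x) + (- real k) * hexp (k + 1) (c - x \<bullet> x)) * (-2 * (x \<bullet> h)))) (at x)" for x :: 'a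
    proof -
      have "((\<lambda>x. c - x \<bullet> x) has_derivative (\<lambda>h. -2 * (x \<bullet> h))) (at x)"
        by (auto intro!: derivative_eq_intros simp: inner_commute)
      from has_derivative_compose[OF this hexp_deriv[unfolded has_field_derivative_def]]
      show ?thesis by (rule has_derivative_eq_rhs) (simp add: fun_eq_iff)
    qed
    have "bump_algebra c (\<lambda>x. (hexp (k + 2) (c - x \<bullet> x) + (- real k) * hexp (k + 1) (c - x \<bullet> x)) * (-2 * (x \<bullet> h)))" for h :: 'a
      by (intro bump_algebra.intros)
    with D show ?case
      by (intro exI[of _ "\<lambda>x h. (hexp (k + 2) (c - x \<bullet> x) + (- real k) * hexp (k + 1) (c - x \<bullet> x)) * (-2 * (x \<bullet> h))"] conjI allI)
  qed
  then show ?thesis using that by blast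
qed

lemma bump_algebra_pd: "bump_algebra c f \<Longrightarrow> bump_algebra c (pd b f)"
proof -
  assume "bump_algebra c f"
  then obtain f' where f': "\<And>x. (f has_derivative f' x) (at x)" "\<And>b. bump_algebra c (\<lambda>x. f' x b)"
    by (rule bump_algebra_derivative) blast
  have "pd b f = (\<lambda>x. f' x b)" using pd_eqI[OF f'(1)] by auto
  then show ?thesis using f' by simp
qed

lemma bump_algebra_differentiable: "bump_algebra c f \<Longrightarrow> f differentiable (at x)"
  by (erule bump_algebra_derivative) (auto simp: differentiable_def)

lemma bump_algebra_C1: "bump_algebra c f \<Longrightarrow> C1_on UNIV f"
  unfolding C1_on_def
  by (metis bump_algebra_pd bump_algebra_differentiable continuous_at_imp_continuous_on differentiable_imp_continuous_within)

lemma uniformly_continuous_compact_supp: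
  fixes g :: "'a::euclidean_space \<Rightarrow> 'b::metric_space"
  assumes g: "continuous_on UNIV g" and K: "\<And>x. norm x > r \<Longrightarrow> g x = a" and e: "e > 0"
  obtains d where "d > 0" "\<And>x y. dist x y < d \<Longrightarrow> dist (g x) (g y) < e"
proof -
  have "uniformly_continuous_on (cball 0 (r + 1)) g"
    using g by (intro compact_uniformly_continuous) (auto intro: continuous_on_subset)
  then obtain d where d: "d > 0" "\<And>x y. x \<in> cball 0 (r + 1) \<Longrightarrow> y \<in> cball 0 (r + 1) \<Longrightarrow> dist x y < d \<Longrightarrow> dist (g x) (g y) < e"
    using e unfolding uniformly_continuous_on_def by metis
  have "dist (g x) (g y) < e" if xy: "dist x y < min d 1" for x y
  proof (cases "x \<in> cball 0 (r + 1) \<and> y \<in> cball 0 (r + 1)")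
    case True then show ?thesis using d xy by auto
  next
    case False
    \<comment> \<open>If one point is outside the larger ball, both are outside the ball of radius
      \<open>r\<close>, where \<open>g\<close> has the constant value \<open>a\<close>.\<close>
    have "norm x \<le> norm y + 1" "norm y \<le> norm x + 1"
      using xy norm_triangle_ineq2[of x y] norm_triangle_ineq2[of y x]
      by (auto simp: dist_norm norm_minus_commute)
    then have "norm x > r" "norm y > r" using False by auto
    then show ?thesis using K e by simp
  qed
  then show ?thesis using that[of "min d 1"] d by auto
qed

lemma AE_lebesgue_iff: "(AE x in lebesgue. P x) \<longleftrightarrow> negligible {x. \<not> P x}"
proof
  assume "AE x in lebesgue. P x"
  then obtain N where "N \<in> null_sets lebesgue" "{x. \<not> P x} \<subseteq> N"
    unfolding eventually_ae_filter by auto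
  then show "negligible {x. \<not> P x}" using negligible_subset negligible_iff_null_sets by blast
next
  assume "negligible {x. \<not> P x}"
  then show "AE x in lebesgue. P x"
    unfolding eventually_ae_filter negligible_iff_null_sets by (intro bexI[of _ "{x. \<not> P x}"]) auto
qed

section \<open>Convolution and mollification\<close>

definition conv :: "('a::euclidean_space \<Rightarrow> real) \<Rightarrow> ('a \<Rightarrow> complex) \<Rightarrow> 'a \<Rightarrow> complex" where
  "conv s g z = (\<integral>t. s (z - t) *\<^sub>R g t \<partial>lebesgue)"

lemma conv_integrable:
  fixes s :: "'a::euclidean_space \<Rightarrow> real" and g :: "'a \<Rightarrow> complex"
  assumes s: "continuous_on UNIV s" and r: "\<And>x. norm x > r \<Longrightarrow> s x = 0" and g: "integrable lebesgue g"
  shows "integrable lebesgue (\<lambda>t. s (z - t) *\<^sub>R g t)"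
proof -
  obtain C where C: "C > 0" "\<And>x. norm (s x) \<le> C"
    using compact_supp_bound[of s "cball 0 r"] s r by auto
  have m: "(\<lambda>t. s (z - t)) \<in> borel_measurable lebesgue"
    by (intro measurable_completion)
      (auto intro!: borel_measurable_continuous_onI continuous_intros continuous_on_compose2[OF s])
  show ?thesis
  proof (rule Bochner_Integration.integrable_bound[of _ "\<lambda>t. C * norm (g t)"])
    show "AE x in lebesgue. norm (s (z - x) *\<^sub>R g x) \<le> norm (C * norm (g x))"
      using C by (auto intro!: mult_right_mono AE_I2)
  qed (use g m in auto)
qed

text \<open>The derivative falls on the kernel, so \<open>g\<close> need only be integrable. Uniform
  continuity of the kernel's gradient makes the first-order remainder at most
  \<open>e' * norm h\<close> uniformly in the point, and this is integrated against
  \<open>norm (g t)\<close>.\<close>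

lemma conv_has_derivative:
  fixes s :: "'a::euclidean_space \<Rightarrow> real" and g :: "'a \<Rightarrow> complex"
  assumes s: "C1_on UNIV s" and r: "\<And>x. norm x > r \<Longrightarrow> s x = 0" and g: "integrable lebesgue g"
  shows "(conv s g has_derivative (\<lambda>h. conv (pd h s) g z)) (at z)"
proof -
  have d: "s differentiable (at x)" for x using s by (simp add: C1_on_def)
  have cs: "continuous_on UNIV s" using C1_on_continuous[OF s] .
  have cp: "continuous_on UNIV (pd b s)" if "b \<in> Basis" for b using s that by (simp add: C1_on_def)
  have rp: "pd b s x = 0" if "norm x > r" for x b
    using pd_cong_open[of "- cball 0 r" x s "\<lambda>_. 0" b] r that by (auto simp: open_Compl)
  \<comment> \<open>The gradient of the kernel, taken as a vector field so that one modulus of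
    continuity serves all directions \<open>h\<close>.\<close>
  define gr where "gr x = (\<Sum>b\<in>Basis. pd b s x *\<^sub>R b)" for x
  have cgr: "continuous_on UNIV gr" unfolding gr_def using cp by (intro continuous_intros) auto
  have pgr: "pd h s x = h \<bullet> gr x" for h x
    unfolding gr_def pd_sum_Basis[OF d, of h] by (simp add: inner_sum_right mult.commute)
  have int_p: "integrable lebesgue (\<lambda>t. pd h s (z - t) *\<^sub>R g t)" for h z
    by (rule conv_integrable[OF _ rp g]) (auto simp: pgr[abs_def] intro!: continuous_intros cgr)
  have "bounded_linear (\<lambda>h. conv (pd h s) g z)"
  proof -
    have "conv (pd h s) g z = (\<Sum>b\<in>Basis. (h \<bullet> b) *\<^sub>R conv (pd b s) g z)" for h
    proof -
      have "conv (pd h s) g z = (\<integral>t. (\<Sum>b\<in>Basis. (h \<bullet> b) *\<^sub>R (pd b s (z - t) *\<^sub>R g t)) \<partial>lebesgue)"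
        unfolding conv_def pd_sum_Basis[OF d, of h] by (simp add: scaleR_left.sum)
      also have "\<dots> = (\<Sum>b\<in>Basis. \<integral>t. (h \<bullet> b) *\<^sub>R (pd b s (z - t) *\<^sub>R g t) \<partial>lebesgue)"
        using int_p by (intro Bochner_Integration.integral_sum integrable_scaleR_right)
      finally show ?thesis unfolding conv_def by (simp only: Bochner_Integration.integral_scaleR_right)
    qed
    then have eq: "(\<lambda>h. conv (pd h s) g z) = (\<lambda>h. \<Sum>b\<in>Basis. (h \<bullet> b) *\<^sub>R conv (pd b s) g z)" by (rule ext)
    show ?thesis unfolding eq
      by (intro bounded_linear_sum bounded_linear_compose[OF bounded_linear_scaleR_left bounded_linear_inner_left])
  qed
  moreover have "\<exists>\<delta>>0. \<forall>y. norm (y - z) < \<delta> \<longrightarrow>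
      norm (conv s g y - conv s g z - conv (pd (y - z) s) g z) \<le> e * norm (y - z)" if e: "e > 0" for e
  proof -
    define I where "I = (\<integral>t. norm (g t) \<partial>lebesgue)"
    have I: "I \<ge> 0" unfolding I_def by simp
    \<comment> \<open>Adding 1 to \<open>I\<close> keeps the quotient meaningful when
      \<open>g\<close> vanishes almost everywhere.\<close>
    define e' where "e' = e / (I + 1)"
    have e': "e' > 0" "e' * I \<le> e" using e I by (auto simp: e'_def field_simps)
    have gr0: "gr x = 0" if "norm x > r" for x using rp[OF that] by (simp add: gr_def)
    obtain \<delta> where \<delta>: "\<delta> > 0" "\<And>x y. dist x y < \<delta> \<Longrightarrow> dist (gr x) (gr y) < e'"
      using uniformly_continuous_compact_supp[OF cgr gr0 e'(1)] by blast
    have "norm (conv s g y - conv s g z - conv (pd (y - z) s) g z) \<le> e * norm (y - z)" if y: "norm (y - z) < \<delta>" for y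
    proof -
      let ?h = "y - z"
      have inc: "norm (s (w + ?h) - s w - pd ?h s w) \<le> e' * norm ?h" for w
      proof (rule increment_bound[OF d])
        fix t :: real assume t: "t \<in> {0<..<1}"
        have "dist (w + t *\<^sub>R ?h) w < \<delta>" using t y mult_right_mono[of t 1 "norm ?h"] by (auto simp: dist_norm)
        then have *: "norm (gr (w + t *\<^sub>R ?h) - gr w) \<le> e'" using \<delta>(2)[of "w + t *\<^sub>R ?h" w] by (simp add: dist_norm)
        have "norm (pd ?h s (w + t *\<^sub>R ?h) - pd ?h s w) = norm (?h \<bullet> (gr (w + t *\<^sub>R ?h) - gr w))"
          by (simp add: pgr inner_diff_right)
        also have "\<dots> \<le> norm ?h * norm (gr (w + t *\<^sub>R ?h) - gr w)" using Cauchy_Schwarz_ineq2 by simp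
        also have "\<dots> \<le> e' * norm ?h" using mult_left_mono[OF *, of "norm ?h"] by (simp add: mult.commute)
        finally show "norm (pd ?h s (w + t *\<^sub>R ?h) - pd ?h s w) \<le> e' * norm ?h" .
      qed
      have "conv s g y - conv s g z - conv (pd ?h s) g z =
          (\<integral>t. (s (y - t) *\<^sub>R g t - s (z - t) *\<^sub>R g t) - pd ?h s (z - t) *\<^sub>R g t \<partial>lebesgue)"
        unfolding conv_def using conv_integrable[OF cs r g] int_p by (simp del: right_diff_distrib)
      also have "norm \<dots> \<le> (\<integral>t. e' * norm ?h * norm (g t) \<partial>lebesgue)"
      proof (rule Bochner_Integration.integral_norm_bound_integral)
        fix t
        have "(s (y - t) *\<^sub>R g t - s (z - t) *\<^sub>R g t) - pd ?h s (z - t) *\<^sub>R g t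
          = (s ((z - t) + ?h) - s (z - t) - pd ?h s (z - t)) *\<^sub>R g t" by (simp add: algebra_simps)
        then show "norm ((s (y - t) *\<^sub>R g t - s (z - t) *\<^sub>R g t) - pd ?h s (z - t) *\<^sub>R g t) \<le> e' * norm ?h * norm (g t)"
          using inc[of "z - t"] by (simp add: mult_right_mono del: add_diff_cancel diff_add_cancel)
      qed (use conv_integrable[OF cs r g] int_p g in auto)
      also have "\<dots> = (e' * I) * norm ?h" unfolding I_def by simp
      also have "\<dots> \<le> e * norm ?h" by (intro mult_right_mono e') auto
      finally show ?thesis .
    qed
    then show ?thesis using \<delta>(1) by blast
  qed
  ultimately show ?thesis unfolding has_derivative_at_alt by blast
qed

lemma pd_conv:
  assumes "C1_on UNIV s" "\<And>x. norm x > r \<Longrightarrow> s x = 0" "integrable lebesgue g"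
  shows "pd b (conv s g) z = conv (pd b s) g z"
  by (rule pd_eqI[OF conv_has_derivative[OF assms]])

lemma pd_outside_ball:
  assumes "\<And>x. norm x > r \<Longrightarrow> s x = 0" "norm x > r"
  shows "pd b s x = 0"
  using pd_cong_open[of "- cball 0 r" x s "\<lambda>_. 0" b] assms by (auto simp: open_Compl)

text \<open>Each derivative falls on the kernel and \<open>bump_algebra\<close> is closed under
  \<open>pd\<close>, so the induction on \<open>p\<close> runs with an arbitrary kernel.\<close>

lemma conv_C_on:
  assumes "bump_algebra c s" "\<And>x. norm x > r \<Longrightarrow> s x = 0" "integrable lebesgue g"
  shows "C_on p UNIV (conv s g)"
  using assms(1,2)
proof (induction p arbitrary: s)
  case 0
  then show ?case
    using has_derivative_continuous[OF conv_has_derivative[OF bump_algebra_C1[OF 0(1)] 0(2) assms(3)]]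
    by (simp add: continuous_at_imp_continuous_on)
next
  case (Suc p)
  note D = conv_has_derivative[OF bump_algebra_C1[OF Suc.prems(1)] Suc.prems(2) assms(3)]
  have "C_on p UNIV (\<lambda>x. frechet_derivative (conv s g) (at x) b)" for b
  proof -
    have "C_on p UNIV (conv (pd b s) g)"
      by (rule Suc.IH[OF bump_algebra_pd[OF Suc.prems(1)] pd_outside_ball[OF Suc.prems(2)]])
    moreover have "conv (pd b s) g = (\<lambda>x. frechet_derivative (conv s g) (at x) b)"
      using pd_eqI[OF D] unfolding pd_def by auto
    ultimately show ?thesis by simp
  qed
  then show ?case using D by (auto simp: differentiable_def)
qed

text \<open>A convolution at \<open>z\<close> is an integral against
  \<open>t \<mapsto> s (z - t)\<close>. The minus sign from the reflection cancels the one from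
  integration by parts, so derivatives pass freely between kernel and function.\<close>

lemma reflected_kernel:
  fixes s :: "'a::euclidean_space \<Rightarrow> real"
  assumes s: "C1_on UNIV s"
  shows "C1_on UNIV (\<lambda>t. of_real (s (z - t)) :: complex)"
    and "pd b (\<lambda>t. of_real (s (z - t)) :: complex) t = - of_real (pd b s (z - t))"
proof -
  have D: "((\<lambda>t. s (z - t)) has_derivative (\<lambda>h. - pd h s (z - t))) (at t)" for t
  proof -
    have d: "s differentiable (at (z - t))" using s by (simp add: C1_on_def)
    have "((\<lambda>t. z - t) has_derivative (\<lambda>h. - h)) (at t)" by (auto intro!: derivative_eq_intros)
    from has_derivative_compose[OF this has_derivative_pd[OF d]] show ?thesis
      using linear_neg[OF linear_pd[OF d]] by simp
  qed
  then have pdR: "pd h (\<lambda>t. s (z - t)) t = - pd h s (z - t)" for h t by (rule pd_eqI)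
  have "C1_on UNIV (\<lambda>t. s (z - t))"
    unfolding C1_on_def
  proof (intro conjI ballI)
    show "(\<lambda>t. s (z - t)) differentiable (at x)" for x using D unfolding differentiable_def by blast
    fix b :: 'a assume "b \<in> Basis"
    then have "continuous_on UNIV (pd b s)" using s by (simp add: C1_on_def)
    from continuous_on_compose2[OF this, of UNIV "\<lambda>t. z - t"]
    have "continuous_on UNIV (\<lambda>t. pd b s (z - t))" by (simp add: continuous_on_op_minus)
    then show "continuous_on UNIV (pd b (\<lambda>t. s (z - t)))"
      unfolding pdR[abs_def] by (intro continuous_intros)
  qed
  then show "C1_on UNIV (\<lambda>t. of_real (s (z - t)) :: complex)" by (rule C1_on_of_real)
  have "(\<lambda>t. s (z - t)) differentiable (at t)" using D unfolding differentiable_def by blast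
  then show "pd b (\<lambda>t. of_real (s (z - t)) :: complex) t = - of_real (pd b s (z - t))"
    by (simp add: pd_of_real pdR)
qed

text \<open>The standard mollifier with support in the ball of radius \<open>e\<close>, written so
  that it lies in \<open>bump_algebra\<close>.\<close>

definition ker :: "real \<Rightarrow> 'a::euclidean_space \<Rightarrow> real" where
  "ker e t = (1 / (\<integral>t. hexp 0 (e\<^sup>2 - t \<bullet> (t :: 'a)) \<partial>lebesgue)) * hexp 0 (e\<^sup>2 - t \<bullet> t)"

lemma hexp_nonneg: "0 \<le> hexp k s" by (simp add: hexp_def)

context
  fixes e :: real assumes e: "e > 0"
begin

lemma bump_algebra_ker: "bump_algebra (e\<^sup>2) (ker e)"
  unfolding ker_def[abs_def] by (intro bump_algebra.intros)

lemma ker_eq_0: "norm t \<ge> e \<Longrightarrow> ker e t = 0"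
proof -
  assume "norm t \<ge> e"
  then have "e\<^sup>2 \<le> (norm t)\<^sup>2" using e by (intro power_mono) auto
  then show ?thesis by (simp add: ker_def hexp_def dot_square_norm)
qed

text \<open>A nonnegative function with integral 0 vanishes almost everywhere, but this one is
  positive on a ball.\<close>

lemma hexp_ball_integral_pos: "(\<integral>t. hexp 0 (e\<^sup>2 - t \<bullet> (t :: 'a::euclidean_space)) \<partial>lebesgue) > 0"
proof -
  let ?f = "\<lambda>t::'a. hexp 0 (e\<^sup>2 - t \<bullet> t)"
  have c: "continuous_on UNIV ?f"
    using C1_on_continuous[OF bump_algebra_C1[OF bump_algebra.hexp[of "e\<^sup>2" 0]]] .
  have 0: "?f t = 0" if "t \<notin> cball 0 e" for t
  proof -
    have "e\<^sup>2 \<le> (norm t)\<^sup>2" using e that by (intro power_mono) auto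
    then show ?thesis by (simp add: hexp_def dot_square_norm)
  qed
  have i: "integrable lebesgue ?f" using integrable_continuous_compact(1)[OF c compact_cball 0] .
  have "(\<integral>t. ?f t \<partial>lebesgue) \<noteq> 0"
  proof
    assume "(\<integral>t. ?f t \<partial>lebesgue) = 0"
    then have "AE t in lebesgue. ?f t = 0"
      using integral_nonneg_eq_0_iff_AE[OF i] hexp_nonneg by auto
    then have "negligible {t. ?f t \<noteq> 0}"
      by (simp add: AE_lebesgue_iff)
    moreover have "ball 0 e \<subseteq> {t. ?f t \<noteq> 0}"
    proof
      fix t :: 'a assume "t \<in> ball 0 e"
      then have "(norm t)\<^sup>2 < e\<^sup>2" by (intro power_strict_mono) auto
      then show "t \<in> {t. ?f t \<noteq> 0}" by (simp add: hexp_def dot_square_norm)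
    qed
    ultimately have "negligible (ball (0::'a) e)" by (rule negligible_subset)
    then show False using open_not_negligible[of "ball (0::'a) e"] e by auto
  qed
  moreover have "(\<integral>t. ?f t \<partial>lebesgue) \<ge> 0" by (intro integral_nonneg_AE) (simp add: hexp_nonneg)
  ultimately show ?thesis by simp
qed

lemma ker_nonneg: "0 \<le> ker e t"
  unfolding ker_def using hexp_ball_integral_pos hexp_nonneg by (auto intro!: mult_nonneg_nonneg less_imp_le)

lemma ker_C1: "C1_on UNIV (ker e)" by (rule bump_algebra_C1[OF bump_algebra_ker])

lemma ker_continuous: "continuous_on UNIV (ker e)" by (rule C1_on_continuous[OF ker_C1])

lemma ker_eq_0': "norm t > e \<Longrightarrow> ker e t = 0" by (rule ker_eq_0) simp

lemma integrable_ker: "integrable lebesgue (\<lambda>t. ker e (z - t))"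
  by (rule integrable_continuous_compact(1)[of _ "cball z e"])
    (auto simp: dist_norm ker_eq_0 intro!: continuous_intros continuous_on_compose2[OF ker_continuous])

lemma integral_ker: "(\<integral>t. ker e (z - t) \<partial>lebesgue) = 1"
proof -
  have "ker e (z - t) = ker e (t + (- z))" for t
    unfolding ker_def by (simp add: inner_diff_left inner_diff_right inner_commute algebra_simps)
  then have "(\<integral>t. ker e (z - t) \<partial>lebesgue) = (\<integral>t. ker e (t + (- z)) \<partial>lebesgue)" by simp
  also have "\<dots> = (\<integral>t. ker e (t :: 'a) \<partial>lebesgue)"
    by (rule integral_shift[OF borel_measurable_continuous_onI[OF ker_continuous]])
  also have "\<dots> = 1" using hexp_ball_integral_pos unfolding ker_def
    by (subst Bochner_Integration.integral_mult_right_zero) (use hexp_ball_integral_pos[where 'a='a] in force)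
  finally show ?thesis .
qed

text \<open>The kernel is a probability density on the ball of radius \<open>e\<close>, so a local
  average stays as close to \<open>a\<close> as the values do. Pointwise convergence, boundedness
  and vanishing of mollified functions are all instances. The bound is required almost everywhere
  only, since it will be known off the interfaces.\<close>

lemma conv_ker_near:
  assumes g: "integrable lebesgue g" and C: "AE t in lebesgue. dist z t < e \<longrightarrow> norm (g t - a) \<le> C"
  shows "norm (conv (ker e) g z - a) \<le> C"
proof -
  have i: "integrable lebesgue (\<lambda>t. ker e (z - t) *\<^sub>R g t)"
    by (rule conv_integrable[OF ker_continuous ker_eq_0' g])
  have ia: "integrable lebesgue (\<lambda>t. ker e (z - t) *\<^sub>R a)" using integrable_ker[of z] by auto
  have "(\<integral>t. ker e (z - t) *\<^sub>R a \<partial>lebesgue) = a"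
    using integral_ker[of z] integrable_ker[of z] by simp
  then have "conv (ker e) g z - a = (\<integral>t. ker e (z - t) *\<^sub>R g t - ker e (z - t) *\<^sub>R a \<partial>lebesgue)"
    unfolding conv_def using i ia by (simp del: integral_scaleR_left)
  also have "norm \<dots> \<le> (\<integral>t. norm (ker e (z - t) *\<^sub>R g t - ker e (z - t) *\<^sub>R a) \<partial>lebesgue)"
    by (rule integral_norm_bound)
  also have "\<dots> \<le> (\<integral>t. ker e (z - t) * C \<partial>lebesgue)"
  proof (rule integral_mono_AE)
    show "AE t in lebesgue. norm (ker e (z - t) *\<^sub>R g t - ker e (z - t) *\<^sub>R a) \<le> ker e (z - t) * C"
      using C
    proof eventually_elim
      case (elim t)
      show ?case
      proof (cases "dist z t < e")
        case True
        have "ker e (z - t) *\<^sub>R g t - ker e (z - t) *\<^sub>R a = ker e (z - t) *\<^sub>R (g t - a)" by (simp add: scaleR_diff_right)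
        then show ?thesis using elim True ker_nonneg[of "z - t"] by (simp add: mult_left_mono)
      next
        case False
        then show ?thesis using ker_eq_0[of "z - t"] by (simp add: dist_norm)
      qed
    qed
  qed (use i ia integrable_ker[of z] in \<open>auto intro!: Bochner_Integration.integrable_diff\<close>)
  also have "\<dots> = C" using integral_ker[of z] by simp
  finally show ?thesis .
qed

lemma conv_ker_eq_0:
  assumes g: "integrable lebesgue g" and "\<And>t. dist z t < e \<Longrightarrow> g t = 0"
  shows "conv (ker e) g z = 0"
  using conv_ker_near[OF g, of z 0 0] assms(2) by auto

end

lemma conv_pd_right:
  assumes g: "C1c W g" and b: "b \<in> Basis" and s: "C1_on UNIV s" and r: "\<And>x. norm x > r \<Longrightarrow> s x = 0"
  shows "conv s (pd b g) z = conv (pd b s) g z"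
proof -
  have c: "C1c UNIV g" using g by (simp add: C1c_def)
  note v = reflected_kernel(1)[OF s, of z]
  let ?v = "\<lambda>t. of_real (s (z - t)) :: complex"
  have "pd b (\<lambda>t. ?v t * g t) t = - (pd b s (z - t) *\<^sub>R g t) + s (z - t) *\<^sub>R pd b g t" for t
    by (simp add: C1c_mult_pd[OF open_UNIV v c] reflected_kernel(2)[OF s] scaleR_conv_of_real)
  moreover have "(\<integral>t. pd b (\<lambda>t. ?v t * g t) t \<partial>lebesgue) = 0"
    by (rule integral_pd_zero[OF C1c_mult[OF open_UNIV v c] b])
  ultimately have *: "(\<integral>t. - (pd b s (z - t) *\<^sub>R g t) + s (z - t) *\<^sub>R pd b g t \<partial>lebesgue) = 0" by simp
  have ig: "integrable lebesgue g" "integrable lebesgue (pd b g)"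
    using integrable_continuous_compact(1)[OF C1c_continuous[OF g] C1c_compact[OF g]]
      integrable_continuous_compact(1)[OF C1c_pd_continuous[OF g b] C1c_compact[OF g]]
    by (auto simp: not_in_supp pd_not_in_supp)
  have "integrable lebesgue (\<lambda>t. pd b s (z - t) *\<^sub>R g t)"
    by (rule conv_integrable[OF _ pd_outside_ball[OF r] ig(1)]) (use s b in \<open>auto simp: C1_on_def\<close>)
  moreover have "integrable lebesgue (\<lambda>t. s (z - t) *\<^sub>R pd b g t)"
    by (rule conv_integrable[OF C1_on_continuous[OF s] r ig(2)])
  ultimately show ?thesis using * unfolding conv_def by simp
qed

section \<open>Weak formulation\<close>

text \<open>Stated at a single point of continuity, because it is applied to right-hand sides that
  may jump across interfaces.\<close>

lemma conv_ker_tendsto: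
  fixes g :: "'a::euclidean_space \<Rightarrow> complex"
  assumes g: "integrable lebesgue g" and c: "isCont g z" and e: "\<And>n. e n > 0" "e \<longlonglongrightarrow> 0"
  shows "(\<lambda>n. conv (ker (e n)) g z) \<longlonglongrightarrow> g z"
proof (rule LIMSEQ_I)
  fix r :: real assume r: "r > 0"
  then obtain d where d: "d > 0" "\<And>t. dist t z < d \<Longrightarrow> dist (g t) (g z) < r / 2"
    using c[unfolded continuous_at_eps_delta] half_gt_zero[OF r] by blast
  obtain n0 where n0: "\<And>n. n \<ge> n0 \<Longrightarrow> norm (e n - 0) < d" using LIMSEQ_D[OF e(2) d(1)] by blast
  show "\<exists>n0. \<forall>n\<ge>n0. norm (conv (ker (e n)) g z - g z) < r"
  proof (intro exI[of _ n0] allI impI)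
    fix n assume n: "n \<ge> n0"
    have "norm (conv (ker (e n)) g z - g z) \<le> r / 2"
    proof (rule conv_ker_near[OF e(1) g])
      show "AE t in lebesgue. dist z t < e n \<longrightarrow> norm (g t - g z) \<le> r / 2"
        using d(2) n0[OF n] e(1)[of n] by (intro AE_I2) (auto simp: dist_norm norm_minus_commute less_imp_le)
    qed
    then show "norm (conv (ker (e n)) g z - g z) < r" using r by simp
  qed
qed

lemma conv_ker_bound:
  assumes "e > 0" "integrable lebesgue g" "AE t in lebesgue. norm (g t) \<le> C"
  shows "norm (conv (ker e) g z) \<le> C"
proof -
  have "AE t in lebesgue. dist z t < e \<longrightarrow> norm (g t - 0) \<le> C" using assms(3) by eventually_elim simp
  from conv_ker_near[OF assms(1,2) this] show ?thesis by simp
qed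

lemma C1c_integrable:
  fixes g :: "'a::euclidean_space \<Rightarrow> complex"
  assumes "C1c W g" shows "integrable lebesgue g"
  using integrable_continuous_compact(1)[OF C1c_continuous[OF assms] C1c_compact[OF assms]] not_in_supp[of _ g]
  by blast

lemma C1c_pd_integrable:
  fixes g :: "'a::euclidean_space \<Rightarrow> complex"
  assumes "C1c W g" "b \<in> Basis" shows "integrable lebesgue (pd b g)"
  using integrable_continuous_compact(1)[OF C1c_pd_continuous[OF assms] C1c_compact[OF assms(1)]] pd_not_in_supp[of _ g b]
  by blast

definition vanish_seq :: "real \<Rightarrow> nat \<Rightarrow> real" where
  "vanish_seq d n = d / real (Suc n)"

lemma vanish_seq: "d > 0 \<Longrightarrow> vanish_seq d n > 0" "d > 0 \<Longrightarrow> vanish_seq d n \<le> d" "vanish_seq d \<longlonglongrightarrow> 0"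
proof -
  show "vanish_seq d \<longlonglongrightarrow> 0"
    unfolding vanish_seq_def[abs_def] using tendsto_mult[OF tendsto_const[of d] LIMSEQ_inverse_real_of_nat]
    by (simp add: divide_inverse)
  assume "d > 0"
  then show "vanish_seq d n > 0" "vanish_seq d n \<le> d"
    unfolding vanish_seq_def by (auto simp: field_simps)
qed

text \<open>Room for mollifying: radii up to \<open>d\<close> keep the support inside the compact
  \<open>L\<close>. Compactness of the closed neighbourhood comes from writing it as a sum of two
  compact sets.\<close>

lemma C1c_neighbourhood:
  fixes K W :: "'a::euclidean_space set"
  assumes "compact K" "open W" "K \<subseteq> W"
  obtains d L where "d > 0" "compact L" "L \<subseteq> W" "K \<subseteq> L" "\<And>x y. x \<in> K \<Longrightarrow> dist x y \<le> d \<Longrightarrow> y \<in> L"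
proof -
  obtain d where d: "d > 0" "(\<Union>x\<in>K. cball x d) \<subseteq> W"
    using compact_subset_open_imp_cball_epsilon_subset[OF assms] by blast
  have "(\<Union>x\<in>K. cball x d) = {x + y |x y. x \<in> K \<and> y \<in> cball 0 d}"
  proof -
    have "y \<in> {x + y |x y. x \<in> K \<and> y \<in> cball 0 d}" if "x \<in> K" "dist x y \<le> d" for x y
      using that by (intro CollectI exI[of _ x] exI[of _ "y - x"]) (auto simp: dist_norm norm_minus_commute)
    then show ?thesis by (auto simp: dist_norm)
  qed
  then have "compact (\<Union>x\<in>K. cball x d)" using compact_sums[OF assms(1) compact_cball[of 0 d]] by simp
  then show ?thesis using d(1) by (intro that[OF d(1) _ d(2)]) force+
qed

lemma conv_ker_vanish:
  assumes e: "0 < e" "e \<le> d" and g: "integrable lebesgue g"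
    and L: "\<And>x y. x \<in> supp g \<Longrightarrow> dist x y \<le> d \<Longrightarrow> y \<in> L" and z: "z \<notin> L"
  shows "conv (ker e) g z = 0"
proof (rule conv_ker_eq_0[OF e(1) g])
  fix t assume "dist z t < e"
  then show "g t = 0" using L[of t z] z e not_in_supp[of t g] by (force simp: dist_commute)
qed

lemma pd_conv_ker:
  assumes g: "C1c W g" and b: "b \<in> Basis" and e: "e > 0"
  shows "pd b (conv (ker e) g) z = conv (ker e) (pd b g) z"
  using pd_conv[OF ker_C1[OF e] ker_eq_0'[OF e] C1c_integrable[OF g], where b=b and z=z]
    conv_pd_right[OF g b ker_C1[OF e] ker_eq_0'[OF e], where z=z] by simp

text \<open>As \<open>g\<close> has only one derivative to give, one of the two falls on
  \<open>g\<close> and the other on the kernel.\<close>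

lemma pd_pd_conv_ker:
  assumes g: "C1c W g" and b: "b \<in> Basis" and e: "e > 0"
  shows "pd b (pd b (conv (ker e) g)) z = conv (pd b (ker e)) (pd b g) z"
  using pd_conv[OF ker_C1[OF e] ker_eq_0'[OF e] C1c_pd_integrable[OF g b], where b=b and z=z]
  by (simp add: pd_conv_ker[OF assms, abs_def])

lemma laplacian_pd: "laplacian f z = (\<Sum>b\<in>Basis. pd b (pd b f) z)"
  by (simp add: laplacian_def pd_def[abs_def])

lemma test_function_conv_ker:
  assumes g: "C1c W g" and e: "0 < e" "e \<le> d" and L: "compact L" "L \<subseteq> W"
    "\<And>x y. x \<in> supp g \<Longrightarrow> dist x y \<le> d \<Longrightarrow> y \<in> L"
  shows "test_function W (conv (ker e) g)"
proof -
  have 0: "conv (ker e) g x = 0" if "x \<notin> L" for x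
    by (rule conv_ker_vanish[OF e C1c_integrable[OF g] L(3) that])
  have s: "closure {x. conv (ker e) g x \<noteq> 0} \<subseteq> L"
    by (rule closure_minimal) (use 0 L(1) compact_imp_closed in auto)
  have "compact (L \<inter> closure {x. conv (ker e) g x \<noteq> 0})"
    using L(1) by (intro compact_Int_closed) auto
  then have "compact (closure {x. conv (ker e) g x \<noteq> 0})" using s by (simp add: Int_absorb1)
  moreover have "C_on p UNIV (conv (ker e) g)" for p
    by (rule conv_C_on[OF bump_algebra_ker[OF e(1)] ker_eq_0'[OF e(1)] C1c_integrable[OF g]])
  ultimately show ?thesis unfolding test_function_def using s L(2) by blast
qed

lemma test_function_C1c:
  assumes "test_function W \<phi>"
  shows "C1c W \<phi>" "b \<in> Basis \<Longrightarrow> C1c W (pd b \<phi>)"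
proof -
  have "C_on 1 UNIV \<phi>" using assms unfolding test_function_def by blast
  then show c: "C1c W \<phi>" using assms unfolding test_function_def C1c_def C_on_1 supp_def by blast
  assume b: "b \<in> Basis"
  have "C_on (Suc 1) UNIV \<phi>" using assms unfolding test_function_def by blast
  then have "C_on 1 UNIV (pd b \<phi>)" using b unfolding C_on.simps(2)[of 1] pd_def[abs_def] by blast
  then have "C1_on UNIV (pd b \<phi>)" unfolding C_on_1 .
  then show "C1c W (pd b \<phi>)"
    by (rule C1cI[OF _ C1c_compact[OF c] C1c_supp[OF c] pd_not_in_supp])
qed

text \<open>Bilinear, without conjugation: in Green's second identity the mixed gradient terms then
  cancel by symmetry.\<close>

definition gdot :: "('a::euclidean_space \<Rightarrow> complex) \<Rightarrow> ('a \<Rightarrow> complex) \<Rightarrow> 'a \<Rightarrow> complex" where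
  "gdot f g z = (\<Sum>b\<in>Basis. pd b f z * pd b g z)"

text \<open>The bare identity. As the integral of a non-integrable function is 0 by convention,
  regularity of \<open>v\<close> and integrability of \<open>f\<close> are supplied separately where
  integrals have to be split.\<close>

definition weak_lap :: "(real^2) set \<Rightarrow> (real^2 \<Rightarrow> complex) \<Rightarrow> (real^2 \<Rightarrow> complex) \<Rightarrow> bool" where
  "weak_lap W v f \<longleftrightarrow>
    (\<forall>\<psi>. C1c W \<psi> \<longrightarrow> (\<integral>z. gdot v \<psi> z \<partial>lebesgue) = - (\<integral>z. f z * \<psi> z \<partial>lebesgue))"

lemma weak_lapD: "weak_lap W v f \<Longrightarrow> C1c W \<psi> \<Longrightarrow>
    (\<integral>z. gdot v \<psi> z \<partial>lebesgue) = - (\<integral>z. f z * \<psi> z \<partial>lebesgue)"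
  unfolding weak_lap_def by blast

lemma weak_lap_mono: "weak_lap W v f \<Longrightarrow> V \<subseteq> W \<Longrightarrow> weak_lap V v f"
  unfolding weak_lap_def C1c_def by blast

lemma C1c_mult_continuous:
  fixes f \<psi> :: "'a::euclidean_space \<Rightarrow> complex"
  assumes "open W" "continuous_on W f" "continuous_on UNIV \<psi>" "compact K" "K \<subseteq> W" "\<And>z. z \<notin> K \<Longrightarrow> \<psi> z = 0"
  shows "continuous_on UNIV (\<lambda>z. f z * \<psi> z)" "integrable lebesgue (\<lambda>z. f z * \<psi> z)"
proof -
  show c: "continuous_on UNIV (\<lambda>z. f z * \<psi> z)"
    by (rule continuous_on_extend_zero[OF assms(1) compact_imp_closed[OF assms(4)] assms(5)])
      (use assms in \<open>auto intro!: continuous_intros intro: continuous_on_subset\<close>)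
  show "integrable lebesgue (\<lambda>z. f z * \<psi> z)"
    by (rule integrable_continuous_compact(1)[OF c assms(4)]) (use assms(6) in auto)
qed

lemma gdot_continuous_integrable:
  assumes "open W" "C1_on W v" "C1c W \<psi>"
  shows "continuous_on UNIV (gdot v \<psi>)" "integrable lebesgue (gdot v \<psi>)"
    "b \<in> Basis \<Longrightarrow> integrable lebesgue (\<lambda>z. pd b v z * pd b \<psi> z)"
    "b \<in> Basis \<Longrightarrow> continuous_on UNIV (\<lambda>z. pd b v z * pd b \<psi> z)"
proof -
  have *: "integrable lebesgue (\<lambda>z. pd b v z * pd b \<psi> z)" "continuous_on UNIV (\<lambda>z. pd b v z * pd b \<psi> z)"
    if b: "b \<in> Basis" for b
    using C1c_mult_continuous[OF assms(1) _ C1c_pd_continuous[OF assms(3) b] C1c_compact[OF assms(3)] C1c_supp[OF assms(3)], of "pd b v"]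
      assms(2) b pd_not_in_supp[of _ \<psi> b] by (auto simp: C1_on_def)
  show "continuous_on UNIV (gdot v \<psi>)" unfolding gdot_def by (intro continuous_intros *)
  show "integrable lebesgue (gdot v \<psi>)" unfolding gdot_def[abs_def] by (intro Bochner_Integration.integrable_sum *)
  show "b \<in> Basis \<Longrightarrow> integrable lebesgue (\<lambda>z. pd b v z * pd b \<psi> z)"
    "b \<in> Basis \<Longrightarrow> continuous_on UNIV (\<lambda>z. pd b v z * pd b \<psi> z)" using * by auto
qed

lemma integral_parts:
  fixes v g :: "'a::euclidean_space \<Rightarrow> complex"
  assumes "open W" "C1_on W v" "C1c W g" "b \<in> Basis"
  shows "(\<integral>z. v z * pd b g z \<partial>lebesgue) = - (\<integral>z. pd b v z * g z \<partial>lebesgue)"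
proof -
  have i1: "integrable lebesgue (\<lambda>z. pd b v z * g z)"
    using C1c_mult_continuous(2)[OF assms(1) _ C1c_continuous[OF assms(3)] C1c_compact[OF assms(3)] C1c_supp[OF assms(3)], of "pd b v"]
      assms(2,4) not_in_supp[of _ g] by (auto simp: C1_on_def)
  have i2: "integrable lebesgue (\<lambda>z. v z * pd b g z)"
    using C1c_mult_continuous(2)[OF assms(1) C1_on_continuous[OF assms(2)] C1c_pd_continuous[OF assms(3,4)] C1c_compact[OF assms(3)] C1c_supp[OF assms(3)]]
      pd_not_in_supp[of _ g b] by auto
  have "(\<integral>z. pd b (\<lambda>x. v x * g x) z \<partial>lebesgue) = 0"
    by (rule integral_pd_zero[OF C1c_mult[OF assms(1-3)] assms(4)])
  then have "(\<integral>z. pd b v z * g z + v z * pd b g z \<partial>lebesgue) = 0"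
    by (simp add: C1c_mult_pd[OF assms(1-3)])
  then show ?thesis using i1 i2 by (simp add: add_eq_0_iff)
qed

lemma integral_laplacian_parts:
  assumes "open W" "C1_on W v" "test_function W \<phi>"
  shows "(\<integral>z. v z * laplacian \<phi> z \<partial>lebesgue) = - (\<integral>z. gdot v \<phi> z \<partial>lebesgue)"
    "integrable lebesgue (\<lambda>z. v z * laplacian \<phi> z)"
proof -
  note C = test_function_C1c[OF assms(3)]
  have i: "integrable lebesgue (\<lambda>z. v z * pd b (pd b \<phi>) z)" if b: "b \<in> Basis" for b
    using C1c_mult_continuous(2)[OF assms(1) C1_on_continuous[OF assms(2)] C1c_pd_continuous[OF C(2)[OF b] b] C1c_compact[OF C(2)[OF b]] C1c_supp[OF C(2)[OF b]]]
      pd_not_in_supp[of _ "pd b \<phi>" b] by auto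
  show "integrable lebesgue (\<lambda>z. v z * laplacian \<phi> z)"
    unfolding laplacian_pd sum_distrib_left by (intro Bochner_Integration.integrable_sum i)
  have "(\<integral>z. v z * laplacian \<phi> z \<partial>lebesgue) = (\<Sum>b\<in>Basis. \<integral>z. v z * pd b (pd b \<phi>) z \<partial>lebesgue)"
    unfolding laplacian_pd sum_distrib_left by (intro Bochner_Integration.integral_sum i)
  also have "\<dots> = (\<Sum>b\<in>Basis. - (\<integral>z. pd b v z * pd b \<phi> z \<partial>lebesgue))"
    by (intro sum.cong refl integral_parts[OF assms(1,2) C(2)])
  also have "\<dots> = - (\<integral>z. gdot v \<phi> z \<partial>lebesgue)"
  proof -
    have "(\<integral>z. gdot v \<phi> z \<partial>lebesgue) = (\<Sum>b\<in>Basis. \<integral>z. pd b v z * pd b \<phi> z \<partial>lebesgue)"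
      unfolding gdot_def using gdot_continuous_integrable(3)[OF assms(1,2) C(1)] SOME_Basis
      by (intro Bochner_Integration.integral_sum) auto
    then show ?thesis by (simp add: sum_negf)
  qed
  finally show "(\<integral>z. v z * laplacian \<phi> z \<partial>lebesgue) = - (\<integral>z. gdot v \<phi> z \<partial>lebesgue)" .
qed

lemma locally_integrable_mult:
  assumes f: "locally_integrable W f" and K: "compact K" "K \<subseteq> W"
    and g: "g \<in> borel_measurable lebesgue" "AE z in lebesgue. norm (g z) \<le> C" "\<And>z. z \<notin> K \<Longrightarrow> g z = 0"
  shows "integrable lebesgue (\<lambda>z. f z * g z)"
proof -
  have i: "integrable lebesgue (\<lambda>z. indicator K z *\<^sub>R f z)"
    using f K unfolding locally_integrable_def set_integrable_def by blast
  have eq: "(\<lambda>z. f z * g z) = (\<lambda>z. (indicator K z *\<^sub>R f z) * g z)"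
    using g(3) by (auto simp: indicator_def)
  show ?thesis unfolding eq
  proof (rule Bochner_Integration.integrable_bound[of _ "\<lambda>z. C * norm (indicator K z *\<^sub>R f z)"])
    show "integrable lebesgue (\<lambda>z. C * norm (indicator K z *\<^sub>R f z))"
      by (rule integrable_mult_right[OF integrable_norm[OF i]])
    show "(\<lambda>z. indicat_real K z *\<^sub>R f z * g z) \<in> borel_measurable lebesgue"
      using borel_measurable_integrable[OF i] g(1) by (rule borel_measurable_times)
    show "AE x in lebesgue. norm (indicat_real K x *\<^sub>R f x * g x) \<le> norm (C * norm (indicat_real K x *\<^sub>R f x))"
      using g(2)
    proof eventually_elim
      case (elim x)
      then have "norm (indicat_real K x *\<^sub>R f x) * norm (g x) \<le> norm (indicat_real K x *\<^sub>R f x) * \<bar>C\<bar>"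
        by (intro mult_left_mono) auto
      then show ?case
        by (simp add: norm_mult mult_ac abs_mult)
    qed
  qed
qed

lemma locally_integrable_mult_C1c:
  assumes f: "locally_integrable W f" and \<psi>: "C1c W \<psi>"
  shows "integrable lebesgue (\<lambda>z. f z * \<psi> z)"
proof -
  obtain C where "\<And>z. norm (\<psi> z) \<le> C" using C1c_bound[OF \<psi>] by blast
  then have "AE z in lebesgue. norm (\<psi> z) \<le> C" by simp
  then show ?thesis
    by (rule locally_integrable_mult[OF f C1c_compact[OF \<psi>] C1c_supp[OF \<psi>] _ _ not_in_supp, rotated])
      (use C1c_continuous[OF \<psi>] in \<open>auto intro!: measurable_completion borel_measurable_continuous_onI\<close>)
qed

text \<open>Dominated convergence with majorant \<open>C * norm (f z)\<close> on \<open>K\<close>: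
  one compact set carries the whole sequence, so \<open>f\<close> may be unbounded, as Green
  functions are near their source.\<close>

lemma locally_integrable_tendsto:
  assumes f: "locally_integrable W f" and K: "compact K" "K \<subseteq> W"
    and g: "\<And>n. g n \<in> borel_measurable lebesgue" "\<And>n. AE z in lebesgue. norm (g n z) \<le> C" "\<And>n z. z \<notin> K \<Longrightarrow> g n z = 0"
    and l: "l \<in> borel_measurable lebesgue" "\<And>z. z \<notin> K \<Longrightarrow> l z = 0" "AE z in lebesgue. (\<lambda>n. g n z) \<longlonglongrightarrow> l z"
  shows "(\<lambda>n. \<integral>z. f z * g n z \<partial>lebesgue) \<longlonglongrightarrow> (\<integral>z. f z * l z \<partial>lebesgue)"
proof -
  have i: "integrable lebesgue (\<lambda>z. indicator K z *\<^sub>R f z)"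
    using f K unfolding locally_integrable_def set_integrable_def by blast
  have eq: "(\<lambda>z. f z * g n z) = (\<lambda>z. (indicator K z *\<^sub>R f z) * g n z)" for n
    using g(3) by (auto simp: indicator_def)
  have eql: "(\<lambda>z. f z * l z) = (\<lambda>z. (indicator K z *\<^sub>R f z) * l z)"
    using l(2) by (auto simp: indicator_def)
  show ?thesis unfolding eq eql
  proof (rule integral_dominated_convergence[where w="\<lambda>z. C * norm (indicator K z *\<^sub>R f z)"])
    show "integrable lebesgue (\<lambda>z. C * norm (indicator K z *\<^sub>R f z))"
      by (rule integrable_mult_right[OF integrable_norm[OF i]])
    show "(\<lambda>z. indicat_real K z *\<^sub>R f z * g n z) \<in> borel_measurable lebesgue" for n
      using borel_measurable_integrable[OF i] g(1) by (rule borel_measurable_times)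
    show "(\<lambda>z. indicat_real K z *\<^sub>R f z * l z) \<in> borel_measurable lebesgue"
      using borel_measurable_integrable[OF i] l(1) by (rule borel_measurable_times)
    show "AE x in lebesgue. (\<lambda>i. indicat_real K x *\<^sub>R f x * g i x) \<longlonglongrightarrow> indicat_real K x *\<^sub>R f x * l x"
      using l(3) by eventually_elim (intro tendsto_intros)
    show "AE x in lebesgue. norm (indicat_real K x *\<^sub>R f x * g i x) \<le> C * norm (indicat_real K x *\<^sub>R f x)" for i
      using g(2)[of i]
    proof eventually_elim
      case (elim x)
      then have "norm (indicat_real K x *\<^sub>R f x) * norm (g i x) \<le> norm (indicat_real K x *\<^sub>R f x) * C"
        by (intro mult_left_mono) auto
      then show ?case by (simp add: norm_mult mult_ac)
    qed
  qed
qed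

lemma continuous_locally_integrable:
  fixes f :: "real^2 \<Rightarrow> complex"
  assumes "continuous_on W f" shows "locally_integrable W f"
  unfolding locally_integrable_def
proof (intro allI impI)
  fix K assume K: "compact K \<and> K \<subseteq> W"
  then have "integrable lborel (\<lambda>x. indicator K x *\<^sub>R f x)"
    using assms by (intro borel_integrable_compact) (auto intro: continuous_on_subset)
  then show "set_integrable lebesgue K f"
    unfolding set_integrable_def using integrable_completion borel_measurable_integrable by (metis measurable_lborel1)
qed

text \<open>Mollify the test function.\<close>

lemma distr_imp_weak_lap:
  assumes W: "open W" and v: "C1_on W v" and f: "locally_integrable W f"
    and eq: "\<And>\<phi>. test_function W \<phi> \<Longrightarrow> (\<integral>z. v z * laplacian \<phi> z \<partial>lebesgue) = (\<integral>z. f z * \<phi> z \<partial>lebesgue)"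
  shows "weak_lap W v f"
  unfolding weak_lap_def
proof (intro allI impI)
  fix \<psi> :: "real^2 \<Rightarrow> complex" assume \<psi>: "C1c W \<psi>"
  obtain d L where d: "d > 0" and L: "compact L" "L \<subseteq> W" "supp \<psi> \<subseteq> L"
    and dL: "\<And>x y. x \<in> supp \<psi> \<Longrightarrow> dist x y \<le> d \<Longrightarrow> y \<in> L"
    using C1c_neighbourhood[OF C1c_compact[OF \<psi>] W C1c_supp[OF \<psi>]] by blast
  define e where "e = vanish_seq d"
  have e: "\<And>n. e n > 0" "\<And>n. e n \<le> d" "e \<longlonglongrightarrow> 0" unfolding e_def using d vanish_seq by auto
  define \<phi> where "\<phi> n = conv (ker (e n)) \<psi>" for n
  have T: "test_function W (\<phi> n)" for n
    unfolding \<phi>_def by (rule test_function_conv_ker[OF \<psi> e(1) e(2) L(1,2) dL])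
  have meas: "g \<in> borel_measurable lebesgue" if "continuous_on UNIV g" for g :: "real^2 \<Rightarrow> complex"
    using that by (intro measurable_completion) (simp add: borel_measurable_continuous_onI)
  \<comment> \<open>Used for \<open>\<psi>\<close> itself and for each of its partial derivatives,
    since mollification commutes with \<open>pd\<close>.\<close>
  have lim: "(\<lambda>n. \<integral>z. h z * conv (ker (e n)) g z \<partial>lebesgue) \<longlonglongrightarrow> (\<integral>z. h z * g z \<partial>lebesgue)"
    if h: "locally_integrable W h" and g: "continuous_on UNIV g" "\<And>z. z \<notin> supp \<psi> \<Longrightarrow> g z = 0"
      "\<And>n. continuous_on UNIV (conv (ker (e n)) g)" for h g
  proof -
    obtain C where C: "\<And>z. norm (g z) \<le> C"
      using compact_supp_bound[OF g(1) C1c_compact[OF \<psi>] g(2)] by blast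
    have ig: "integrable lebesgue g" by (rule integrable_continuous_compact(1)[OF g(1) C1c_compact[OF \<psi>] g(2)])
    have sg: "supp g \<subseteq> supp \<psi>" using g(2) by (intro supp_subset_closed) auto
    show ?thesis
    proof (rule locally_integrable_tendsto[OF h L(1,2)])
      show "AE z in lebesgue. norm (conv (ker (e n)) g z) \<le> C" for n
        using conv_ker_bound[OF e(1) ig, of C] C by (intro AE_I2) auto
      show "conv (ker (e n)) g z = 0" if "z \<notin> L" for n z
        using conv_ker_vanish[OF e(1) e(2) ig _ that] dL sg by blast
      show "AE z in lebesgue. (\<lambda>n. conv (ker (e n)) g z) \<longlonglongrightarrow> g z"
        using conv_ker_tendsto[OF ig _ e(1) e(3)] g(1) by (intro AE_I2) (simp add: continuous_on_eq_continuous_at)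
    qed (use g L(3) in \<open>auto intro!: meas\<close>)
  qed
  have "(\<lambda>n. \<integral>z. f z * \<phi> n z \<partial>lebesgue) \<longlonglongrightarrow> (\<integral>z. f z * \<psi> z \<partial>lebesgue)"
    unfolding \<phi>_def
    by (rule lim[OF f C1c_continuous[OF \<psi>] not_in_supp[where f=\<psi>]]) (use C1c_continuous[OF test_function_C1c(1)[OF T]] SOME_Basis in \<open>auto simp: \<phi>_def\<close>)
  moreover have "(\<integral>z. f z * \<phi> n z \<partial>lebesgue) = - (\<Sum>b\<in>Basis. \<integral>z. pd b v z * pd b (\<phi> n) z \<partial>lebesgue)" for n
  proof -
    have "(\<integral>z. f z * \<phi> n z \<partial>lebesgue) = - (\<integral>z. gdot v (\<phi> n) z \<partial>lebesgue)"
      using eq[OF T] integral_laplacian_parts(1)[OF W v T] by simp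
    then show ?thesis unfolding gdot_def
      using gdot_continuous_integrable(3)[OF W v test_function_C1c(1)[OF T[of n]]] SOME_Basis
      by (subst (asm) Bochner_Integration.integral_sum) auto
  qed
  ultimately have 1: "(\<lambda>n. - (\<Sum>b\<in>Basis. \<integral>z. pd b v z * pd b (\<phi> n) z \<partial>lebesgue)) \<longlonglongrightarrow> (\<integral>z. f z * \<psi> z \<partial>lebesgue)"
    by simp
  have "(\<lambda>n. \<integral>z. pd b v z * pd b (\<phi> n) z \<partial>lebesgue) \<longlonglongrightarrow> (\<integral>z. pd b v z * pd b \<psi> z \<partial>lebesgue)" if b: "b \<in> Basis" for b
  proof -
    have *: "pd b (\<phi> n) = conv (ker (e n)) (pd b \<psi>)" for n
      unfolding \<phi>_def using pd_conv_ker[OF \<psi> b e(1)] by auto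
    have c: "continuous_on UNIV (conv (ker (e n)) (pd b \<psi>))" for n
      using C1c_pd_continuous[OF test_function_C1c(1)[OF T[of n]] b] by (simp add: *)
    have "continuous_on W (pd b v)" using v b by (simp add: C1_on_def)
    from lim[OF continuous_locally_integrable[OF this] C1c_pd_continuous[OF \<psi> b] pd_not_in_supp[where f=\<psi> and b=b] c]
    show ?thesis unfolding * by simp
  qed
  then have "(\<lambda>n. - (\<Sum>b\<in>Basis. \<integral>z. pd b v z * pd b (\<phi> n) z \<partial>lebesgue)) \<longlonglongrightarrow> - (\<Sum>b\<in>Basis. \<integral>z. pd b v z * pd b \<psi> z \<partial>lebesgue)"
    by (intro tendsto_intros)
  then have "(\<integral>z. f z * \<psi> z \<partial>lebesgue) = - (\<Sum>b\<in>Basis. \<integral>z. pd b v z * pd b \<psi> z \<partial>lebesgue)"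
    using 1 LIMSEQ_unique by blast
  moreover have "(\<integral>z. gdot v \<psi> z \<partial>lebesgue) = (\<Sum>b\<in>Basis. \<integral>z. pd b v z * pd b \<psi> z \<partial>lebesgue)"
    unfolding gdot_def by (intro Bochner_Integration.integral_sum gdot_continuous_integrable(3)[OF W v \<psi>])
  ultimately show "(\<integral>z. gdot v \<psi> z \<partial>lebesgue) = - (\<integral>z. f z * \<psi> z \<partial>lebesgue)" by simp
qed

lemma gdot_add_right:
  assumes "C1c V \<psi>1" "C1c V' \<psi>2"
  shows "gdot v (\<lambda>z. \<psi>1 z + \<psi>2 z) z = gdot v \<psi>1 z + gdot v \<psi>2 z"
  unfolding gdot_def using C1c_differentiable[OF assms(1)] C1c_differentiable[OF assms(2)]
  by (simp add: pd_add sum.distrib distrib_left)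

text \<open>A partition of unity peeled off one ball at a time: \<open>\<zeta> * \<psi>\<close> is
  supported where the equation is known, and \<open>(1 - \<zeta>) * \<psi>\<close> is supported in
  the remaining balls, where the induction hypothesis applies.\<close>

lemma weak_lap_local:
  assumes W: "open W" and v: "C1_on W v" and f: "locally_integrable W f"
    and loc: "\<And>p. p \<in> W \<Longrightarrow> \<exists>r>0. weak_lap (ball p r \<inter> W) v f"
  shows "weak_lap W v f"
  unfolding weak_lap_def
proof (intro allI impI)
  let ?E = "\<lambda>\<psi>. (\<integral>z. gdot v \<psi> z \<partial>lebesgue) = - (\<integral>z. f z * \<psi> z \<partial>lebesgue)"
  fix \<psi> :: "real^2 \<Rightarrow> complex" assume \<psi>: "C1c W \<psi>"
  obtain r where r: "\<And>p. p \<in> W \<Longrightarrow> r p > 0 \<and> weak_lap (ball p (r p) \<inter> W) v f" using loc by metis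
  \<comment> \<open>With a third of the radius the cutoff is 1 on this ball and vanishes outside the
    ball of twice the size, which still lies inside \<open>ball p (r p)\<close>.\<close>
  let ?B = "\<lambda>p. ball p (r p / 3)"
  have "supp \<psi> \<subseteq> (\<Union>p\<in>supp \<psi>. ?B p)"
  proof
    fix p assume "p \<in> supp \<psi>"
    moreover have "p \<in> W" using \<open>p \<in> supp \<psi>\<close> C1c_supp[OF \<psi>] by blast
    then have "p \<in> ?B p" using r[of p] by simp
    ultimately show "p \<in> (\<Union>p\<in>supp \<psi>. ?B p)" by blast
  qed
  then obtain P where P: "P \<subseteq> supp \<psi>" "finite P" "supp \<psi> \<subseteq> (\<Union>p\<in>P. ?B p)"
    using compactE_image[OF C1c_compact[OF \<psi>], of "supp \<psi>" ?B] by auto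
  have PW: "P \<subseteq> W" using P(1) C1c_supp[OF \<psi>] by blast
  from P(2) PW have "\<forall>\<psi>. C1c W \<psi> \<longrightarrow> supp \<psi> \<subseteq> (\<Union>p\<in>P. ?B p) \<longrightarrow> ?E \<psi>"
  proof (induction P rule: finite_induct)
    case empty
    show ?case
    proof (intro allI impI)
      fix \<psi> :: "real^2 \<Rightarrow> complex" assume "supp \<psi> \<subseteq> (\<Union>p\<in>{}. ?B p)"
      then have s: "supp \<psi> = {}" by simp
      have "\<psi> z = 0" "pd b \<psi> z = 0" for z b
        using not_in_supp[of z \<psi>] pd_not_in_supp[of z \<psi> b] s by auto
      then show "?E \<psi>" by (simp add: gdot_def)
    qed
  next
    case (insert p P)
    show ?case
    proof (intro allI impI)
      fix \<psi> :: "real^2 \<Rightarrow> complex" assume \<psi>: "C1c W \<psi>" and sub: "supp \<psi> \<subseteq> (\<Union>p\<in>insert p P. ?B p)"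
      have rp: "r p / 3 > 0" "weak_lap (ball p (r p) \<inter> W) v f" using r[of p] insert.prems by auto
      define \<zeta> where "\<zeta> = cbump p (r p / 3)"
      have \<zeta>: "C1_on V \<zeta>" for V unfolding \<zeta>_def by (rule C1c_C_on[OF cbump_C1c[OF rp(1) order_refl]])
      have 0: "\<zeta> z = 0" if "z \<notin> cball p (2 * (r p / 3))" for z
        unfolding \<zeta>_def cbump_def using bump_eq_0[OF rp(1), of p z] that by auto
      have c1: "C1c W (\<lambda>z. \<zeta> z * \<psi> z)" by (rule C1c_mult[OF W \<zeta> \<psi>])
      have c1': "C1c (ball p (r p) \<inter> W) (\<lambda>z. \<zeta> z * \<psi> z)"
      proof (rule C1c_mono[OF c1])
        have "supp (\<lambda>z. \<zeta> z * \<psi> z) \<subseteq> cball p (2 * (r p / 3))"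
          using 0 by (intro supp_subset_closed) auto
        then show "supp (\<lambda>z. \<zeta> z * \<psi> z) \<subseteq> ball p (r p) \<inter> W" using C1c_supp[OF c1] rp(1) by auto
      qed
      have c2: "C1c W (\<lambda>z. (1 - \<zeta> z) * \<psi> z)" by (rule C1c_mult[OF W C1_on_diff[OF C1_on_const \<zeta>] \<psi>])
      have "supp (\<lambda>z. (1 - \<zeta> z) * \<psi> z) \<subseteq> supp \<psi> - ?B p"
      proof (rule supp_subset_closed)
        show "closed (supp \<psi> - ?B p)" by (intro closed_Diff) auto
        show "(1 - \<zeta> z) * \<psi> z = 0" if "z \<notin> supp \<psi> - ?B p" for z
          using that not_in_supp[of z \<psi>] bump_eq_1[OF rp(1), of p z] by (auto simp: \<zeta>_def cbump_def)
      qed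
      then have "supp (\<lambda>z. (1 - \<zeta> z) * \<psi> z) \<subseteq> (\<Union>p\<in>P. ?B p)" using sub by blast
      then have E2: "?E (\<lambda>z. (1 - \<zeta> z) * \<psi> z)" using insert.IH insert.prems c2 by blast
      have E1: "?E (\<lambda>z. \<zeta> z * \<psi> z)" by (rule weak_lapD[OF rp(2) c1'])
      have eq: "\<psi> = (\<lambda>z. \<zeta> z * \<psi> z + (1 - \<zeta> z) * \<psi> z)" by (simp add: algebra_simps)
      have "(\<integral>z. gdot v \<psi> z \<partial>lebesgue) = (\<integral>z. gdot v (\<lambda>z. \<zeta> z * \<psi> z) z + gdot v (\<lambda>z. (1 - \<zeta> z) * \<psi> z) z \<partial>lebesgue)"
      proof -
        have "gdot v \<psi> z = gdot v (\<lambda>z. \<zeta> z * \<psi> z + (1 - \<zeta> z) * \<psi> z) z" for z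
          by (rule arg_cong[OF eq])
        then show ?thesis by (simp only: gdot_add_right[OF c1 c2])
      qed
      also have "\<dots> = (\<integral>z. gdot v (\<lambda>z. \<zeta> z * \<psi> z) z \<partial>lebesgue) + (\<integral>z. gdot v (\<lambda>z. (1 - \<zeta> z) * \<psi> z) z \<partial>lebesgue)"
        by (intro Bochner_Integration.integral_add gdot_continuous_integrable(2)[OF W v] c1 c2)
      also have "\<dots> = - (\<integral>z. f z * (\<zeta> z * \<psi> z) + f z * ((1 - \<zeta> z) * \<psi> z) \<partial>lebesgue)"
        using E1 E2 locally_integrable_mult_C1c[OF f c1] locally_integrable_mult_C1c[OF f c2] by simp
      also have "\<dots> = - (\<integral>z. f z * \<psi> z \<partial>lebesgue)" by (simp add: algebra_simps)
      finally show "?E \<psi>" .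
    qed
  qed
  then show "?E \<psi>" using \<psi> P(3) by blast
qed

section \<open>Removing interfaces\<close>

text \<open>Coordinate-free form of \<open>x $ 2 - g (x $ 1)\<close> after a rotation: a step
  \<open>t\<close> along \<open>e\<close> raises the height by exactly \<open>t\<close>. The zero
  set is a graph over the complement of \<open>e\<close>, and layers of equal height are translates
  of one another.\<close>

definition graph_height :: "('a::euclidean_space \<Rightarrow> real) \<Rightarrow> 'a \<Rightarrow> bool" where
  "graph_height s e \<longleftrightarrow> C1_on UNIV s \<and> norm e = 1 \<and> (\<forall>x t. s (x + t *\<^sub>R e) = s x + t)"

lemma measure_translation_right:
  "measure lebesgue ((\<lambda>x. x + a) ` A) = measure lebesgue (A :: 'a::euclidean_space set)"
  using measure_translation[of a A] by (simp add: add.commute[of _ a])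

text \<open>About \<open>1 / \<delta>\<close> disjoint translates of the strip along \<open>e\<close> fit into the larger ball.\<close>

lemma measure_strip_le:
  fixes s :: "'a::euclidean_space \<Rightarrow> real"
  assumes s: "graph_height s e" and \<delta>: "0 < \<delta>" "\<delta> \<le> 1" and R: "R \<ge> 0"
  shows "measure lebesgue (cball 0 R \<inter> {x. a \<le> s x \<and> s x < a + \<delta>}) \<le> \<delta> * measure lebesgue (cball (0::'a) (R + 1))"
proof -
  \<comment> \<open>Large enough for \<open>n * \<delta> \<ge> 1\<close>, which turns the packing
    into the estimate, and small enough that each shift \<open>j * \<delta>\<close> with
    \<open>j < n\<close> is at most 1, so the translates stay in the ball of radius
    \<open>R + 1\<close>.\<close>
  define n where "n = nat \<lceil>1 / \<delta>\<rceil>"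
  have n: "real n \<ge> 1 / \<delta>" unfolding n_def by linarith
  have n': "real j * \<delta> \<le> 1" if "j < n" for j
  proof -
    have "real j < 1 / \<delta>" using that unfolding n_def by linarith
    then show ?thesis using \<delta>(1) by (simp add: field_simps)
  qed
  define A where "A = cball 0 R \<inter> {x. a \<le> s x \<and> s x < a + \<delta>}"
  define T where "T j = (\<lambda>x. x + (real j * \<delta>) *\<^sub>R e) ` A" for j
  have cs: "continuous_on UNIV s" using s C1_on_continuous by (auto simp: graph_height_def)
  have meas: "A \<in> sets borel"
  proof -
    have m: "s \<in> borel_measurable borel" using cs by (rule borel_measurable_continuous_onI)
    have "{x \<in> space borel. a \<le> s x \<and> s x < a + \<delta>} \<in> sets borel" using m by measurable
    then show ?thesis unfolding A_def by (auto intro: borel_closed)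
  qed
  have st: "s (x + t *\<^sub>R e) = s x + t" "norm e = 1" for x t using s by (auto simp: graph_height_def)
  have T_meas: "T j \<in> sets borel" for j
  proof -
    have "T j = (\<lambda>x. x - (real j * \<delta>) *\<^sub>R e) -` A \<inter> space borel"
      unfolding T_def by (auto simp: image_iff intro!: bexI[of _ "x - (real j * \<delta>) *\<^sub>R e" for x])
    moreover have "(\<lambda>x. x - (real j * \<delta>) *\<^sub>R e) \<in> borel_measurable borel" by measurable
    ultimately show ?thesis using meas measurable_sets by metis
  qed
  have sT: "a + real j * \<delta> \<le> s x \<and> s x < a + real j * \<delta> + \<delta>" if "x \<in> T j" for x j
    using that st unfolding T_def A_def by auto
  have disj: "disjoint_family_on T {..<n}"
    unfolding disjoint_family_on_def
  proof (intro ballI impI)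
    have *: "T i \<inter> T j = {}" if "i < j" for i j :: nat
    proof (rule ccontr)
      assume "T i \<inter> T j \<noteq> {}"
      then obtain x where "x \<in> T i" "x \<in> T j" by blast
      then have "real j * \<delta> < (real i + 1) * \<delta>" using sT[of x i] sT[of x j] by (simp add: algebra_simps)
      moreover have "(real i + 1) * \<delta> \<le> real j * \<delta>" using that \<delta>(1) by (intro mult_right_mono) auto
      ultimately show False by simp
    qed
    fix i j :: nat assume "i \<noteq> j"
    then consider "i < j" | "j < i" by linarith
    then show "T i \<inter> T j = {}" using *[of i j] *[of j i] by cases auto
  qed
  have sub: "(\<Union>j<n. T j) \<subseteq> cball 0 (R + 1)"
  proof
    fix y assume "y \<in> (\<Union>j<n. T j)"
    then obtain j x where j: "j < n" "x \<in> A" "y = x + (real j * \<delta>) *\<^sub>R e" unfolding T_def by auto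
    have "norm y \<le> norm x + norm ((real j * \<delta>) *\<^sub>R e)" unfolding j(3) by (rule norm_triangle_ineq)
    also have "\<dots> \<le> R + 1" using j n'[OF j(1)] \<delta>(1) st(2) by (auto simp: A_def)
    finally show "y \<in> cball 0 (R + 1)" by simp
  qed
  have lm: "T j \<in> lmeasurable" if "j < n" for j
  proof (rule fmeasurableI2[OF lmeasurable_cball[of 0 "R + 1"]])
    show "T j \<subseteq> cball 0 (R + 1)" using sub that by blast
    show "T j \<in> sets lebesgue" using T_meas[of j] by auto
  qed
  have "real n * measure lebesgue A = (\<Sum>j<n. measure lebesgue (T j))"
    unfolding T_def by (simp add: measure_translation_right)
  also have "\<dots> = measure lebesgue (\<Union>j<n. T j)"
    by (rule measure_UNION'[symmetric])
      (use lm disj in \<open>auto simp: disjoint_family_on_def pairwise_def disjnt_def\<close>)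
  also have "\<dots> \<le> measure lebesgue (cball (0::'a) (R + 1))"
    using sub lm by (intro measure_mono_fmeasurable) (auto intro!: fmeasurable.finite_UN simp: fmeasurableD)
  finally have *: "real n * measure lebesgue A \<le> measure lebesgue (cball (0::'a) (R + 1))" .
  have "1 \<le> \<delta> * real n" using n \<delta>(1) by (simp add: field_simps)
  then have "1 * measure lebesgue A \<le> (\<delta> * real n) * measure lebesgue A"
    by (intro mult_right_mono) auto
  also have "\<dots> \<le> \<delta> * measure lebesgue (cball (0::'a) (R + 1))"
    using mult_left_mono[OF *, of \<delta>] \<delta>(1) by (simp add: mult.assoc)
  finally show ?thesis unfolding A_def by simp
qed

text \<open>The graph lies in strips of every height \<open>\<delta>\<close>, whose measure within a
  ball is of order \<open>\<delta>\<close>.\<close>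

lemma negligible_graph:
  fixes s :: "'a::euclidean_space \<Rightarrow> real"
  assumes s: "graph_height s e"
  shows "negligible {x. s x = 0}"
proof -
  have "negligible (cball 0 R \<inter> {x. s x = 0})" if R: "R \<ge> 0" for R
  proof -
    let ?Z = "cball 0 R \<inter> {x. s x = 0}"
    have cs: "continuous_on UNIV s" using s C1_on_continuous by (auto simp: graph_height_def)
    have Z: "?Z \<in> lmeasurable"
      by (intro lmeasurable_compact compact_Int_closed closed_Collect_eq) (use cs in auto)
    have le: "measure lebesgue ?Z \<le> \<delta> * measure lebesgue (cball (0::'a) (R + 1))" if d: "0 < \<delta>" "\<delta> \<le> 1" for \<delta>
    proof -
      have m: "s \<in> borel_measurable borel" using cs by (rule borel_measurable_continuous_onI)
      have "{x \<in> space borel. 0 \<le> s x \<and> s x < 0 + \<delta>} \<in> sets borel" using m by measurable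
      then have b: "{x. 0 \<le> s x \<and> s x < 0 + \<delta>} \<in> sets borel" by simp
      have "measure lebesgue ?Z \<le> measure lebesgue (cball 0 R \<inter> {x. 0 \<le> s x \<and> s x < 0 + \<delta>})"
      proof (rule measure_mono_fmeasurable)
        show "cball 0 R \<inter> {x. 0 \<le> s x \<and> s x < 0 + \<delta>} \<in> lmeasurable"
          by (rule fmeasurable_Int_fmeasurable[OF lmeasurable_cball]) (use b in auto)
      qed (use d Z in \<open>auto simp: fmeasurableD\<close>)
      also have "\<dots> \<le> \<delta> * measure lebesgue (cball (0::'a) (R + 1))" by (rule measure_strip_le[OF s d R])
      finally show ?thesis .
    qed
    have "measure lebesgue ?Z \<le> 0"
    proof (rule field_le_epsilon)
      fix \<epsilon> :: real assume e: "\<epsilon> > 0"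
      \<comment> \<open>The summand 1 keeps \<open>\<epsilon> / M\<close> meaningful; the minimum
        below respects the restriction \<open>\<delta> \<le> 1\<close> of the strip
        estimate.\<close>
      define M where "M = measure lebesgue (cball (0::'a) (R + 1)) + 1"
      have M: "M \<ge> 1" by (simp add: M_def)
      have "measure lebesgue ?Z \<le> min 1 (\<epsilon> / M) * measure lebesgue (cball (0::'a) (R + 1))"
        using e M by (intro le) auto
      also have "\<dots> \<le> (\<epsilon> / M) * M"
        using e M by (intro mult_mono) (auto simp: M_def)
      finally show "measure lebesgue ?Z \<le> 0 + \<epsilon>" using M by simp
    qed
    then show ?thesis using Z by (simp add: negligible_iff_measure measure_le_0_iff)
  qed
  then have "negligible (\<Union>n::nat. cball 0 (real n) \<inter> {x. s x = 0})" by (intro negligible_Union_nat) auto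
  moreover have "{x. s x = 0} \<subseteq> (\<Union>n::nat. cball 0 (real n) \<inter> {x. s x = 0})"
    using real_arch_simple by (auto simp: dist_norm)
  ultimately show ?thesis by (rule negligible_subset)
qed

lemma C1_on_compose:
  fixes p :: "real \<Rightarrow> real" and s :: "'a::euclidean_space \<Rightarrow> real"
  assumes p: "\<And>t. (p has_real_derivative p' t) (at t)" "continuous_on UNIV p'" and s: "C1_on UNIV s"
  shows "C1_on UNIV (\<lambda>x. p (s x))" "pd b (\<lambda>x. p (s x)) x = p' (s x) * pd b s x"
proof -
  have D: "((\<lambda>x. p (s x)) has_derivative (\<lambda>h. p' (s x) * pd h s x)) (at x)" for x
  proof -
    have d: "s differentiable (at x)" using s by (simp add: C1_on_def)
    show ?thesis
      by (rule has_derivative_compose[OF has_derivative_pd[OF d] p(1)[unfolded has_field_derivative_def]])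
  qed
  then have P: "pd b (\<lambda>x. p (s x)) x = p' (s x) * pd b s x" for b x by (rule pd_eqI)
  then show "pd b (\<lambda>x. p (s x)) x = p' (s x) * pd b s x" .
  show "C1_on UNIV (\<lambda>x. p (s x))"
    unfolding C1_on_def P[abs_def]
  proof (intro conjI ballI)
    show "(\<lambda>x. p (s x)) differentiable (at x)" for x using D unfolding differentiable_def by (intro exI)
    fix b :: 'a assume "b \<in> Basis"
    then have "continuous_on UNIV (pd b s)" using s by (simp add: C1_on_def)
    moreover have "continuous_on UNIV (\<lambda>x. p' (s x))"
      by (rule continuous_on_compose2[OF p(2) C1_on_continuous[OF s]]) simp
    ultimately show "continuous_on UNIV (\<lambda>x. p' (s x) * pd b s x)" by (intro continuous_intros)
  qed
qed

section \<open>Cutting out a layer around an interface\<close>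

definition step_bump :: "real \<Rightarrow> real" where
  "step_bump t = - cut' (- 1 - t)"

text \<open>The rising flank lies over [-2, -1] with slope \<open>step_bump\<close>, the falling one
  over [1, 2]. Both have the same profile, translated by 3; this is the origin of the shifts by 3
  and \<open>3 * d\<close>.\<close>

definition hat :: "real \<Rightarrow> real" where
  "hat t = cut (- 1 - t) - cut (2 - t)"

text \<open>The derivative of \<open>hat\<close> is the difference of a function and its translate; this is what
  makes the contribution of an interface cancel when the gradient is continuous.\<close>

lemma hat_deriv: "(hat has_real_derivative step_bump t - step_bump (t - 3)) (at t)"
proof -
  have 1: "((\<lambda>t. cut (a - t)) has_real_derivative - cut' (a - t)) (at t)" for a
  proof -
    have "((\<lambda>t. a - t) has_real_derivative - 1) (at t)" by (auto intro!: derivative_eq_intros)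
    from DERIV_chain2[OF cut_deriv this] show ?thesis by simp
  qed
  have "(hat has_real_derivative - cut' (- 1 - t) - - cut' (2 - t)) (at t)"
    unfolding hat_def[abs_def] by (rule DERIV_diff[OF 1 1])
  then show ?thesis by (simp add: step_bump_def)
qed

lemma step_bump_continuous: "continuous_on UNIV step_bump"
proof -
  have c: "continuous_on UNIV cut'" by (simp add: continuous_at_imp_continuous_on isCont_cut')
  have "continuous_on UNIV (\<lambda>t. cut' (- 1 - t))"
    by (rule continuous_on_compose2[OF c]) (auto intro!: continuous_intros)
  then show ?thesis unfolding step_bump_def[abs_def] by (intro continuous_intros)
qed

lemma step_bump_bounds: "0 \<le> step_bump t" "step_bump t \<le> 9" "t < -2 \<or> -1 \<le> t \<Longrightarrow> step_bump t = 0"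
  using cut'_nonpos[of "-1-t"] cut'_ge[of "-1-t"] cut'_eq_0[of "-1-t"] by (auto simp: step_bump_def)

lemma hat_bounds: "\<bar>t\<bar> \<le> 1 \<Longrightarrow> hat t = 1" "\<bar>t\<bar> \<ge> 2 \<Longrightarrow> hat t = 0" "0 \<le> 1 - hat t" "1 - hat t \<le> 2"
  using cut_eq_1[of "-1-t"] cut_eq_0[of "-1-t"] cut_eq_1[of "2-t"] cut_eq_0[of "2-t"]
    cut_nonneg[of "-1-t"] cut_le_1[of "-1-t"] cut_nonneg[of "2-t"] cut_le_1[of "2-t"]
  by (cases "t \<ge> 0"; auto simp: hat_def)+

lemma measurable_lebesgue_continuous:
  fixes g :: "'a::euclidean_space \<Rightarrow> 'b::topological_space"
  assumes "continuous_on UNIV g" shows "g \<in> borel_measurable lebesgue"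
  using assms by (intro measurable_completion) (simp add: borel_measurable_continuous_onI)

text \<open>Translating the second bump back by \<open>3 * d\<close> along \<open>e\<close> leaves
  the difference of \<open>E\<close> at \<open>x\<close> and at
  \<open>x + (3 * d) *\<^sub>R e\<close>, times a bump, divided by \<open>d\<close>. The strip
  carrying the bump has measure of order \<open>d\<close>, which pays for the division, and the
  difference tends to 0 by uniform continuity.\<close>

lemma interface_layer_tendsto:
  fixes E :: "'a::euclidean_space \<Rightarrow> complex"
  assumes s: "graph_height s e" and E: "continuous_on UNIV E" "compact K" "\<And>x. x \<notin> K \<Longrightarrow> E x = 0"
  shows "(\<lambda>n. \<integral>x. E x * of_real ((step_bump (s x / vanish_seq 1 n) - step_bump (s x / vanish_seq 1 n - 3)) / vanish_seq 1 n) \<partial>lebesgue) \<longlonglongrightarrow> 0"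
proof -
  obtain R where R: "R > 0" "\<And>x. x \<in> K \<Longrightarrow> norm x \<le> R"
    using compact_imp_bounded[OF E(2)] unfolding bounded_pos by auto
  have ER: "E x = 0" if "norm x > R" for x using E(3)[of x] R(2)[of x] that by fastforce
  have cs: "continuous_on UNIV s" using s C1_on_continuous by (auto simp: graph_height_def)
  have st: "s (x + t *\<^sub>R e) = s x + t" "norm e = 1" for x t using s by (auto simp: graph_height_def)
  \<comment> \<open>The shifted \<open>E\<close> vanishes outside radius \<open>R + 3\<close>
    because \<open>d \<le> 1\<close>; the last 1 is the enlargement in
    \<open>measure_strip_le\<close>.\<close>
  define C where "C = measure lebesgue (cball (0::'a) (R + 3 + 1))"
  have C0: "C \<ge> 0" by (simp add: C_def)
  define J where "J d = (\<integral>x. E x * of_real ((step_bump (s x / d) - step_bump (s x / d - 3)) / d) \<partial>lebesgue)" for d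
  have J: "norm (J d) \<le> 9 * \<omega> * C"
    if d: "0 < d" "d \<le> 1" and \<omega>: "\<And>x. norm (E x - E (x + (3 * d) *\<^sub>R e)) \<le> \<omega>" for d \<omega>
  proof -
    have w0: "\<omega> \<ge> 0" using \<omega>[of 0] norm_ge_zero order_trans by blast
    define \<beta> where "\<beta> x = step_bump (s x / d)" for x
    have c\<beta>: "continuous_on UNIV \<beta>" unfolding \<beta>_def
      by (rule continuous_on_compose2[OF step_bump_continuous]) (auto intro!: continuous_intros cs simp: divide_inverse)
    have \<beta>3: "step_bump (s x / d - 3) = \<beta> (x - (3 * d) *\<^sub>R e)" for x
    proof -
      have "s (x - (3 * d) *\<^sub>R e) = s x - 3 * d" using st(1)[of x "- (3 * d)"] by simp
      then show ?thesis using d by (simp add: \<beta>_def diff_divide_distrib)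
    qed
    have c3: "continuous_on UNIV (\<lambda>x. \<beta> (x - (3 * d) *\<^sub>R e))"
      by (rule continuous_on_compose2[OF c\<beta>]) (auto intro!: continuous_intros)
    have cE3: "continuous_on UNIV (\<lambda>x. E (x + (3 * d) *\<^sub>R e))"
      by (rule continuous_on_compose2[OF E(1)]) (auto intro!: continuous_intros)
    have i1: "integrable lebesgue (\<lambda>x. E x * of_real (\<beta> x))"
      by (rule integrable_continuous_compact(1)[OF _ E(2)]) (use E c\<beta> in \<open>auto intro!: continuous_intros\<close>)
    have i2: "integrable lebesgue (\<lambda>x. E x * of_real (\<beta> (x - (3 * d) *\<^sub>R e)))"
      by (rule integrable_continuous_compact(1)[OF _ E(2)]) (use E c3 in \<open>auto intro!: continuous_intros\<close>)
    have E3: "E (x + (3 * d) *\<^sub>R e) = 0" if "norm x > R + 3" for x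
    proof (rule ER)
      have "norm x \<le> norm (x + (3 * d) *\<^sub>R e) + norm ((3 * d) *\<^sub>R e)"
        using norm_triangle_ineq4[of "x + (3 * d) *\<^sub>R e" "(3 * d) *\<^sub>R e"] by simp
      then show "norm (x + (3 * d) *\<^sub>R e) > R" using that d st(2) by simp
    qed
    have i3: "integrable lebesgue (\<lambda>x. E (x + (3 * d) *\<^sub>R e) * of_real (\<beta> x))"
      by (rule integrable_continuous_compact(1)[OF _ compact_cball[of 0 "R + 3"]])
        (use E3 c\<beta> cE3 in \<open>auto intro!: continuous_intros\<close>)
    have sh: "(\<integral>x. E x * of_real (\<beta> (x - (3 * d) *\<^sub>R e)) \<partial>lebesgue) = (\<integral>x. E (x + (3 * d) *\<^sub>R e) * of_real (\<beta> x) \<partial>lebesgue)"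
    proof -
      have "continuous_on UNIV (\<lambda>x. E x * of_real (\<beta> (x - (3 * d) *\<^sub>R e)))"
        using E(1) c3 by (intro continuous_intros)
      from integral_shift[OF borel_measurable_continuous_onI[OF this], of "(3 * d) *\<^sub>R e"]
      show ?thesis by simp
    qed
    have "J d = (\<integral>x. (E x * of_real (\<beta> x) - E x * of_real (\<beta> (x - (3 * d) *\<^sub>R e))) / of_real d \<partial>lebesgue)"
      unfolding J_def \<beta>3 \<beta>_def by (intro Bochner_Integration.integral_cong) (auto simp: algebra_simps diff_divide_distrib)
    also have "\<dots> = ((\<integral>x. E x * of_real (\<beta> x) \<partial>lebesgue) - (\<integral>x. E x * of_real (\<beta> (x - (3 * d) *\<^sub>R e)) \<partial>lebesgue)) / of_real d"
      using i1 i2 by simp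
    also have "\<dots> = (\<integral>x. E x * of_real (\<beta> x) - E (x + (3 * d) *\<^sub>R e) * of_real (\<beta> x) \<partial>lebesgue) / of_real d"
      unfolding sh using i1 i3 by simp
    finally have Jd: "J d = (\<integral>x. E x * of_real (\<beta> x) - E (x + (3 * d) *\<^sub>R e) * of_real (\<beta> x) \<partial>lebesgue) / of_real d" .
    \<comment> \<open>Where the bump lives: \<open>s x / d\<close> runs through [-2, -1), a strip of
      height \<open>d\<close>.\<close>
    let ?S = "cball 0 (R + 3) \<inter> {x. - (2 * d) \<le> s x \<and> s x < - (2 * d) + d}"
    have S: "?S \<in> lmeasurable"
    proof -
      have m: "s \<in> borel_measurable borel" using cs by (rule borel_measurable_continuous_onI)
      have "{x \<in> space borel. - (2 * d) \<le> s x \<and> s x < - (2 * d) + d} \<in> sets borel" using m by measurable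
      then show ?thesis by (intro fmeasurable_Int_fmeasurable[OF lmeasurable_cball]) auto
    qed
    have "norm (\<integral>x. E x * of_real (\<beta> x) - E (x + (3 * d) *\<^sub>R e) * of_real (\<beta> x) \<partial>lebesgue) \<le> (\<integral>x. 9 * \<omega> * indicator ?S x \<partial>lebesgue)"
    proof (rule Bochner_Integration.integral_norm_bound_integral)
      show "integrable lebesgue (\<lambda>x. 9 * \<omega> * indicat_real ?S x)"
        using S by (intro integrable_mult_right integrable_real_indicator) (auto simp: fmeasurable_def)
      fix x
      have eq: "norm (E x * of_real (\<beta> x) - E (x + (3 * d) *\<^sub>R e) * of_real (\<beta> x)) = norm (E x - E (x + (3 * d) *\<^sub>R e)) * \<beta> x"
        using step_bump_bounds(1)[of "s x / d"] by (simp add: \<beta>_def left_diff_distrib[symmetric] norm_mult)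
      show "norm (E x * of_real (\<beta> x) - E (x + (3 * d) *\<^sub>R e) * of_real (\<beta> x)) \<le> 9 * \<omega> * indicat_real ?S x"
      proof (cases "x \<in> ?S")
        case True
        have "norm (E x - E (x + (3 * d) *\<^sub>R e)) * \<beta> x \<le> \<omega> * 9"
          using \<omega>[of x] step_bump_bounds(1,2)[of "s x / d"] w0 by (intro mult_mono) (auto simp: \<beta>_def)
        then show ?thesis unfolding eq using True by simp
      next
        case False
        then consider "norm x > R + 3" | "s x / d < - 2 \<or> - 1 \<le> s x / d"
          using d by (auto simp: field_simps)
        then show ?thesis
        proof cases
          case 1 then show ?thesis unfolding eq using ER[of x] E3[of x] w0 by simp
        next
          case 2 then show ?thesis unfolding eq \<beta>_def using step_bump_bounds(3) w0 by simp
        qed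
      qed
    qed (use i1 i3 in auto)
    also have "\<dots> = 9 * \<omega> * measure lebesgue ?S" using S by (simp add: fmeasurableD)
    also have "\<dots> \<le> 9 * \<omega> * (d * C)"
      unfolding C_def using measure_strip_le[OF s d, of "R + 3" "- (2 * d)"] R(1) w0 by (intro mult_left_mono) auto
    finally show ?thesis unfolding Jd using d by (simp add: norm_divide field_simps)
  qed
  show ?thesis
  proof (rule LIMSEQ_I)
    fix r :: real assume r: "r > 0"
    define \<omega> where "\<omega> = r / (9 * (C + 1))"
    have \<omega>: "\<omega> > 0" "9 * \<omega> * C < r" using r C0 by (auto simp: \<omega>_def field_simps)
    obtain \<delta> where \<delta>: "\<delta> > 0" "\<And>x y. dist x y < \<delta> \<Longrightarrow> dist (E x) (E y) < \<omega>"
      using uniformly_continuous_compact_supp[OF E(1) ER \<omega>(1)] by blast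
    have d3: "\<delta> / 3 > 0" using \<delta> by simp
    obtain n0 where n0: "\<And>n. n \<ge> n0 \<Longrightarrow> norm (vanish_seq 1 n - 0) < \<delta> / 3"
      using LIMSEQ_D[OF vanish_seq(3)[of 1] d3] by blast
    have "norm (J (vanish_seq 1 n)) < r" if n: "n \<ge> n0" for n
    proof -
      have v: "0 < vanish_seq 1 n" "vanish_seq 1 n \<le> 1" using vanish_seq[of 1] by auto
      have "norm (E x - E (x + (3 * vanish_seq 1 n) *\<^sub>R e)) \<le> \<omega>" for x
        using \<delta>(2)[of x "x + (3 * vanish_seq 1 n) *\<^sub>R e"] n0[OF n] v st(2) by (simp add: dist_norm less_imp_le)
      from J[OF v this] show ?thesis using \<omega>(2) by simp
    qed
    then show "\<exists>n0. \<forall>n\<ge>n0. norm ((\<integral>x. E x * of_real ((step_bump (s x / vanish_seq 1 n) - step_bump (s x / vanish_seq 1 n - 3)) / vanish_seq 1 n) \<partial>lebesgue) - 0) < r"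
      unfolding J_def by auto
  qed
qed

text \<open>Test with \<open>\<psi> (1 - hat (s / \<delta>))\<close> and let \<open>\<delta>\<close> tend to zero.\<close>

lemma weak_lap_across_graph:
  fixes s :: "real^2 \<Rightarrow> real"
  assumes W: "open W" and v: "C1_on W v" and f: "locally_integrable W f"
    and s: "graph_height s e" and weak: "weak_lap (W - {x. s x = 0}) v f"
  shows "weak_lap W v f"
  unfolding weak_lap_def
proof (intro allI impI)
  fix \<psi> :: "real^2 \<Rightarrow> complex" assume \<psi>: "C1c W \<psi>"
  have sC: "C1_on UNIV s" using s by (simp add: graph_height_def)
  have cs: "continuous_on UNIV s" by (rule C1_on_continuous[OF sC])
  have pds: "continuous_on UNIV (pd b s)" if "b \<in> Basis" for b using sC that by (simp add: C1_on_def)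
  define d where "d = vanish_seq 1"
  have d: "d n > 0" "d \<longlonglongrightarrow> 0" for n unfolding d_def using vanish_seq[of 1] by auto
  define p where "p n t = 1 - hat (t / d n)" for n t
  define p' where "p' n t = - ((step_bump (t / d n) - step_bump (t / d n - 3)) / d n)" for n t
  have pD: "(p n has_real_derivative p' n t) (at t)" for n t
  proof -
    have "((\<lambda>t. t / d n) has_real_derivative 1 / d n) (at t)"
      using d(1)[of n] by (auto intro!: derivative_eq_intros)
    from DERIV_chain2[OF hat_deriv this]
    have "((\<lambda>t. hat (t / d n)) has_real_derivative (step_bump (t / d n) - step_bump (t / d n - 3)) * (1 / d n)) (at t)" .
    from DERIV_diff[OF DERIV_const[of 1] this] show ?thesis unfolding p_def[abs_def] p'_def by simp
  qed
  have p'c: "continuous_on UNIV (p' n)" for n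
    unfolding p'_def divide_inverse
    by (intro continuous_intros continuous_on_compose2[OF step_bump_continuous]) auto
  note comp = C1_on_compose[OF pD p'c sC]
  define q where "q n x = complex_of_real (p n (s x))" for n x
  have q: "C1_on UNIV (q n)" for n unfolding q_def by (rule C1_on_of_real[OF comp(1)])
  have pdq: "pd b (q n) x = of_real (p' n (s x) * pd b s x)" for n b x
  proof -
    have dp: "(\<lambda>x. p n (s x)) differentiable (at x)" using comp(1)[of n] by (simp add: C1_on_def)
    have "q n = (\<lambda>x. of_real (p n (s x)))" by (simp add: q_def[abs_def])
    then show ?thesis by (simp only: pd_of_real[OF dp] comp(2))
  qed
  have q0: "q n x = 0" if "\<bar>s x\<bar> \<le> d n" for n x
  proof -
    have "\<bar>s x / d n\<bar> \<le> 1" using that d(1)[of n] by simp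
    then show ?thesis using hat_bounds(1) by (simp add: q_def p_def)
  qed
  have qb: "norm (q n x) \<le> 2" for n x
    using hat_bounds(3,4)[of "s x / d n"] by (simp add: q_def p_def del: of_real_diff)
  have qlim: "(\<lambda>n. q n x) \<longlonglongrightarrow> 1" if "s x \<noteq> 0" for x
  proof (rule tendsto_eventually)
    have "eventually (\<lambda>n. dist (d n) 0 < \<bar>s x\<bar> / 2) sequentially"
      using tendstoD[OF d(2), of "\<bar>s x\<bar> / 2"] that by simp
    then show "eventually (\<lambda>n. q n x = 1) sequentially"
    proof eventually_elim
      case (elim n)
      then have "2 \<le> \<bar>s x / d n\<bar>" using d(1)[of n] by (simp add: dist_norm field_simps)
      then show ?case using hat_bounds(2) by (simp add: q_def p_def)
    qed
  qed
  have c0: "C1c W (\<lambda>x. q n x * \<psi> x)" for n by (rule C1c_mult[OF W C1_on_subset[OF q subset_UNIV] \<psi>])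
  have c: "C1c (W - {x. s x = 0}) (\<lambda>x. q n x * \<psi> x)" for n
  proof (rule C1c_mono[OF c0])
    have "supp (\<lambda>x. q n x * \<psi> x) \<subseteq> {x. \<bar>s x\<bar> \<ge> d n}"
      by (rule supp_subset_closed) (use q0 in \<open>auto intro!: closed_Collect_le continuous_intros cs\<close>)
    then show "supp (\<lambda>x. q n x * \<psi> x) \<subseteq> W - {x. s x = 0}"
      using C1c_supp[OF c0[of n]] d(1)[of n] by fastforce
  qed
  \<comment> \<open>The coefficient of the singular layer term, \<open>\<psi>\<close> times the
    product of the gradients of \<open>v\<close> and \<open>s\<close>. It is continuous because the
    gradient of \<open>v\<close> is: this is where the transmission conditions enter.\<close>
  define E where "E x = (\<Sum>b\<in>Basis. pd b v x * (of_real (pd b s x) * \<psi> x))" for x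
  have Ec: "continuous_on UNIV E"
  proof -
    have "continuous_on UNIV (\<lambda>x. pd b v x * (of_real (pd b s x) * \<psi> x))" if b: "b \<in> Basis" for b
      by (rule C1c_mult_continuous(1)[OF W _ _ C1c_compact[OF \<psi>] C1c_supp[OF \<psi>]])
        (use v b pds[OF b] C1c_continuous[OF \<psi>] not_in_supp[of _ \<psi>] in \<open>auto simp: C1_on_def intro!: continuous_intros\<close>)
    then show ?thesis unfolding E_def by (intro continuous_on_sum)
  qed
  have E0: "E x = 0" if "x \<notin> supp \<psi>" for x using not_in_supp[OF that] by (simp add: E_def)
  define J where "J n = (\<integral>x. E x * of_real ((step_bump (s x / d n) - step_bump (s x / d n - 3)) / d n) \<partial>lebesgue)" for n
  have J: "J \<longlonglongrightarrow> 0"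
    unfolding J_def[abs_def] d_def by (rule interface_layer_tendsto[OF s Ec C1c_compact[OF \<psi>] E0])
  have split: "gdot v (\<lambda>x. q n x * \<psi> x) x = gdot v \<psi> x * q n x - E x * of_real ((step_bump (s x / d n) - step_bump (s x / d n - 3)) / d n)" for n x
  proof -
    have "gdot v (\<lambda>x. q n x * \<psi> x) x = (\<Sum>b\<in>Basis. pd b v x * (pd b (q n) x * \<psi> x + q n x * pd b \<psi> x))"
      unfolding gdot_def by (simp add: C1c_mult_pd[OF W C1_on_subset[OF q subset_UNIV] \<psi>])
    also have "\<dots> = (\<Sum>b\<in>Basis. pd b v x * pd b \<psi> x) * q n x + (\<Sum>b\<in>Basis. pd b v x * (of_real (pd b s x) * \<psi> x)) * of_real (p' n (s x))"
      unfolding pdq sum_distrib_right sum.distrib[symmetric] by (intro sum.cong refl) (simp add: algebra_simps)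
    finally show ?thesis unfolding gdot_def E_def p'_def by simp
  qed
  have ig: "integrable lebesgue (gdot v \<psi>)" by (rule gdot_continuous_integrable(2)[OF W v \<psi>])
  have qm: "q n \<in> borel_measurable lebesgue" for n
    by (rule measurable_lebesgue_continuous[OF C1_on_continuous[OF q]])
  have ae: "AE x in lebesgue. (\<lambda>n. q n x) \<longlonglongrightarrow> 1"
  proof -
    have "{x. \<not> (\<lambda>n. q n x) \<longlonglongrightarrow> 1} \<subseteq> {x. s x = 0}" using qlim by auto
    then show ?thesis unfolding AE_lebesgue_iff using negligible_subset[OF negligible_graph[OF s]] by blast
  qed
  have qlim_int: "(\<lambda>n. \<integral>x. g x * q n x \<partial>lebesgue) \<longlonglongrightarrow> (\<integral>x. g x \<partial>lebesgue)"
    and qint: "integrable lebesgue (\<lambda>x. g x * q n x)"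
    if g: "integrable lebesgue g" for g :: "real^2 \<Rightarrow> complex" and n
  proof -
    have b: "norm (g x * q n x) \<le> 2 * norm (g x)" for x n
      using mult_left_mono[OF qb[of n x], of "norm (g x)"] by (simp add: norm_mult mult.commute)
    have i2: "integrable lebesgue (\<lambda>x. 2 * norm (g x))" using g by auto
    have m: "(\<lambda>x. g x * q n x) \<in> borel_measurable lebesgue" for n
      by (rule borel_measurable_times[OF borel_measurable_integrable[OF g] qm])
    show "(\<lambda>n. \<integral>x. g x * q n x \<partial>lebesgue) \<longlonglongrightarrow> (\<integral>x. g x \<partial>lebesgue)"
    proof (rule integral_dominated_convergence[OF _ m i2])
      show "AE x in lebesgue. (\<lambda>n. g x * q n x) \<longlonglongrightarrow> g x"
        using ae
      proof eventually_elim
        case (elim x)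
        from tendsto_mult[OF tendsto_const[of "g x"] this] show ?case by simp
      qed
    qed (use b borel_measurable_integrable[OF g] in auto)
    show "integrable lebesgue (\<lambda>x. g x * q n x)"
      by (rule Bochner_Integration.integrable_bound[OF i2 m]) (use b in \<open>auto intro!: AE_I2\<close>)
  qed
  have "(\<integral>x. gdot v \<psi> x * q n x \<partial>lebesgue) - J n = - (\<integral>x. f x * \<psi> x * q n x \<partial>lebesgue)" for n
  proof -
    have "integrable lebesgue (\<lambda>x. gdot v \<psi> x * q n x - gdot v (\<lambda>x. q n x * \<psi> x) x)"
      using qint[OF ig] gdot_continuous_integrable(2)[OF W v c0] by (intro Bochner_Integration.integrable_diff)
    then have iJ: "integrable lebesgue (\<lambda>x. E x * of_real ((step_bump (s x / d n) - step_bump (s x / d n - 3)) / d n))"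
      unfolding split by simp
    have "(\<integral>x. gdot v \<psi> x * q n x \<partial>lebesgue) - J n = (\<integral>x. gdot v (\<lambda>x. q n x * \<psi> x) x \<partial>lebesgue)"
      unfolding split J_def by (rule Bochner_Integration.integral_diff[OF qint[OF ig] iJ, symmetric])
    also have "\<dots> = - (\<integral>x. f x * (q n x * \<psi> x) \<partial>lebesgue)" by (rule weak_lapD[OF weak c])
    finally show ?thesis by (simp add: mult_ac)
  qed
  moreover have "(\<lambda>n. (\<integral>x. gdot v \<psi> x * q n x \<partial>lebesgue) - J n) \<longlonglongrightarrow> (\<integral>x. gdot v \<psi> x \<partial>lebesgue) - 0"
    by (intro tendsto_diff qlim_int[OF ig] J)
  moreover have "(\<lambda>n. - (\<integral>x. f x * \<psi> x * q n x \<partial>lebesgue)) \<longlonglongrightarrow> - (\<integral>x. f x * \<psi> x \<partial>lebesgue)"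
    by (intro tendsto_minus qlim_int locally_integrable_mult_C1c[OF f \<psi>])
  ultimately have "(\<integral>x. gdot v \<psi> x \<partial>lebesgue) - 0 = - (\<integral>x. f x * \<psi> x \<partial>lebesgue)"
    by (simp only:) (rule LIMSEQ_unique)
  then show "(\<integral>x. gdot v \<psi> x \<partial>lebesgue) = - (\<integral>x. f x * \<psi> x \<partial>lebesgue)" by simp
qed

section \<open>Frontiers of C^2 domains\<close>

lemma C1_on_bounded_linear:
  fixes L :: "'a::euclidean_space \<Rightarrow> real"
  assumes "bounded_linear L" shows "C1_on UNIV L"
proof -
  have D: "(L has_derivative L) (at z)" for z by (rule bounded_linear_imp_has_derivative[OF assms])
  have "pd h L = (\<lambda>z. L h)" for h using pd_eqI[OF D] by (rule ext)
  then show ?thesis using D unfolding C1_on_def differentiable_def by auto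
qed

text \<open>The height is second coordinate minus \<open>g\<close> of the first, both after
  \<open>T\<close>, and \<open>e\<close> is the direction that \<open>T\<close> sends to the second
  axis. A frontier point is not in the open set \<open>U\<close>, which excludes
  \<open>s < 0\<close>; it is a limit of points of \<open>U\<close>, which excludes
  \<open>s > 0\<close>.\<close>

lemma C2_domain_frontier_graph:
  assumes U: "C2_domain U" and p: "p \<in> frontier U"
  obtains V s e where "open V" "p \<in> V" "graph_height s e" "frontier U \<inter> V \<subseteq> {x. s x = 0}"
proof -
  obtain V and T :: "real^2 \<Rightarrow> real^2" and g :: "real \<Rightarrow> real" where
    V: "open V" "p \<in> V" and T: "orthogonal_transformation T" and g: "C_on 2 UNIV g"
    and UV: "U \<inter> V = {x \<in> V. T x $ 2 < g (T x $ 1)}"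
    using U p unfolding C2_domain_def by meson
  have oU: "open U" using U by (simp add: C2_domain_def)
  define e where "e = inv T (axis 2 1)"
  have Te: "T e = axis 2 1"
    unfolding e_def using orthogonal_transformation_surj[OF T] by (simp add: surj_f_inv_f)
  have ne: "norm e = 1" using T Te by (metis norm_axis_1 orthogonal_transformation_norm)
  have lT: "linear T" using T by (simp add: orthogonal_transformation_linear)
  have bT: "bounded_linear (\<lambda>x. T x $ i)" for i
    by (rule bounded_linear_compose[OF bounded_linear_vec_nth linear_linear[THEN iffD2, OF lT, unfolded linear_conv_bounded_linear]])
  define s where "s x = T x $ 2 - g (T x $ 1)" for x
  have g1: "C_on (Suc 1) UNIV g" using g by (simp only: Suc_1)
  have gd: "g differentiable (at t)" for t using g1 unfolding C_on.simps(2)[of 1] by blast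
  have gC: "C_on 1 UNIV (\<lambda>t. frechet_derivative g (at t) b)" if "b \<in> Basis" for b
    using g1 that unfolding C_on.simps(2)[of 1] by blast
  have gc: "continuous_on UNIV (pd 1 g)"
    using C1_on_continuous[OF gC[unfolded C_on_1, of 1]] by (simp add: pd_def[abs_def])
  have gD: "(g has_real_derivative pd 1 g t) (at t)" for t
  proof -
    have "pd h g t = pd 1 g t * h" for h
      using linear_scale[OF linear_pd[OF gd], of h 1 t] by (simp add: mult.commute)
    then have eq: "(\<lambda>h. pd h g t) = (*) (pd 1 g t)" by (rule ext)
    show ?thesis unfolding has_field_derivative_def eq[symmetric] by (rule has_derivative_pd[OF gd])
  qed
  have sC: "C1_on UNIV s"
    unfolding s_def[abs_def]
    by (intro C1_on_diff C1_on_compose(1)[OF gD gc] C1_on_bounded_linear bT)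
  have "graph_height s e"
    unfolding graph_height_def using sC ne
    by (auto simp: s_def linear_add[OF lT] linear_scale[OF lT] Te axis_def)
  moreover have "frontier U \<inter> V \<subseteq> {x. s x = 0}"
  proof
    fix x assume x: "x \<in> frontier U \<inter> V"
    then have "x \<notin> U" using oU by (simp add: frontier_def interior_open)
    then have "\<not> s x < 0" using x UV unfolding s_def by fastforce
    moreover have "\<not> s x > 0"
    proof
      assume "s x > 0"
      have "continuous_on UNIV s" by (rule C1_on_continuous[OF sC])
      then have "open {x. s x > 0}" by (intro open_Collect_less) auto
      then have "open ({x. s x > 0} \<inter> V)" using V by auto
      moreover have "x \<in> closure U" using x by (simp add: frontier_def)
      ultimately have "({x. s x > 0} \<inter> V) \<inter> U \<noteq> {}"
        using \<open>s x > 0\<close> x open_Int_closure_eq_empty[of "{x. s x > 0} \<inter> V" U] by blast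
      then obtain y where y: "s y > 0" "y \<in> V" "y \<in> U" by blast
      then have "y \<in> {x \<in> V. T x $ 2 < g (T x $ 1)}" using UV by blast
      then show False using y(1) by (simp add: s_def)
    qed
    ultimately show "x \<in> {x. s x = 0}" by simp
  qed
  ultimately show ?thesis using that V by blast
qed

lemma graph_height_exists: "\<exists>s e. graph_height (s :: real^2 \<Rightarrow> real) e"
proof -
  have "graph_height (\<lambda>x :: real^2. x \<bullet> axis 1 1) (axis 1 1)"
    unfolding graph_height_def
    by (auto intro!: C1_on_bounded_linear bounded_linear_inner_left simp: inner_add_left inner_axis_axis)
  then show ?thesis by blast
qed

text \<open>Away from the frontier any graph serves, with a neighbourhood that misses the frontier.
  A statement for all points lets every domain supply a graph at one and the same
  \<open>p\<close>.\<close>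

lemma C2_domain_local_graph:
  assumes U: "C2_domain U"
  obtains V s e where "open V" "p \<in> V" "graph_height s e" "frontier U \<inter> V \<subseteq> {x. s x = 0}"
proof (cases "p \<in> frontier U")
  case True
  then show ?thesis using C2_domain_frontier_graph[OF U] that by blast
next
  case False
  obtain s and e :: "real^2" where "graph_height s e" using graph_height_exists by blast
  then show ?thesis using that[of "- frontier U" s e] False by (auto simp: open_Compl)
qed

lemma C2_domain_negligible_frontier:
  assumes U: "C2_domain U" shows "negligible (frontier U)"
  unfolding locally_negligible_alt[of "frontier U"]
proof
  fix p assume p: "p \<in> frontier U"
  obtain V s e where V: "open V" "p \<in> V" "graph_height s e" "frontier U \<inter> V \<subseteq> {x. s x = 0}"
    using C2_domain_local_graph[OF U, of p] by blast
  then have "negligible (frontier U \<inter> V)" using negligible_subset negligible_graph by blast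
  then show "\<exists>Ua. openin (top_of_set (frontier U)) Ua \<and> p \<in> Ua \<and> negligible Ua"
    using V p by (intro exI[of _ "frontier U \<inter> V"]) (auto simp: openin_open)
qed

text \<open>Near \<open>p\<close> the frontiers lie in finitely many zero sets of heights. The
  equation holds off all of them, and each is then crossed by \<open>weak_lap_across_graph\<close>;
  the interfaces may meet at \<open>p\<close> in any way.\<close>

lemma weak_lap_across_interfaces:
  fixes N :: nat and \<Omega> :: "nat \<Rightarrow> (real^2) set"
  assumes \<Omega>: "\<And>i. i \<le> N \<Longrightarrow> C2_domain (\<Omega> i)" and cover: "(\<Union>i\<le>N. closure (\<Omega> i)) = UNIV"
    and W: "open W" and v: "C1_on W v" and f: "locally_integrable W f"
    and weak: "\<And>i. i \<le> N \<Longrightarrow> weak_lap (\<Omega> i \<inter> W) v f"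
  shows "weak_lap W v f"
proof (rule weak_lap_local[OF W v f])
  fix p assume pW: "p \<in> W"
  have "\<forall>i. \<exists>V s e. i \<le> N \<longrightarrow> open V \<and> p \<in> V \<and> graph_height s e \<and> frontier (\<Omega> i) \<inter> V \<subseteq> {x. s x = 0}"
    using C2_domain_local_graph[OF \<Omega>] by metis
  then obtain V s e where V: "\<And>i. i \<le> N \<Longrightarrow> open (V i) \<and> p \<in> V i \<and> graph_height (s i) (e i) \<and> frontier (\<Omega> i) \<inter> V i \<subseteq> {x. s i x = 0}"
    by metis
  have "open (\<Inter>i\<in>{..N}. V i)" using V by (intro open_INT) auto
  moreover have "p \<in> (\<Inter>i\<in>{..N}. V i)" using V by auto
  ultimately obtain r where r: "r > 0" "ball p r \<subseteq> (\<Inter>i\<in>{..N}. V i)" using openE by blast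
  let ?B = "ball p r \<inter> W"
  have B: "open ?B" using W by auto
  have vs: "C1_on X v" if "X \<subseteq> W" for X using C1_on_subset[OF v that] .
  have fs: "locally_integrable X f" if "X \<subseteq> W" for X using f that unfolding locally_integrable_def by blast
  have oO: "open (\<Omega> i)" if "i \<le> N" for i using \<Omega>[OF that] by (simp add: C2_domain_def)
  let ?Z = "\<lambda>A. ?B - (\<Union>i\<in>A. {x. s i x = 0})"
  have cs: "closed {x. s i x = 0}" if "i \<le> N" for i
  proof -
    have "continuous_on UNIV (s i)" using V[OF that] C1_on_continuous by (auto simp: graph_height_def)
    then show ?thesis by (intro closed_Collect_eq) auto
  qed
  have oZ: "open (?Z A)" if "A \<subseteq> {..N}" for A
    using that finite_subset[OF that] cs by (intro open_Diff B closed_UN) auto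
  \<comment> \<open>No frontier passes through a point off all zero sets, so the point is interior
    to the piece whose closure contains it.\<close>
  have start: "weak_lap (?Z {..N}) v f"
  proof (rule weak_lap_local[OF oZ[OF order_refl] vs fs])
    fix x assume x: "x \<in> ?Z {..N}"
    then obtain i where i: "i \<le> N" "x \<in> closure (\<Omega> i)" using cover by blast
    have "x \<notin> frontier (\<Omega> i)" using x V[OF i(1)] r(2) i(1) by blast
    then have xi: "x \<in> \<Omega> i" using i(2) oO[OF i(1)] by (simp add: frontier_def interior_open)
    obtain \<rho> where \<rho>: "\<rho> > 0" "ball x \<rho> \<subseteq> \<Omega> i" using openE[OF oO[OF i(1)] xi] by blast
    have "weak_lap (ball x \<rho> \<inter> ?Z {..N}) v f"
      by (rule weak_lap_mono[OF weak[OF i(1)]]) (use \<rho>(2) in auto)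
    then show "\<exists>r>0. weak_lap (ball x r \<inter> ?Z {..N}) v f" using \<rho>(1) by blast
  qed auto
  \<comment> \<open>The zero sets are put back one at a time; those still removed form a closed set,
    so each step takes place in an open set.\<close>
  have step: "A \<subseteq> {..N} \<Longrightarrow> weak_lap (?Z A) v f \<Longrightarrow> weak_lap ?B v f" if "finite A" for A
    using that
  proof (induction A rule: finite_induct)
    case (insert i A)
    have i: "i \<le> N" and A: "A \<subseteq> {..N}" using insert.prems by auto
    have "?Z (insert i A) = ?Z A - {x. s i x = 0}" by auto
    then have "weak_lap (?Z A - {x. s i x = 0}) v f" using insert.prems(2) by simp
    then have "weak_lap (?Z A) v f"
      using V[OF i] by (intro weak_lap_across_graph[OF oZ[OF A] vs fs, of "s i" "e i"]) auto
    then show ?case using insert.IH[OF A] by blast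
  qed simp
  have "weak_lap ?B v f" using step[of "{..N}"] start by auto
  then show "\<exists>r>0. weak_lap (ball p r \<inter> W) v f" using r(1) by blast
qed

section \<open>Green identities\<close>

text \<open>Used with the complement of the interfaces for \<open>U\<close>: the values of the refractive
  indices on the interfaces are arbitrary.\<close>

definition regular_on :: "(real^2) set \<Rightarrow> (real^2) set \<Rightarrow> (real^2 \<Rightarrow> complex) \<Rightarrow> bool" where
  "regular_on U W f \<longleftrightarrow> continuous_on (U \<inter> W) f \<and>
     (\<forall>K. compact K \<and> K \<subseteq> W \<longrightarrow> bounded (f ` (K \<inter> U)))"

lemma regular_on_continuous: "continuous_on W f \<Longrightarrow> regular_on U W f"
  unfolding regular_on_def
proof (intro conjI allI impI)
  assume f: "continuous_on W f"
  show "continuous_on (U \<inter> W) f" by (rule continuous_on_subset[OF f]) auto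
  fix K assume "compact K \<and> K \<subseteq> W"
  then have "bounded (f ` K)" using f by (intro compact_imp_bounded compact_continuous_image) (auto intro: continuous_on_subset)
  then show "bounded (f ` (K \<inter> U))" by (rule bounded_subset) auto
qed

lemma regular_on_mono: "regular_on U W f \<Longrightarrow> V \<subseteq> W \<Longrightarrow> regular_on U V f"
  unfolding regular_on_def by (meson Int_mono continuous_on_subset order_refl subset_trans)

lemma regular_on_bound:
  assumes "regular_on U W f" "compact K" "K \<subseteq> W"
  obtains C where "C > 0" "\<And>z. z \<in> K \<Longrightarrow> z \<in> U \<Longrightarrow> norm (f z) \<le> C"
proof -
  have "bounded (f ` (K \<inter> U))" using assms unfolding regular_on_def by blast
  then obtain C where "C > 0" "\<forall>y\<in>f ` (K \<inter> U). norm y \<le> C" unfolding bounded_pos by blast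
  then show ?thesis using that by blast
qed

lemma regular_on_mult:
  assumes "regular_on U W f" "regular_on U W g"
  shows "regular_on U W (\<lambda>z. f z * g z)"
  unfolding regular_on_def
proof (intro conjI allI impI)
  show "continuous_on (U \<inter> W) (\<lambda>z. f z * g z)"
    using assms unfolding regular_on_def by (intro continuous_on_mult) auto
  fix K assume K: "compact K \<and> K \<subseteq> W"
  obtain C where C: "C > 0" "\<And>z. z \<in> K \<Longrightarrow> z \<in> U \<Longrightarrow> norm (f z) \<le> C" using regular_on_bound[OF assms(1)] K by blast
  obtain D where D: "D > 0" "\<And>z. z \<in> K \<Longrightarrow> z \<in> U \<Longrightarrow> norm (g z) \<le> D" using regular_on_bound[OF assms(2)] K by blast
  show "bounded ((\<lambda>z. f z * g z) ` (K \<inter> U))"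
    unfolding bounded_iff
  proof (intro exI[of _ "C * D"] ballI)
    fix y assume "y \<in> (\<lambda>z. f z * g z) ` (K \<inter> U)"
    then show "norm y \<le> C * D" using C D by (auto simp: norm_mult intro!: mult_mono)
  qed
qed

lemma regular_on_add:
  assumes "regular_on U W f" "regular_on U W g"
  shows "regular_on U W (\<lambda>z. f z + g z)"
  unfolding regular_on_def
proof (intro conjI allI impI)
  show "continuous_on (U \<inter> W) (\<lambda>z. f z + g z)"
    using assms unfolding regular_on_def by (intro continuous_on_add) auto
  fix K assume K: "compact K \<and> K \<subseteq> W"
  obtain C where C: "C > 0" "\<And>z. z \<in> K \<Longrightarrow> z \<in> U \<Longrightarrow> norm (f z) \<le> C" using regular_on_bound[OF assms(1)] K by blast
  obtain D where D: "D > 0" "\<And>z. z \<in> K \<Longrightarrow> z \<in> U \<Longrightarrow> norm (g z) \<le> D" using regular_on_bound[OF assms(2)] K by blast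
  show "bounded ((\<lambda>z. f z + g z) ` (K \<inter> U))"
    unfolding bounded_iff
  proof (intro exI[of _ "C + D"] ballI)
    fix y assume "y \<in> (\<lambda>z. f z + g z) ` (K \<inter> U)"
    then show "norm y \<le> C + D" using C D by (auto intro!: norm_triangle_mono)
  qed
qed

lemma regular_on_extend_zero:
  assumes f: "regular_on U W f" and U: "open U" and W: "open W" and K: "compact K" "K \<subseteq> W" "\<And>z. z \<notin> K \<Longrightarrow> f z = 0"
  shows "regular_on U UNIV f"
  unfolding regular_on_def
proof (intro conjI allI impI)
  have "continuous_on (U \<inter> W) f" using f by (simp add: regular_on_def)
  moreover have "continuous_on (- K) f" by (rule continuous_on_eq[where f="\<lambda>_. 0"]) (use K in auto)
  ultimately have "continuous_on ((U \<inter> W) \<union> (- K)) f"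
    using U W K compact_imp_closed by (intro continuous_on_open_Un) auto
  then show "continuous_on (U \<inter> UNIV) f" by (rule continuous_on_subset) (use K in auto)
  fix K' :: "(real^2) set" assume "compact K' \<and> K' \<subseteq> UNIV"
  obtain C where C: "C > 0" "\<And>z. z \<in> K \<Longrightarrow> z \<in> U \<Longrightarrow> norm (f z) \<le> C" using regular_on_bound[OF f K(1,2)] by blast
  have "norm (f z) \<le> C" if "z \<in> U" for z using C K(3)[of z] that by (cases "z \<in> K") auto
  then show "bounded (f ` (K' \<inter> U))" unfolding bounded_iff by blast
qed

text \<open>The kernel reflected at \<open>z\<close> is an admissible test function, and the weak
  equation tested with it yields the mollified right-hand side. Thus a mollified function inherits
  bounds for its Laplacian from \<open>F\<close>.\<close>

lemma laplacian_conv_ker: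
  assumes h: "C1c W h" and weak: "weak_lap UNIV h F" and e: "e > 0"
  shows "laplacian (conv (ker e) h) z = conv (ker e) F z"
proof -
  let ?k = "\<lambda>t. of_real (ker e (z - t)) :: complex"
  note k = ker_C1[OF e]
  have kc: "C1c UNIV ?k"
    by (rule C1cI[OF reflected_kernel(1)[OF k] compact_cball[of z e]]) (auto simp: ker_eq_0[OF e] dist_norm)
  have h': "C1_on UNIV h" using h by (simp add: C1c_def)
  have "laplacian (conv (ker e) h) z = (\<Sum>b\<in>Basis. conv (pd b (ker e)) (pd b h) z)"
    unfolding laplacian_pd by (intro sum.cong refl pd_pd_conv_ker[OF h _ e])
  also have "\<dots> = (\<Sum>b\<in>Basis. \<integral>t. - (pd b h t * pd b ?k t) \<partial>lebesgue)"
    unfolding conv_def reflected_kernel(2)[OF k] by (simp add: scaleR_conv_of_real mult.commute)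
  also have "\<dots> = - (\<integral>t. gdot h ?k t \<partial>lebesgue)"
  proof -
    have "(\<integral>t. gdot h ?k t \<partial>lebesgue) = (\<Sum>b\<in>Basis. \<integral>t. pd b h t * pd b ?k t \<partial>lebesgue)"
      unfolding gdot_def by (intro Bochner_Integration.integral_sum gdot_continuous_integrable(3)[OF open_UNIV h' kc])
    then show ?thesis by (simp add: sum_negf)
  qed
  also have "\<dots> = (\<integral>t. F t * ?k t \<partial>lebesgue)" using weak_lapD[OF weak kc] by simp
  also have "\<dots> = conv (ker e) F z" unfolding conv_def by (simp add: scaleR_conv_of_real mult.commute)
  finally show ?thesis .
qed

context
  fixes U :: "(real^2) set"
  assumes openU: "open U" and nullU: "negligible (- U)"
begin

lemma AE_regular: "AE z in lebesgue. z \<in> U"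
  using nullU unfolding AE_lebesgue_iff Compl_eq .

lemma AE_U_I: "(\<And>z. z \<in> U \<Longrightarrow> P z) \<Longrightarrow> AE z in lebesgue. P z"
  using AE_regular by eventually_elim

text \<open>Setting \<open>f\<close> to 0 off \<open>U\<close> gives a Borel function and changes
  \<open>f\<close> only on a null set; completeness of Lebesgue measure carries measurability
  back.\<close>

lemma regular_on_measurable_compact:
  assumes f: "regular_on U W f" and K: "compact K" "K \<subseteq> W"
  shows "(\<lambda>z. indicator K z *\<^sub>R f z) \<in> borel_measurable lebesgue" "set_integrable lebesgue K f"
proof -
  have "continuous_on (U \<inter> K) f" using f K(2) unfolding regular_on_def by (blast intro: continuous_on_subset)
  moreover have KU: "U \<inter> K \<in> sets borel" by (intro sets.Int borel_open borel_closed openU compact_imp_closed K)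
  ultimately have "(\<lambda>z. indicator (U \<inter> K) z *\<^sub>R f z) \<in> borel_measurable borel"
    by (intro borel_measurable_continuous_on_indicator)
  then have g: "(\<lambda>z. indicator (U \<inter> K) z *\<^sub>R f z) \<in> borel_measurable lebesgue"
    by (intro measurable_completion) simp
  have ae: "AE z in lebesgue. indicator (U \<inter> K) z *\<^sub>R f z = indicator K z *\<^sub>R f z"
    by (rule AE_U_I) (simp add: indicator_def)
  show m: "(\<lambda>z. indicator K z *\<^sub>R f z) \<in> borel_measurable lebesgue"
    by (rule borel_measurable_AE[OF g ae])
  obtain C where C: "C > 0" "\<And>z. z \<in> K \<Longrightarrow> z \<in> U \<Longrightarrow> norm (f z) \<le> C" using regular_on_bound[OF f K] by blast
  show "set_integrable lebesgue K f"
    unfolding set_integrable_def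
    by (rule Bochner_Integration.integrable_bound[OF integrable_indicator_compact[OF K(1), of C] m])
      (rule AE_U_I, use C in \<open>auto simp: indicator_def\<close>)
qed

lemma regular_on_locally_integrable: "regular_on U W f \<Longrightarrow> locally_integrable W f"
  unfolding locally_integrable_def using regular_on_measurable_compact(2) by blast

lemma regular_on_measurable:
  assumes f: "regular_on U UNIV f"
  shows "f \<in> borel_measurable lebesgue"
proof -
  have "continuous_on U f" using f by (simp add: regular_on_def)
  then have "(\<lambda>z. indicator U z *\<^sub>R f z) \<in> borel_measurable borel"
    using openU by (intro borel_measurable_continuous_on_indicator) auto
  then have g: "(\<lambda>z. indicator U z *\<^sub>R f z) \<in> borel_measurable lebesgue"
    by (intro measurable_completion) simp
  show ?thesis by (rule borel_measurable_AE[OF g]) (rule AE_U_I, simp)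
qed

lemma regular_on_integrable:
  assumes f: "regular_on U UNIV f" and K: "compact K" "\<And>z. z \<notin> K \<Longrightarrow> f z = 0"
  shows "integrable lebesgue f"
proof -
  have "(\<lambda>z. indicator K z *\<^sub>R f z) = f" using K(2) by (auto simp: indicator_def)
  then show ?thesis using regular_on_measurable_compact(2)[OF f K(1)] unfolding set_integrable_def by simp
qed

lemma regular_on_mult_integrable:
  assumes v: "locally_integrable W v" and f: "regular_on U UNIV f" and K: "compact K" "K \<subseteq> W" "\<And>z. z \<notin> K \<Longrightarrow> f z = 0"
  shows "integrable lebesgue (\<lambda>z. v z * f z)"
proof -
  obtain C where C: "C > 0" "\<And>z. z \<in> K \<Longrightarrow> z \<in> U \<Longrightarrow> norm (f z) \<le> C" using regular_on_bound[OF f K(1)] by auto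
  have "AE z in lebesgue. norm (f z) \<le> C"
    by (rule AE_U_I) (use C K(3) in \<open>metis less_imp_le norm_zero\<close>)
  then show ?thesis
    by (rule locally_integrable_mult[OF v K(1,2) regular_on_measurable[OF f] _ K(3)])
qed

text \<open>The mollified \<open>h\<close> are test functions whose Laplacians are bounded and converge almost
  everywhere, so that local integrability of \<open>v\<close> is all that is needed of its singularity.\<close>

lemma distr_point_source_C1c:
  assumes q: "regular_on U UNIV q" and src: "distr_point_source k q (ball x \<rho>) x v"
    and h: "C1c (ball x \<rho>) h" and F: "regular_on U UNIV F" and K: "compact K" "K \<subseteq> ball x \<rho>" "\<And>z. z \<notin> K \<Longrightarrow> F z = 0"
    and weak: "weak_lap UNIV h F"
  shows "(\<integral>z. v z * (F z + of_real (k\<^sup>2) * q z * h z) \<partial>lebesgue) = - h x"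
proof -
  let ?K = "supp h \<union> K"
  have K': "compact ?K" "?K \<subseteq> ball x \<rho>" using C1c_compact[OF h] C1c_supp[OF h] K by auto
  obtain d L where d: "d > 0" and L: "compact L" "L \<subseteq> ball x \<rho>" "?K \<subseteq> L"
    and dL: "\<And>x y. x \<in> ?K \<Longrightarrow> dist x y \<le> d \<Longrightarrow> y \<in> L"
    using C1c_neighbourhood[OF K'(1) open_ball K'(2)] by blast
  define e where "e = vanish_seq d"
  have e: "\<And>n. e n > 0" "\<And>n. e n \<le> d" "e \<longlonglongrightarrow> 0" unfolding e_def using d vanish_seq by auto
  have v: "locally_integrable (ball x \<rho>) v" using src by (simp add: distr_point_source_def)
  have sF: "supp F \<subseteq> K" by (intro supp_subset_closed compact_imp_closed K)
  have iF: "integrable lebesgue F" by (rule regular_on_integrable[OF F K(1,3)])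
  have ih: "integrable lebesgue h" by (rule C1c_integrable[OF h])
  define \<phi> where "\<phi> n = conv (ker (e n)) h" for n
  have T: "test_function (ball x \<rho>) (\<phi> n)" for n
    unfolding \<phi>_def by (rule test_function_conv_ker[OF h e(1) e(2) L(1,2)]) (use dL in auto)
  have lap: "laplacian (\<phi> n) z = conv (ker (e n)) F z" for n z
    unfolding \<phi>_def by (rule laplacian_conv_ker[OF h weak e(1)])
  define g where "g n z = laplacian (\<phi> n) z + of_real (k\<^sup>2) * q z * \<phi> n z" for n z
  have eq: "(\<integral>z. v z * g n z \<partial>lebesgue) = - \<phi> n x" for n
    using src T[of n] unfolding distr_point_source_def g_def by blast
  obtain CF where CF: "CF > 0" "\<And>z. z \<in> K \<Longrightarrow> z \<in> U \<Longrightarrow> norm (F z) \<le> CF" using regular_on_bound[OF F K(1)] by auto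
  have aeF: "AE z in lebesgue. norm (F z) \<le> CF" by (rule AE_U_I) (use CF K(3) in \<open>metis less_imp_le norm_zero\<close>)
  obtain Cq where Cq: "Cq > 0" "\<And>z. z \<in> L \<Longrightarrow> z \<in> U \<Longrightarrow> norm (q z) \<le> Cq" using regular_on_bound[OF q L(1)] by auto
  obtain Ch where Ch: "Ch > 0" "\<And>z. norm (h z) \<le> Ch" using C1c_bound[OF h] by blast
  have g0: "g n z = 0" if "z \<notin> L" for n z
  proof -
    have "conv (ker (e n)) F z = 0" by (rule conv_ker_vanish[OF e(1,2) iF _ that]) (use dL sF in auto)
    moreover have "\<phi> n z = 0" unfolding \<phi>_def by (rule conv_ker_vanish[OF e(1,2) ih _ that]) (use dL in auto)
    ultimately show ?thesis by (simp add: g_def lap)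
  qed
  have gm: "g n \<in> borel_measurable lebesgue" for n
  proof -
    note C = test_function_C1c[OF T[of n]]
    have "laplacian (\<phi> n) = (\<lambda>z. \<Sum>b\<in>Basis. pd b (pd b (\<phi> n)) z)" by (simp add: laplacian_pd[abs_def])
    then have "laplacian (\<phi> n) \<in> borel_measurable lebesgue"
      using C1c_pd_continuous[OF C(2)] by (auto intro!: measurable_lebesgue_continuous continuous_on_sum)
    moreover have "\<phi> n \<in> borel_measurable lebesgue" by (rule measurable_lebesgue_continuous[OF C1c_continuous[OF C(1)]])
    ultimately show ?thesis unfolding g_def[abs_def]
      using regular_on_measurable[OF q] by (intro borel_measurable_add borel_measurable_times) auto
  qed
  have "(\<lambda>n. \<integral>z. v z * g n z \<partial>lebesgue) \<longlonglongrightarrow> (\<integral>z. v z * (F z + of_real (k\<^sup>2) * q z * h z) \<partial>lebesgue)"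
  proof (rule locally_integrable_tendsto[OF v L(1,2) gm _ g0])
    show "AE z in lebesgue. norm (g n z) \<le> CF + k\<^sup>2 * Cq * Ch" for n
    proof (rule AE_U_I)
      fix z assume z: "z \<in> U"
      show "norm (g n z) \<le> CF + k\<^sup>2 * Cq * Ch"
      proof (cases "z \<in> L")
        case True
        have "norm (\<phi> n z) \<le> Ch" unfolding \<phi>_def by (rule conv_ker_bound[OF e(1) ih]) (use Ch in auto)
        moreover have "norm (conv (ker (e n)) F z) \<le> CF" by (rule conv_ker_bound[OF e(1) iF aeF])
        moreover have "norm (of_real (k\<^sup>2) * q z * \<phi> n z) = k\<^sup>2 * norm (q z) * norm (\<phi> n z)"
          by (simp add: norm_mult del: of_real_power)
        moreover have "k\<^sup>2 * norm (q z) * norm (\<phi> n z) \<le> k\<^sup>2 * Cq * Ch"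
          using Cq(2)[OF True z] calculation(1) Cq(1) Ch(1) by (intro mult_mono) auto
        ultimately show ?thesis unfolding g_def lap by (intro norm_triangle_le) linarith
      next
        case False
        then show ?thesis using g0 CF(1) Cq(1) Ch(1) by simp
      qed
    qed
    show "(\<lambda>z. F z + of_real (k\<^sup>2) * q z * h z) \<in> borel_measurable lebesgue"
      using regular_on_measurable[OF q] regular_on_measurable[OF F] measurable_lebesgue_continuous[OF C1c_continuous[OF h]]
      by (intro borel_measurable_add borel_measurable_times) auto
    show "F z + of_real (k\<^sup>2) * q z * h z = 0" if "z \<notin> L" for z
    proof -
      have "z \<notin> K" "z \<notin> supp h" using that L(3) by auto
      then show ?thesis using K(3)[of z] not_in_supp[of z h] by simp
    qed
    show "AE z in lebesgue. (\<lambda>n. g n z) \<longlonglongrightarrow> F z + of_real (k\<^sup>2) * q z * h z"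
    proof (rule AE_U_I)
      fix z assume z: "z \<in> U"
      have "isCont F z" using F z openU continuous_on_eq_continuous_at by (fastforce simp: regular_on_def)
      then have "(\<lambda>n. conv (ker (e n)) F z) \<longlonglongrightarrow> F z" by (rule conv_ker_tendsto[OF iF _ e(1,3)])
      moreover have "isCont h z" using C1c_continuous[OF h] by (simp add: continuous_on_eq_continuous_at)
      then have "(\<lambda>n. \<phi> n z) \<longlonglongrightarrow> h z" unfolding \<phi>_def by (rule conv_ker_tendsto[OF ih _ e(1,3)])
      ultimately show "(\<lambda>n. g n z) \<longlonglongrightarrow> F z + of_real (k\<^sup>2) * q z * h z"
        unfolding g_def lap by (intro tendsto_intros)
    qed
  qed
  moreover have "(\<lambda>n. \<integral>z. v z * g n z \<partial>lebesgue) \<longlonglongrightarrow> - h x"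
  proof -
    have "isCont h x" using C1c_continuous[OF h] by (simp add: continuous_on_eq_continuous_at)
    then show ?thesis unfolding eq \<phi>_def by (intro tendsto_minus conv_ker_tendsto[OF ih _ e(1,3)])
  qed
  ultimately show ?thesis by (rule LIMSEQ_unique)
qed

end

text \<open>Test the equation of \<open>w\<close> with \<open>v * \<psi>\<close> and that of
  \<open>v\<close> with \<open>w * \<psi>\<close>; the terms \<open>gdot v w * \<psi>\<close> cancel
  in the difference.\<close>

lemma green_second_weak:
  assumes W: "open W" and v: "C1_on W v" and w: "C1_on W w"
    and fv: "locally_integrable W f" "weak_lap W v f" and fw: "locally_integrable W g" "weak_lap W w g" and \<psi>: "C1c W \<psi>"
  shows "(\<integral>z. v z * gdot w \<psi> z - w z * gdot v \<psi> z \<partial>lebesgue) = (\<integral>z. f z * (w z * \<psi> z) \<partial>lebesgue) - (\<integral>z. g z * (v z * \<psi> z) \<partial>lebesgue)"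
proof -
  note vp = C1c_mult[OF W v \<psi>] and wp = C1c_mult[OF W w \<psi>]
  have 1: "gdot w (\<lambda>z. v z * \<psi> z) z = gdot v w z * \<psi> z + v z * gdot w \<psi> z" for z
    unfolding gdot_def C1c_mult_pd[OF W v \<psi>] by (simp add: sum_distrib_left sum_distrib_right sum.distrib[symmetric] algebra_simps)
  have 2: "gdot v (\<lambda>z. w z * \<psi> z) z = gdot v w z * \<psi> z + w z * gdot v \<psi> z" for z
    unfolding gdot_def C1c_mult_pd[OF W w \<psi>] by (simp add: sum_distrib_left sum_distrib_right sum.distrib[symmetric] algebra_simps)
  have "(\<integral>z. v z * gdot w \<psi> z - w z * gdot v \<psi> z \<partial>lebesgue) = (\<integral>z. gdot w (\<lambda>z. v z * \<psi> z) z - gdot v (\<lambda>z. w z * \<psi> z) z \<partial>lebesgue)"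
    unfolding 1 2 by simp
  also have "\<dots> = (\<integral>z. gdot w (\<lambda>z. v z * \<psi> z) z \<partial>lebesgue) - (\<integral>z. gdot v (\<lambda>z. w z * \<psi> z) z \<partial>lebesgue)"
    by (intro Bochner_Integration.integral_diff gdot_continuous_integrable(2)[OF W] v w vp wp)
  also have "\<dots> = (\<integral>z. f z * (w z * \<psi> z) \<partial>lebesgue) - (\<integral>z. g z * (v z * \<psi> z) \<partial>lebesgue)"
    using weak_lapD[OF fv(2) wp] weak_lapD[OF fw(2) vp] by simp
  finally show ?thesis .
qed

lemma supp_pd_cbump:
  assumes "r > 0"
  shows "supp (pd b (cbump x r)) \<subseteq> cball x (2 * r) - ball x r"
  by (rule supp_subset_closed) (use assms in \<open>auto intro!: closed_Diff simp: pd_cbump pd_bump_eq_0\<close>)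

text \<open>The Leibniz rule for the Laplacian of a product, in weak form. The term
  \<open>w * pd b c\<close> standing before \<open>pd b \<psi>\<close> is again C^1, so one
  integration by parts moves the derivative onto it; this consumes the second derivative of the
  cutoff and none of \<open>w\<close>.\<close>

lemma weak_lap_mult_cbump:
  assumes W: "open W" and w: "C1_on W w" and f: "locally_integrable W f" "weak_lap W w f"
    and r: "r > 0" "cball x (2 * r) \<subseteq> W"
  shows "weak_lap UNIV (\<lambda>z. w z * cbump x r z)
    (\<lambda>z. f z * cbump x r z + (2 * gdot w (cbump x r) z + w z * laplacian (cbump x r) z))"
  unfolding weak_lap_def
proof (intro allI impI)
  let ?c = "cbump x r"
  fix \<psi> :: "real^2 \<Rightarrow> complex" assume \<psi>: "C1c UNIV \<psi>"
  have cW: "C1c W ?c" by (rule cbump_C1c[OF r])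
  have pW: "C1c W (pd b ?c)" for b by (rule pd_cbump_C1c[OF r])
  have psiC: "C1_on V \<psi>" for V by (rule C1c_C_on[OF \<psi>])
  have pc: "C1c W (\<lambda>z. \<psi> z * ?c z)" by (rule C1c_mult[OF W psiC cW])
  have wp: "C1c W (\<lambda>z. w z * pd b ?c z)" for b by (rule C1c_mult[OF W w pW])
  have g1: "gdot (\<lambda>z. w z * ?c z) \<psi> z = (\<Sum>b\<in>Basis. (w z * pd b ?c z) * pd b \<psi> z) + ?c z * gdot w \<psi> z" for z
    unfolding gdot_def C1c_mult_pd[OF W w cW]
    by (simp add: sum_distrib_left sum.distrib[symmetric] algebra_simps)
  have g2: "?c z * gdot w \<psi> z = gdot w (\<lambda>z. \<psi> z * ?c z) z - gdot w ?c z * \<psi> z" for z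
    unfolding gdot_def C1c_mult_pd[OF W psiC cW]
    by (simp add: sum_distrib_left sum_distrib_right sum.distrib sum_subtractf[symmetric] algebra_simps)
  have i1: "integrable lebesgue (\<lambda>z. (w z * pd b ?c z) * pd b \<psi> z)" if b: "b \<in> Basis" for b
    using C1c_mult_continuous(2)[OF open_UNIV C1c_continuous[OF wp] C1c_pd_continuous[OF \<psi> b] C1c_compact[OF \<psi>]]
      pd_not_in_supp[of _ \<psi> b] by simp
  have i2: "integrable lebesgue (gdot w (\<lambda>z. \<psi> z * ?c z))" by (rule gdot_continuous_integrable(2)[OF W w pc])
  have i3: "integrable lebesgue (\<lambda>z. gdot w ?c z * \<psi> z)"
    using C1c_mult_continuous(2)[OF open_UNIV gdot_continuous_integrable(1)[OF W w cW] C1c_continuous[OF \<psi>] C1c_compact[OF \<psi>]]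
      not_in_supp[of _ \<psi>] by simp
  have lapc: "continuous_on UNIV (\<lambda>z. w z * pd b (pd b ?c) z)" if b: "b \<in> Basis" for b
    by (rule C1c_mult_continuous(1)[OF W C1_on_continuous[OF w] C1c_pd_continuous[OF pW b]
          C1c_compact[OF pW[of b]] C1c_supp[OF pW[of b]]]) (rule pd_not_in_supp)
  have i4: "integrable lebesgue (\<lambda>z. (w z * pd b (pd b ?c) z) * \<psi> z)" if b: "b \<in> Basis" for b
    using C1c_mult_continuous(2)[OF open_UNIV lapc[OF b] C1c_continuous[OF \<psi>] C1c_compact[OF \<psi>]]
      not_in_supp[of _ \<psi>] by simp
  have i5: "integrable lebesgue (\<lambda>z. (pd b w z * pd b ?c z) * \<psi> z)" if b: "b \<in> Basis" for b
    using C1c_mult_continuous(2)[OF open_UNIV gdot_continuous_integrable(4)[OF W w cW b] C1c_continuous[OF \<psi>] C1c_compact[OF \<psi>]]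
      not_in_supp[of _ \<psi>] by simp
  have parts: "(\<integral>z. (w z * pd b ?c z) * pd b \<psi> z \<partial>lebesgue) = - (\<integral>z. (pd b w z * pd b ?c z) * \<psi> z \<partial>lebesgue) - (\<integral>z. (w z * pd b (pd b ?c) z) * \<psi> z \<partial>lebesgue)"
    if b: "b \<in> Basis" for b
  proof -
    have "(\<integral>z. (w z * pd b ?c z) * pd b \<psi> z \<partial>lebesgue) = - (\<integral>z. pd b (\<lambda>z. w z * pd b ?c z) z * \<psi> z \<partial>lebesgue)"
      by (rule integral_parts[OF open_UNIV C1c_C_on[OF wp] \<psi> b])
    also have "\<dots> = - (\<integral>z. (pd b w z * pd b ?c z) * \<psi> z + (w z * pd b (pd b ?c) z) * \<psi> z \<partial>lebesgue)"
      unfolding C1c_mult_pd[OF W w pW] distrib_right ..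
    finally show ?thesis using i4[OF b] i5[OF b] by simp
  qed
  have S1: "(\<integral>z. gdot w ?c z * \<psi> z \<partial>lebesgue) = (\<Sum>b\<in>Basis. \<integral>z. (pd b w z * pd b ?c z) * \<psi> z \<partial>lebesgue)"
    unfolding gdot_def sum_distrib_right by (intro Bochner_Integration.integral_sum i5)
  have S2: "(\<integral>z. (w z * laplacian ?c z) * \<psi> z \<partial>lebesgue) = (\<Sum>b\<in>Basis. \<integral>z. (w z * pd b (pd b ?c) z) * \<psi> z \<partial>lebesgue)"
    unfolding laplacian_pd sum_distrib_right sum_distrib_left by (intro Bochner_Integration.integral_sum i4)
  have i6: "integrable lebesgue (\<lambda>z. (w z * laplacian ?c z) * \<psi> z)"
    unfolding laplacian_pd sum_distrib_right sum_distrib_left by (intro Bochner_Integration.integrable_sum i4)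
  have i7: "integrable lebesgue (\<lambda>z. f z * (\<psi> z * ?c z))" by (rule locally_integrable_mult_C1c[OF f(1) pc])
  have "(\<integral>z. gdot (\<lambda>z. w z * ?c z) \<psi> z \<partial>lebesgue) =
     (\<Sum>b\<in>Basis. \<integral>z. (w z * pd b ?c z) * pd b \<psi> z \<partial>lebesgue) + ((\<integral>z. gdot w (\<lambda>z. \<psi> z * ?c z) z \<partial>lebesgue) - (\<integral>z. gdot w ?c z * \<psi> z \<partial>lebesgue))"
    unfolding g1 g2 using i1 i2 i3 by (simp add: Bochner_Integration.integral_sum)
  also have "(\<Sum>b\<in>Basis. \<integral>z. (w z * pd b ?c z) * pd b \<psi> z \<partial>lebesgue) = - (\<integral>z. gdot w ?c z * \<psi> z \<partial>lebesgue) - (\<integral>z. (w z * laplacian ?c z) * \<psi> z \<partial>lebesgue)"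
    unfolding S1 S2 by (simp add: parts sum_subtractf sum_negf)
  also have "(\<integral>z. gdot w (\<lambda>z. \<psi> z * ?c z) z \<partial>lebesgue) = - (\<integral>z. f z * (\<psi> z * ?c z) \<partial>lebesgue)"
    by (rule weak_lapD[OF f(2) pc])
  finally have "(\<integral>z. gdot (\<lambda>z. w z * ?c z) \<psi> z \<partial>lebesgue) =
     - ((\<integral>z. f z * (\<psi> z * ?c z) \<partial>lebesgue) + (2 * (\<integral>z. gdot w ?c z * \<psi> z \<partial>lebesgue) + (\<integral>z. (w z * laplacian ?c z) * \<psi> z \<partial>lebesgue)))"
    by simp
  also have "\<dots> = - (\<integral>z. f z * (\<psi> z * ?c z) + (2 * (gdot w ?c z * \<psi> z) + (w z * laplacian ?c z) * \<psi> z) \<partial>lebesgue)"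
    using i3 i6 i7 by simp
  also have "\<dots> = - (\<integral>z. (f z * ?c z + (2 * gdot w ?c z + w z * laplacian ?c z)) * \<psi> z \<partial>lebesgue)"
    by (simp add: algebra_simps)
  finally show "(\<integral>z. gdot (\<lambda>z. w z * ?c z) \<psi> z \<partial>lebesgue) = - (\<integral>z. (f z * ?c z + (2 * gdot w ?c z + w z * laplacian ?c z)) * \<psi> z \<partial>lebesgue)" .
qed

context
  fixes U :: "(real^2) set"
  assumes openU: "open U" and nullU: "negligible (- U)"
begin

text \<open>The function \<open>w * cbump x r\<close> has a locally bounded Laplacian off the
  interfaces, so it may be inserted into the point source equation of \<open>v\<close>. It equals
  \<open>w\<close> at \<open>x\<close>, and the terms with derivatives of the cutoff combine to a
  flux.\<close>

lemma source_representation: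
  assumes q: "regular_on U UNIV q" and v: "C1_on (UNIV - {x}) v" and src: "distr_point_source k q (ball x \<rho>) x v"
    and W: "open W" and w: "C1_on W w" and f: "regular_on U W f" "weak_lap W w f"
    and r: "r > 0" "cball x (2 * r) \<subseteq> W" "2 * r < \<rho>"
  shows "(\<integral>z. v z * ((f z + of_real (k\<^sup>2) * q z * w z) * cbump x r z) \<partial>lebesgue)
    + (\<integral>z. v z * gdot w (cbump x r) z - w z * gdot v (cbump x r) z \<partial>lebesgue) = - w x"
proof -
  let ?c = "cbump x r" and ?K = "cball x (2 * r)" and ?A = "cball x (2 * r) - ball x r"
  have cW: "C1c W ?c" by (rule cbump_C1c[OF r(1,2)])
  have pW: "C1c W (pd b ?c)" for b by (rule pd_cbump_C1c[OF r(1,2)])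
  have K: "compact ?K" "?K \<subseteq> ball x \<rho>" using r by auto
  have A: "compact ?A" "?A \<subseteq> UNIV - {x}" "?A \<subseteq> W - {x}"
    using r by (auto intro: compact_diff)
  \<comment> \<open>Derivatives of the cutoff live on an annulus that avoids \<open>x\<close>, so
    only the undifferentiated cutoff meets the singularity of \<open>v\<close>.\<close>
  have sA: "supp (pd b ?c) \<subseteq> ?A" for b by (rule supp_pd_cbump[OF r(1)])
  have c0: "?c z = 0" if "z \<notin> ?K" for z using bump_eq_0[OF r(1), of x z] that by (simp add: cbump_def)
  have pd0: "pd b ?c z = 0" "pd b (pd b ?c) z = 0" if "z \<notin> ?A" for z b
  proof -
    have "z \<notin> supp (pd b ?c)" using sA[of b] that by blast
    then show "pd b ?c z = 0" "pd b (pd b ?c) z = 0" by (rule not_in_supp, rule pd_not_in_supp)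
  qed
  have gd0: "gdot w ?c z = 0" "gdot v ?c z = 0" "laplacian ?c z = 0" if "z \<notin> ?A" for z
    using pd0[OF that] by (simp_all add: gdot_def laplacian_pd)
  have fl: "locally_integrable W f" by (rule regular_on_locally_integrable[OF openU nullU f(1)])
  note weak = weak_lap_mult_cbump[OF W w fl f(2) r(1,2)]
  let ?h = "\<lambda>z. w z * ?c z"
  let ?F = "\<lambda>z. f z * ?c z + (2 * gdot w ?c z + w z * laplacian ?c z)"
  have h: "C1c (ball x \<rho>) ?h"
  proof (rule C1c_mono[OF C1c_mult[OF W w cW]])
    have "supp ?h \<subseteq> ?K" by (rule supp_subset_closed) (auto simp: c0)
    then show "supp ?h \<subseteq> ball x \<rho>" using K by blast
  qed
  have lapc: "continuous_on UNIV (laplacian ?c)"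
    unfolding laplacian_pd[abs_def] by (intro continuous_on_sum C1c_pd_continuous[OF pW])
  have gwc: "continuous_on UNIV (gdot w ?c)" by (rule gdot_continuous_integrable(1)[OF W w cW])
  have wlap: "continuous_on UNIV (\<lambda>z. w z * laplacian ?c z)"
    by (rule C1c_mult_continuous(1)[OF W C1_on_continuous[OF w] lapc A(1)]) (use A gd0 in auto)
  have regfc: "regular_on U UNIV (\<lambda>z. f z * ?c z)"
    by (rule regular_on_extend_zero[OF regular_on_mult[OF f(1) regular_on_continuous] openU W K(1) r(2)])
      (use C1c_continuous[OF cW] c0 in \<open>auto intro: continuous_on_subset\<close>)
  have F: "regular_on U UNIV ?F"
    by (intro regular_on_add regfc regular_on_continuous continuous_intros gwc wlap)
  have F0: "?F z = 0" if "z \<notin> ?K" for z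
    using that gd0[of z] c0[of z] by auto
  have main: "(\<integral>z. v z * (?F z + of_real (k\<^sup>2) * q z * ?h z) \<partial>lebesgue) = - w x"
    using distr_point_source_C1c[OF openU nullU q src h F K F0 weak] bump_eq_1[OF r(1), of x x] r(1)
    by (simp add: cbump_def)
  have vl: "locally_integrable (ball x \<rho>) v" using src by (simp add: distr_point_source_def)
  have i1: "integrable lebesgue (\<lambda>z. v z * ((f z + of_real (k\<^sup>2) * q z * w z) * ?c z))"
  proof (rule regular_on_mult_integrable[OF openU nullU vl _ K])
    have "regular_on U W (\<lambda>z. f z + of_real (k\<^sup>2) * q z * w z)"
      by (intro regular_on_add f(1) regular_on_mult regular_on_continuous[OF C1_on_continuous[OF w]] regular_on_mono[OF q] regular_on_continuous) auto
    then show "regular_on U UNIV (\<lambda>z. (f z + of_real (k\<^sup>2) * q z * w z) * ?c z)"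
      by (intro regular_on_extend_zero[OF regular_on_mult[OF _ regular_on_continuous] openU W K(1) r(2)])
        (use C1c_continuous[OF cW] c0 in \<open>auto intro: continuous_on_subset\<close>)
  qed (simp add: c0)
  have vx: "open (UNIV - {x})" "continuous_on (UNIV - {x}) v" using C1_on_continuous[OF v] by auto
  have i2: "integrable lebesgue (\<lambda>z. v z * gdot w ?c z)"
    by (rule C1c_mult_continuous(2)[OF vx gwc A(1,2)]) (simp add: gd0)
  have WX: "open (W - {x})" using W by auto
  have pWX: "C1c (W - {x}) (pd b ?c)" for b by (rule C1c_mono[OF pW]) (use sA A in blast)
  have vwC: "C1_on (W - {x}) (\<lambda>z. v z * w z)"
    by (intro C1_on_mult C1_on_subset[OF v] C1_on_subset[OF w]) auto
  have i3: "integrable lebesgue (\<lambda>z. (v z * w z) * pd b (pd b ?c) z)" if b: "b \<in> Basis" for b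
    by (rule C1c_mult_continuous(2)[OF WX C1_on_continuous[OF vwC] C1c_pd_continuous[OF pWX b] A(1,3)]) (simp add: pd0)
  have i4: "integrable lebesgue (\<lambda>z. v z * (w z * laplacian ?c z))"
    by (rule C1c_mult_continuous(2)[OF vx wlap A(1,2)]) (simp add: gd0)
  have i5: "integrable lebesgue (\<lambda>z. (w z * pd b v z) * pd b ?c z)" if b: "b \<in> Basis" for b
  proof (rule C1c_mult_continuous(2)[OF WX _ C1c_continuous[OF pW] A(1,3)])
    show "continuous_on (W - {x}) (\<lambda>z. w z * pd b v z)"
      using v b C1_on_continuous[OF w] unfolding C1_on_def
      by (intro continuous_on_mult) (auto intro: continuous_on_subset)
  qed (simp add: pd0)
  have i5': "integrable lebesgue (\<lambda>z. w z * gdot v ?c z)"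
  proof -
    have "integrable lebesgue (\<lambda>z. \<Sum>b\<in>Basis. (w z * pd b v z) * pd b ?c z)"
      by (intro Bochner_Integration.integrable_sum i5)
    then show ?thesis unfolding gdot_def sum_distrib_left mult.assoc .
  qed
  have i6: "integrable lebesgue (\<lambda>z. (v z * pd b w z) * pd b ?c z)" if b: "b \<in> Basis" for b
  proof (rule C1c_mult_continuous(2)[OF WX _ C1c_continuous[OF pW] A(1,3)])
    show "continuous_on (W - {x}) (\<lambda>z. v z * pd b w z)"
      using w b C1_on_continuous[OF v] unfolding C1_on_def
      by (intro continuous_on_mult) (auto intro: continuous_on_subset)
  qed (simp add: pd0)
  have parts: "(\<integral>z. (v z * w z) * pd b (pd b ?c) z \<partial>lebesgue) = - (\<integral>z. (w z * pd b v z) * pd b ?c z + (v z * pd b w z) * pd b ?c z \<partial>lebesgue)"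
    if b: "b \<in> Basis" for b
  proof -
    have "(\<integral>z. (v z * w z) * pd b (pd b ?c) z \<partial>lebesgue) = - (\<integral>z. pd b (\<lambda>z. v z * w z) z * pd b ?c z \<partial>lebesgue)"
      by (rule integral_parts[OF WX vwC pWX b])
    also have "(\<lambda>z. pd b (\<lambda>z. v z * w z) z * pd b ?c z) = (\<lambda>z. (w z * pd b v z) * pd b ?c z + (v z * pd b w z) * pd b ?c z)"
    proof
      fix z
      show "pd b (\<lambda>z. v z * w z) z * pd b ?c z = (w z * pd b v z) * pd b ?c z + (v z * pd b w z) * pd b ?c z"
      proof (cases "z \<in> ?A")
        case True
        then have "v differentiable (at z)" "w differentiable (at z)" using v w A by (auto simp: C1_on_def)
        then show ?thesis by (simp add: pd_mult algebra_simps)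
      qed (simp add: pd0)
    qed
    finally show ?thesis .
  qed
  \<comment> \<open>On the annulus \<open>v * w\<close> is C^1, so one derivative comes off the
    second-order term. Added to twice \<open>v * gdot w\<close>, the result leaves exactly the
    antisymmetric flux.\<close>
  have lap: "(\<integral>z. v z * (w z * laplacian ?c z) \<partial>lebesgue) = - (\<integral>z. w z * gdot v ?c z \<partial>lebesgue) - (\<integral>z. v z * gdot w ?c z \<partial>lebesgue)"
  proof -
    have "(\<integral>z. v z * (w z * laplacian ?c z) \<partial>lebesgue) = (\<Sum>b\<in>Basis. \<integral>z. (v z * w z) * pd b (pd b ?c) z \<partial>lebesgue)"
      unfolding laplacian_pd sum_distrib_left mult.assoc[symmetric] by (intro Bochner_Integration.integral_sum i3)
    also have "\<dots> = - ((\<Sum>b\<in>Basis. \<integral>z. (w z * pd b v z) * pd b ?c z \<partial>lebesgue) + (\<Sum>b\<in>Basis. \<integral>z. (v z * pd b w z) * pd b ?c z \<partial>lebesgue))"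
      using i5 i6 by (simp add: parts sum_subtractf sum_negf)
    also have "(\<Sum>b\<in>Basis. \<integral>z. (w z * pd b v z) * pd b ?c z \<partial>lebesgue) = (\<integral>z. w z * gdot v ?c z \<partial>lebesgue)"
      unfolding gdot_def sum_distrib_left mult.assoc[symmetric] by (intro Bochner_Integration.integral_sum[symmetric] i5)
    also have "(\<Sum>b\<in>Basis. \<integral>z. (v z * pd b w z) * pd b ?c z \<partial>lebesgue) = (\<integral>z. v z * gdot w ?c z \<partial>lebesgue)"
      unfolding gdot_def sum_distrib_left mult.assoc[symmetric] by (intro Bochner_Integration.integral_sum[symmetric] i6)
    finally show ?thesis by simp
  qed
  have "(\<integral>z. v z * (?F z + of_real (k\<^sup>2) * q z * ?h z) \<partial>lebesgue) =
     (\<integral>z. v z * ((f z + of_real (k\<^sup>2) * q z * w z) * ?c z) + (2 * (v z * gdot w ?c z) + v z * (w z * laplacian ?c z)) \<partial>lebesgue)"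
    by (intro Bochner_Integration.integral_cong refl) (simp add: algebra_simps)
  also have "\<dots> = (\<integral>z. v z * ((f z + of_real (k\<^sup>2) * q z * w z) * ?c z) \<partial>lebesgue) + (2 * (\<integral>z. v z * gdot w ?c z \<partial>lebesgue) + (\<integral>z. v z * (w z * laplacian ?c z) \<partial>lebesgue))"
    using i1 i2 i4 by simp
  also have "\<dots> = (\<integral>z. v z * ((f z + of_real (k\<^sup>2) * q z * w z) * ?c z) \<partial>lebesgue) + ((\<integral>z. v z * gdot w ?c z \<partial>lebesgue) - (\<integral>z. w z * gdot v ?c z \<partial>lebesgue))"
    unfolding lap by simp
  also have "(\<integral>z. v z * gdot w ?c z \<partial>lebesgue) - (\<integral>z. w z * gdot v ?c z \<partial>lebesgue) = (\<integral>z. v z * gdot w ?c z - w z * gdot v ?c z \<partial>lebesgue)"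
    using i2 i5' by simp
  finally show ?thesis using main by simp
qed

end

section \<open>The radiation condition\<close>

text \<open>In place of integrals over circles, the radiation condition is used on annuli, with the
  weight \<open>\<mu> R z = - \<partial>\<^sub>r (bump 0 R) z\<close>.\<close>

definition annulus_weight :: "real \<Rightarrow> real^2 \<Rightarrow> real" where
  "annulus_weight R z = - (2 / R\<^sup>2 * cut' (z \<bullet> z / R\<^sup>2 - 1))"

definition radial_weight :: "real \<Rightarrow> real^2 \<Rightarrow> real" where
  "radial_weight R z = annulus_weight R z * norm z"

definition radial_deriv :: "(real^2 \<Rightarrow> complex) \<Rightarrow> real^2 \<Rightarrow> complex" where
  "radial_deriv v z = pd (sgn z) v z"

lemma annulus_weight_nonneg: "0 \<le> annulus_weight R z" 
  unfolding annulus_weight_def using cut'_nonpos[of "z \<bullet> z / R\<^sup>2 - 1"]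
  by (simp add: divide_nonpos_nonneg mult_nonneg_nonpos)

lemma annulus_weight_le: "R > 0 \<Longrightarrow> annulus_weight R z \<le> 18 / R\<^sup>2"
  unfolding annulus_weight_def using cut'_ge[of "z \<bullet> z / R\<^sup>2 - 1"] by (simp add: field_simps)

lemma annulus_weight_eq_0: "R > 0 \<Longrightarrow> norm z \<le> R \<or> 2 * R \<le> norm z \<Longrightarrow> annulus_weight R z = 0"
  unfolding annulus_weight_def using cut'_eq_0 bump_arg_le[of R 0 z] bump_arg_ge[of R 0 z] by auto

lemma annulus_weight_continuous: "continuous_on UNIV (annulus_weight R)"
proof -
  have c: "continuous_on UNIV cut'" by (simp add: continuous_at_imp_continuous_on isCont_cut')
  have "continuous_on UNIV (\<lambda>z::real^2. cut' (z \<bullet> z / R\<^sup>2 - 1))"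
    unfolding divide_inverse by (rule continuous_on_compose2[OF c]) (auto intro!: continuous_intros)
  then show ?thesis unfolding annulus_weight_def[abs_def] by (intro continuous_intros)
qed

lemma radial_weight_nonneg: "0 \<le> radial_weight R z"
  unfolding radial_weight_def using annulus_weight_nonneg by simp

lemma radial_weight_continuous: "continuous_on UNIV (radial_weight R)"
  unfolding radial_weight_def[abs_def] by (intro continuous_intros annulus_weight_continuous)

lemma radial_weight_eq_0: "R > 0 \<Longrightarrow> norm z \<le> R \<or> 2 * R \<le> norm z \<Longrightarrow> radial_weight R z = 0"
  unfolding radial_weight_def by (simp add: annulus_weight_eq_0)

text \<open>Height of order \<open>1 / R\<^sup>2\<close> on an area of order
  \<open>R\<^sup>2\<close>. This weight is \<open>radial_weight\<close> divided by the radius, so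
  the bound absorbs the \<open>1 / norm z\<close> that the squared radiation condition produces. The
  constant is 18 times the factor 4 from the radius \<open>2 * R\<close>; the added 1 makes it
  positive.\<close>

lemma integral_annulus_weight:
  obtains C where "C > 0" "\<And>R. R > 0 \<Longrightarrow> integrable lebesgue (annulus_weight R)"
    "\<And>R. R > 0 \<Longrightarrow> (\<integral>z. annulus_weight R z \<partial>lebesgue) \<le> C"
proof -
  define C where "C = 72 * unit_ball_vol (real DIM(real^2)) + 1"
  have i: "integrable lebesgue (annulus_weight R)" if "R > 0" for R
    by (rule integrable_continuous_compact(1)[OF annulus_weight_continuous compact_cball[of 0 "2 * R"]])
      (use annulus_weight_eq_0[OF that] in auto)
  have "(\<integral>z. annulus_weight R z \<partial>lebesgue) \<le> C" if R: "R > 0" for R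
  proof -
    have "(\<integral>z. annulus_weight R z \<partial>lebesgue) \<le> (\<integral>z. 18 / R\<^sup>2 * indicator (cball 0 (2 * R)) (z :: real^2) \<partial>lebesgue)"
    proof (rule integral_mono[OF i[OF R] integrable_indicator_compact])
      show "annulus_weight R z \<le> 18 / R\<^sup>2 * indicator (cball 0 (2 * R)) z" for z
        using annulus_weight_le[OF R, of z] annulus_weight_eq_0[OF R, of z] by (auto simp: indicator_def)
    qed simp
    also have "\<dots> = 18 / R\<^sup>2 * measure lebesgue (cball (0 :: real^2) (2 * R))" by simp
    also have "measure lebesgue (cball (0 :: real^2) (2 * R)) = unit_ball_vol (real DIM(real^2)) * (2 * R) ^ DIM(real^2)"
      using content_cball[of "2 * R" "0 :: real^2"] R by (simp add: measure_completion)
    also have "18 / R\<^sup>2 * (unit_ball_vol (real DIM(real^2)) * (2 * R) ^ DIM(real^2)) = 72 * unit_ball_vol (real DIM(real^2))"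
      using R by (simp add: field_simps power2_eq_square)
    finally show ?thesis by (simp add: C_def)
  qed
  moreover have "C > 0" unfolding C_def by (auto intro!: add_nonneg_pos)
  ultimately show ?thesis using that i by blast
qed

lemma integrable_extend_zero:
  fixes g :: "'a::euclidean_space \<Rightarrow> 'b::{banach,second_countable_topology}"
  assumes "open W" "compact K" "K \<subseteq> W" "continuous_on W g" "\<And>x. x \<notin> K \<Longrightarrow> g x = 0"
  shows "integrable lebesgue g"
  using integrable_continuous_compact(1)[OF continuous_on_extend_zero[OF assms(1) compact_imp_closed[OF assms(2)] assms(3-5)] assms(2,5)] .

lemma gdot_cbump:
  assumes v: "v differentiable (at z)"
  shows "gdot v (cbump 0 R) z = - (of_real (radial_weight R z) * radial_deriv v z)"
proof -
  let ?c = "2 / R\<^sup>2 * cut' (z \<bullet> z / R\<^sup>2 - 1)"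
  have "gdot v (cbump 0 R) z = (\<Sum>b\<in>Basis. of_real ?c * ((z \<bullet> b) *\<^sub>R pd b v z))"
    unfolding gdot_def pd_cbump pd_bump by (simp add: scaleR_conv_of_real mult_ac)
  also have "\<dots> = of_real ?c * pd z v z"
    by (simp only: sum_distrib_left[symmetric] pd_sum_Basis[OF v, of z])
  also have "pd z v z = norm z *\<^sub>R pd (sgn z) v z"
  proof -
    have "z = norm z *\<^sub>R sgn z" by (cases "z = 0") (simp_all add: sgn_div_norm)
    then show ?thesis using linear_scale[OF linear_pd[OF v], of "norm z" "sgn z"] by simp
  qed
  finally show ?thesis
    unfolding radial_weight_def annulus_weight_def radial_deriv_def by (simp add: scaleR_conv_of_real mult_ac)
qed

text \<open>Inside radius \<open>R\<^sub>0\<close>, where \<open>v\<close> may fail to be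
  differentiable, the cutoff is constant and both sides vanish.\<close>

lemma gdot_cbump':
  assumes v: "C1_on (UNIV - cball 0 R\<^sub>0) v" and R: "R\<^sub>0 \<ge> 0" "R > R\<^sub>0"
  shows "gdot v (cbump 0 R) z = - (of_real (radial_weight R z) * radial_deriv v z)"
proof (cases "norm z \<le> R\<^sub>0")
  case True
  then have "radial_weight R z = 0" "pd b (cbump 0 R) z = 0" for b
    using R radial_weight_eq_0[of R z] pd_bump_eq_0[of R 0 z] by (auto simp: pd_cbump)
  then show ?thesis by (simp add: gdot_def)
next
  case False
  then show ?thesis using v by (intro gdot_cbump) (auto simp: C1_on_def)
qed

lemma radiating_bound:
  assumes v: "radiating \<kappa> v" and e: "\<epsilon> > 0"
  obtains R where "R > 0" "\<And>z. norm z \<ge> R \<Longrightarrow> norm (radial_deriv v z - \<i> * \<kappa> * v z) \<le> \<epsilon> / sqrt (norm z)"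
proof -
  have "\<forall>\<^sub>F r in at_top. \<forall>d\<in>sphere 0 1. dist (of_real (sqrt r) *
      (frechet_derivative v (at (r *\<^sub>R d)) d - \<i> * \<kappa> * v (r *\<^sub>R d))) 0 < \<epsilon>"
    using v e unfolding radiating_def uniform_limit_iff by blast
  then obtain R where R: "\<And>r d. r \<ge> R \<Longrightarrow> d \<in> sphere 0 1 \<Longrightarrow> norm (of_real (sqrt r) *
      (frechet_derivative v (at (r *\<^sub>R d)) d - \<i> * \<kappa> * v (r *\<^sub>R d))) < \<epsilon>"
    unfolding eventually_at_top_linorder dist_norm diff_zero by blast
  have "norm (radial_deriv v z - \<i> * \<kappa> * v z) \<le> \<epsilon> / sqrt (norm z)" if z: "norm z \<ge> max R 1" for z
  proof -
    have n: "norm z > 0" using z by linarith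
    have "sgn z \<in> sphere 0 1" using n by (simp add: norm_sgn)
    moreover have "norm z *\<^sub>R sgn z = z" using n by (simp add: sgn_div_norm)
    ultimately have "norm (of_real (sqrt (norm z)) * (radial_deriv v z - \<i> * \<kappa> * v z)) < \<epsilon>"
      using R[of "norm z" "sgn z"] z by (simp add: radial_deriv_def pd_def)
    then have "sqrt (norm z) * norm (radial_deriv v z - \<i> * \<kappa> * v z) < \<epsilon>" by (simp add: norm_mult)
    then show ?thesis using n by (simp add: field_simps)
  qed
  then show ?thesis using that[of "max R 1"] by auto
qed

text \<open>Test the Helmholtz equation with \<open>cnj v\<close> times a cutoff and expand
  $|\partial_r v - i\kappa v|^2$; the volume terms have the right sign as \<open>Im \<kappa> \<ge> 0\<close>.\<close>

lemma radiating_annulus_bound: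
  assumes v: "C1_on (UNIV - cball 0 R\<^sub>0) v" and R0: "R\<^sub>0 \<ge> 0"
    and weak: "weak_lap (UNIV - cball 0 R\<^sub>0) v (\<lambda>z. - (\<kappa>\<^sup>2) * v z)"
    and rad: "radiating \<kappa> v" and \<kappa>: "Im \<kappa> \<ge> 0" "\<kappa> \<noteq> 0"
  obtains C R\<^sub>1 where "C \<ge> 0" "R\<^sub>1 > R\<^sub>0"
    "\<And>R. R \<ge> R\<^sub>1 \<Longrightarrow> (\<integral>z. radial_weight R z * (norm (v z))\<^sup>2 \<partial>lebesgue) \<le> C"
proof -
  let ?X = "UNIV - cball (0 :: real^2) R\<^sub>0"
  have X: "open ?X" by auto
  obtain C0 where C0: "C0 > 0" "\<And>R. R > 0 \<Longrightarrow> integrable lebesgue (annulus_weight R)"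
    "\<And>R. R > 0 \<Longrightarrow> (\<integral>z. annulus_weight R z \<partial>lebesgue) \<le> C0" using integral_annulus_weight by blast
  obtain R' where R': "R' > 0" "\<And>z. norm z \<ge> R' \<Longrightarrow> norm (radial_deriv v z - \<i> * \<kappa> * v z) \<le> 1 / sqrt (norm z)"
    using radiating_bound[OF rad zero_less_one] by blast
  define R1 where "R1 = max R' (R\<^sub>0 + 1)"
  have R1: "R1 > R\<^sub>0" "R1 \<ge> R'" "R1 > 0" using R0 by (auto simp: R1_def)
  have vc: "continuous_on ?X v" by (rule C1_on_continuous[OF v])
  have pc: "continuous_on ?X (pd b v)" if "b \<in> Basis" for b using v that by (simp add: C1_on_def)
  have rc: "continuous_on ?X (radial_deriv v)"
  proof (rule continuous_on_eq)
    show "continuous_on ?X (\<lambda>z. \<Sum>b\<in>Basis. (sgn z \<bullet> b) *\<^sub>R pd b v z)"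
      using R0 by (intro continuous_on_sum continuous_on_scaleR continuous_intros pc) auto
    show "(\<Sum>b\<in>Basis. (sgn z \<bullet> b) *\<^sub>R pd b v z) = radial_deriv v z" if "z \<in> ?X" for z
      unfolding radial_deriv_def using v that by (intro pd_sum_Basis[symmetric]) (auto simp: C1_on_def)
  qed
  define S where "S z = (\<Sum>b\<in>Basis. (norm (pd b v z))\<^sup>2)" for z
  have Sc: "continuous_on ?X S" unfolding S_def by (intro continuous_intros pc)
  have cC: "C1_on ?X (\<lambda>z. cnj (v z))" and cpd: "z \<in> ?X \<Longrightarrow> pd b (\<lambda>z. cnj (v z)) z = cnj (pd b v z)" for z b
  proof -
    have D: "((\<lambda>z. cnj (v z)) has_derivative (\<lambda>h. cnj (pd h v z))) (at z)" if "z \<in> ?X" for z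
      using v that by (intro has_derivative_cnj has_derivative_pd) (auto simp: C1_on_def)
    have P: "pd b (\<lambda>z. cnj (v z)) z = cnj (pd b v z)" if "z \<in> ?X" for z b by (rule pd_eqI[OF D[OF that]])
    show "z \<in> ?X \<Longrightarrow> pd b (\<lambda>z. cnj (v z)) z = cnj (pd b v z)" by (rule P)
    have "continuous_on ?X (pd b (\<lambda>z. cnj (v z)))" if "b \<in> Basis" for b
      by (rule continuous_on_eq[where f="\<lambda>z. cnj (pd b v z)"]) (use P pc[OF that] in \<open>auto intro!: continuous_intros\<close>)
    then show "C1_on ?X (\<lambda>z. cnj (v z))" using D unfolding C1_on_def differentiable_def by blast
  qed
  \<comment> \<open>The boundary term of Green's first identity for \<open>v\<close> and its
    conjugate, spread over an annulus.\<close>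
  let ?T = "\<lambda>R z. of_real (radial_weight R z) * (cnj (v z) * radial_deriv v z)"
  have K: "compact {z :: real^2. a \<le> norm z \<and> norm z \<le> b}" for a b
  proof -
    have "{z :: real^2. a \<le> norm z \<and> norm z \<le> b} = cball 0 b - ball 0 a" by auto
    then show ?thesis by (simp add: compact_diff)
  qed
  have iw: "integrable lebesgue (\<lambda>z. radial_weight R z *\<^sub>R g z)"
    if "R \<ge> R1" "continuous_on ?X g" for R and g :: "real^2 \<Rightarrow> 'b::{banach,second_countable_topology}"
  proof (rule integrable_extend_zero[OF X K[of R "2 * R"]])
    show "{z :: real^2. R \<le> norm z \<and> norm z \<le> 2 * R} \<subseteq> ?X" using that R1 by auto
    show "continuous_on ?X (\<lambda>z. radial_weight R z *\<^sub>R g z)"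
      by (intro continuous_on_scaleR that(2) continuous_on_subset[OF radial_weight_continuous]) auto
    show "radial_weight R z *\<^sub>R g z = 0" if "z \<notin> {z. R \<le> norm z \<and> norm z \<le> 2 * R}" for z
      using radial_weight_eq_0[of R z] that \<open>R \<ge> R1\<close> R1 by auto
  qed
  have iT: "integrable lebesgue (?T R)" if "R \<ge> R1" for R
    using iw[OF that, of "\<lambda>z. cnj (v z) * radial_deriv v z"] vc rc
    by (simp add: scaleR_conv_of_real continuous_on_mult continuous_on_cnj)
  define C1 where "C1 = (\<integral>z. ?T R1 z \<partial>lebesgue)"
  \<comment> \<open>The factor \<open>cnj \<kappa>\<close> aligns the signs: the gradient term
    acquires the factor \<open>cnj \<kappa>\<close> and the zero-order term
    \<open>- (norm \<kappa>)\<^sup>2 * \<kappa>\<close>, so both have nonpositive imaginary part and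
    only the fixed inner boundary term \<open>C1\<close> remains.\<close>
  have Im_le: "Im (cnj \<kappa> * (\<integral>z. ?T R z \<partial>lebesgue)) \<le> norm \<kappa> * norm C1" if R: "R \<ge> 2 * R1" for R
  proof -
    \<comment> \<open>A nonnegative cutoff for the region between radii \<open>R1\<close> and
      \<open>2 * R\<close>: because \<open>R \<ge> 2 * R1\<close>, the inner bump is 0 before the
      outer one starts to fall.\<close>
    define \<eta> where "\<eta> z = cbump 0 R z - cbump 0 R1 z" for z :: "real^2"
    have R0': "R > 0" "R \<ge> R1" "R > R\<^sub>0" using R R1 by auto
    let ?K = "{z :: real^2. R1 \<le> norm z \<and> norm z \<le> 2 * R}"
    have KX: "?K \<subseteq> ?X" using R1 by auto
    have \<eta>0: "\<eta> z = 0" if "z \<notin> ?K" for z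
      using that bump_eq_1[of R 0 z] bump_eq_1[of R1 0 z] bump_eq_0[of R 0 z] bump_eq_0[of R1 0 z] R R1
      by (auto simp: \<eta>_def cbump_def)
    have cb: "C1_on V (cbump 0 r)" for V r unfolding cbump_def[abs_def]
      by (rule C1_on_subset[OF C1_on_of_real[OF bump_C1]]) simp
    have \<eta>C: "C1c ?X \<eta>" unfolding \<eta>_def
      by (rule C1cI[OF C1_on_diff[OF cb cb] K KX]) (use \<eta>0 in \<open>simp add: \<eta>_def\<close>)
    have \<eta>r: "\<eta> z = of_real (bump 0 R z - bump 0 R1 z)" "bump 0 R z - bump 0 R1 z \<ge> 0" for z
    proof -
      show "\<eta> z = of_real (bump 0 R z - bump 0 R1 z)" by (simp add: \<eta>_def cbump_def)
      show "bump 0 R z - bump 0 R1 z \<ge> 0"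
      proof (cases "norm z \<le> R")
        case True
        then show ?thesis using bump_eq_1[of R 0 z] bump_le_1[of 0 R1 z] R0' by simp
      next
        case False
        then show ?thesis using bump_eq_0[of R1 0 z] bump_nonneg[of 0 R z] R R1 by simp
      qed
    qed
    define e where "e z = bump 0 R z - bump 0 R1 z" for z :: "real^2"
    have e: "\<eta> z = of_real (e z)" "e z \<ge> 0" for z using \<eta>r unfolding e_def by auto
    have ec: "continuous_on UNIV e" unfolding e_def
      by (intro continuous_intros C1_on_continuous[OF bump_C1])
    have e0: "e z = 0" if "z \<notin> ?K" for z using \<eta>0[OF that] e(1)[of z] by simp
    have gd: "gdot v \<eta> z = - (of_real (radial_weight R z) * radial_deriv v z) + of_real (radial_weight R1 z) * radial_deriv v z" for z
    proof -
      have "gdot v \<eta> z = gdot v (cbump 0 R) z - gdot v (cbump 0 R1) z"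
      proof -
        have "pd b \<eta> z = pd b (cbump 0 R) z - pd b (cbump 0 R1) z" for b
          unfolding \<eta>_def[abs_def] by (rule pd_diff) (use cb[of UNIV] in \<open>auto simp: C1_on_def\<close>)
        then show ?thesis unfolding gdot_def by (simp add: sum_subtractf right_diff_distrib)
      qed
      then show ?thesis using gdot_cbump'[OF v R0] R0' R1 by simp
    qed
    have ie: "integrable lebesgue (\<lambda>z. e z * g z)" if "continuous_on ?X g" for g :: "real^2 \<Rightarrow> real"
      by (rule integrable_extend_zero[OF X K KX])
        (use that e0 in \<open>auto intro!: continuous_on_mult continuous_on_subset[OF ec]\<close>)
    have eq1: "gdot v (\<lambda>z. cnj (v z) * \<eta> z) z = of_real (e z * S z) + (- ?T R z + ?T R1 z)" for z
    proof (cases "z \<in> ?X")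
      case True
      have "gdot v (\<lambda>z. cnj (v z) * \<eta> z) z = (\<Sum>b\<in>Basis. pd b v z * cnj (pd b v z)) * \<eta> z + cnj (v z) * gdot v \<eta> z"
        unfolding gdot_def C1c_mult_pd[OF X cC \<eta>C] cpd[OF True]
        by (simp add: sum_distrib_left sum_distrib_right sum.distrib[symmetric] algebra_simps)
      also have "(\<Sum>b\<in>Basis. pd b v z * cnj (pd b v z)) = of_real (S z)"
        by (simp only: S_def of_real_sum complex_norm_square)
      finally show ?thesis unfolding gd e(1)[of z] by (simp add: algebra_simps)
    next
      case False
      then have "z \<notin> supp \<eta>" using C1c_supp[OF \<eta>C] by blast
      moreover have "e z = 0" "radial_weight R z = 0" "radial_weight R1 z = 0"
        using False e0[of z] radial_weight_eq_0[of R z] radial_weight_eq_0[of R1 z] R0' R1 by auto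
      ultimately show ?thesis
        unfolding gdot_def C1c_mult_pd[OF X cC \<eta>C] by (simp add: not_in_supp pd_not_in_supp)
    qed
    have iS: "integrable lebesgue (\<lambda>z. e z * S z)" by (rule ie[OF Sc])
    have iv: "integrable lebesgue (\<lambda>z. e z * (norm (v z))\<^sup>2)" by (rule ie) (intro continuous_intros vc)
    define IS where "IS = (\<integral>z. e z * S z \<partial>lebesgue)"
    define Iv where "Iv = (\<integral>z. e z * (norm (v z))\<^sup>2 \<partial>lebesgue)"
    have pos: "IS \<ge> 0" "Iv \<ge> 0"
      unfolding IS_def Iv_def S_def by (auto intro!: integral_nonneg_AE AE_I2 mult_nonneg_nonneg e sum_nonneg)
    have "(\<integral>z. gdot v (\<lambda>z. cnj (v z) * \<eta> z) z \<partial>lebesgue) = of_real IS + (- (\<integral>z. ?T R z \<partial>lebesgue) + C1)"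
      unfolding eq1 C1_def IS_def using iS iT[OF R0'(2)] iT[OF order_refl]
      by (simp del: of_real_mult)
    moreover have "(\<integral>z. gdot v (\<lambda>z. cnj (v z) * \<eta> z) z \<partial>lebesgue) = - (\<integral>z. - (\<kappa>\<^sup>2) * v z * (cnj (v z) * \<eta> z) \<partial>lebesgue)"
      by (rule weak_lapD[OF weak C1c_mult[OF X cC \<eta>C]])
    moreover have "(\<integral>z. - (\<kappa>\<^sup>2) * v z * (cnj (v z) * \<eta> z) \<partial>lebesgue) = - (\<kappa>\<^sup>2) * of_real Iv"
    proof -
      have "- (\<kappa>\<^sup>2) * v z * (cnj (v z) * \<eta> z) = - (\<kappa>\<^sup>2) * of_real (e z * (norm (v z))\<^sup>2)" for z
        unfolding e(1) of_real_mult complex_norm_square by (simp only: mult_ac minus_mult_left[symmetric])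
      then have "(\<integral>z. - (\<kappa>\<^sup>2) * v z * (cnj (v z) * \<eta> z) \<partial>lebesgue) = (\<integral>z. - (\<kappa>\<^sup>2) * of_real (e z * (norm (v z))\<^sup>2) \<partial>lebesgue)"
        by (simp only:)
      then show ?thesis unfolding Iv_def by (simp only: integral_mult_right_zero integral_complex_of_real)
    qed
    ultimately have T: "(\<integral>z. ?T R z \<partial>lebesgue) = of_real IS + C1 - \<kappa>\<^sup>2 * of_real Iv" by (simp add: algebra_simps)
    have "cnj \<kappa> * (\<integral>z. ?T R z \<partial>lebesgue) = cnj \<kappa> * of_real IS + cnj \<kappa> * C1 - (cnj \<kappa> * \<kappa>) * \<kappa> * of_real Iv"
      unfolding T by (simp add: algebra_simps power2_eq_square)
    also have "cnj \<kappa> * \<kappa> = of_real ((norm \<kappa>)\<^sup>2)" by (simp only: complex_norm_square mult.commute)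
    finally have "Im (cnj \<kappa> * (\<integral>z. ?T R z \<partial>lebesgue)) = - Im \<kappa> * IS + Im (cnj \<kappa> * C1) - (norm \<kappa>)\<^sup>2 * Im \<kappa> * Iv"
      by simp
    also have "\<dots> \<le> Im (cnj \<kappa> * C1)"
    proof -
      have "0 \<le> Im \<kappa> * IS" "0 \<le> (norm \<kappa>)\<^sup>2 * Im \<kappa> * Iv"
        using \<kappa>(1) pos by (auto intro!: mult_nonneg_nonneg)
      then show ?thesis by linarith
    qed
    also have "\<dots> \<le> norm (cnj \<kappa> * C1)" using abs_Im_le_cmod[of "cnj \<kappa> * C1"] by linarith
    finally show ?thesis by (simp add: norm_mult)
  qed
  \<comment> \<open>\<open>C0\<close> bounds the weighted square of the radiation defect, and the
    second summand comes from \<open>Im_le\<close>.\<close>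
  define C where "C = (C0 + 2 * (norm \<kappa> * norm C1)) / (norm \<kappa>)\<^sup>2"
  have "(\<integral>z. radial_weight R z * (norm (v z))\<^sup>2 \<partial>lebesgue) \<le> C" if R: "R \<ge> 2 * R1" for R
  proof -
    have R0': "R > 0" "R \<ge> R1" using R R1 by auto
    \<comment> \<open>The square of the radial derivative is dropped from the expansion. The weight
      turns the bound \<open>1 / norm z\<close> of the defect into
      \<open>annulus_weight\<close>.\<close>
    have pt: "radial_weight R z * ((norm \<kappa>)\<^sup>2 * (norm (v z))\<^sup>2) \<le> annulus_weight R z + 2 * Im (cnj \<kappa> * ?T R z)" for z
    proof (cases "norm z \<le> R")
      case True
      then show ?thesis using radial_weight_eq_0[OF R0'(1), of z] annulus_weight_eq_0[OF R0'(1), of z] by simp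
    next
      case False
      let ?d = "radial_deriv v z"
      have "norm (?d - \<i> * \<kappa> * v z) \<le> 1 / sqrt (norm z)" using R'(2)[of z] False R R1 by simp
      then have "(norm (?d - \<i> * \<kappa> * v z))\<^sup>2 \<le> (1 / sqrt (norm z))\<^sup>2" by (intro power_mono) auto
      then have "(norm (?d - \<i> * \<kappa> * v z))\<^sup>2 \<le> 1 / norm z" by (simp add: power_divide)
      moreover have "(norm (?d - \<i> * \<kappa> * v z))\<^sup>2 = (norm ?d)\<^sup>2 + (norm \<kappa>)\<^sup>2 * (norm (v z))\<^sup>2 - 2 * Im (cnj \<kappa> * (cnj (v z) * ?d))"
        unfolding cmod_power2 by (simp add: algebra_simps power2_eq_square)
      ultimately have "(norm \<kappa>)\<^sup>2 * (norm (v z))\<^sup>2 \<le> 1 / norm z + 2 * Im (cnj \<kappa> * (cnj (v z) * ?d))"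
        using zero_le_power2[of "norm ?d"] by linarith
      then have "radial_weight R z * ((norm \<kappa>)\<^sup>2 * (norm (v z))\<^sup>2) \<le> radial_weight R z * (1 / norm z + 2 * Im (cnj \<kappa> * (cnj (v z) * ?d)))"
        by (intro mult_left_mono radial_weight_nonneg)
      also have "\<dots> = annulus_weight R z + 2 * (radial_weight R z * Im (cnj \<kappa> * (cnj (v z) * ?d)))"
        using False R0' by (cases "z = 0") (simp_all add: radial_weight_def distrib_left)
      also have "radial_weight R z * Im (cnj \<kappa> * (cnj (v z) * ?d)) = Im (cnj \<kappa> * ?T R z)"
        by (simp add: algebra_simps)
      finally show ?thesis .
    qed
    have iIm: "integrable lebesgue (\<lambda>z. Im (cnj \<kappa> * ?T R z))"
      by (intro integrable_Im integrable_mult_right iT[OF R0'(2)])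
    have "(norm \<kappa>)\<^sup>2 * (\<integral>z. radial_weight R z * (norm (v z))\<^sup>2 \<partial>lebesgue) = (\<integral>z. radial_weight R z * ((norm \<kappa>)\<^sup>2 * (norm (v z))\<^sup>2) \<partial>lebesgue)"
      by (subst integral_mult_right_zero[symmetric]) (simp add: mult_ac)
    also have "\<dots> \<le> (\<integral>z. annulus_weight R z + 2 * Im (cnj \<kappa> * ?T R z) \<partial>lebesgue)"
    proof (rule integral_mono[OF _ _ pt])
      have "continuous_on ?X (\<lambda>z. (norm \<kappa>)\<^sup>2 * (norm (v z))\<^sup>2)" by (intro continuous_intros vc)
      from iw[OF R0'(2) this] show "integrable lebesgue (\<lambda>z. radial_weight R z * ((norm \<kappa>)\<^sup>2 * (norm (v z))\<^sup>2))" by simp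
      show "integrable lebesgue (\<lambda>z. annulus_weight R z + 2 * Im (cnj \<kappa> * ?T R z))"
        by (intro Bochner_Integration.integrable_add C0(2)[OF R0'(1)] integrable_mult_right iIm)
    qed
    also have "\<dots> = (\<integral>z. annulus_weight R z \<partial>lebesgue) + 2 * (\<integral>z. Im (cnj \<kappa> * ?T R z) \<partial>lebesgue)"
      by (simp only: Bochner_Integration.integral_add[OF C0(2)[OF R0'(1)] integrable_mult_right[OF iIm]] integral_mult_right_zero)
    also have "(\<integral>z. Im (cnj \<kappa> * ?T R z) \<partial>lebesgue) = Im (cnj \<kappa> * (\<integral>z. ?T R z \<partial>lebesgue))"
      by (simp only: integral_Im[OF integrable_mult_right[OF iT[OF R0'(2)]]] integral_mult_right_zero)
    also have "(\<integral>z. annulus_weight R z \<partial>lebesgue) + 2 * Im (cnj \<kappa> * (\<integral>z. ?T R z \<partial>lebesgue)) \<le> C0 + 2 * (norm \<kappa> * norm C1)"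
      using C0(3)[OF R0'(1)] Im_le[OF R] by simp
    finally show ?thesis using \<kappa>(2) by (simp add: C_def field_simps)
  qed
  moreover have "C \<ge> 0" using C0(1) by (auto simp: C_def)
  moreover have "2 * R1 > R\<^sub>0" using R1 by simp
  ultimately show ?thesis using that by blast
qed

text \<open>The terms with \<open>\<i> * \<kappa>\<close> cancel by antisymmetry, so each product in
  the flux contains one radiation defect of size at most \<open>\<epsilon> / sqrt (norm z)\<close>.
  The inequality between geometric and arithmetic mean bounds it by \<open>\<epsilon> / 2\<close>
  times the squared field plus \<open>1 / norm z\<close>, and both have bounded weighted
  integrals.\<close>

lemma radiating_flux_tendsto:
  assumes R0: "R\<^sub>0 \<ge> 0" and \<kappa>: "Im \<kappa> \<ge> 0" "\<kappa> \<noteq> 0"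
    and v: "C1_on (UNIV - cball 0 R\<^sub>0) v" "weak_lap (UNIV - cball 0 R\<^sub>0) v (\<lambda>z. - (\<kappa>\<^sup>2) * v z)" "radiating \<kappa> v"
    and w: "C1_on (UNIV - cball 0 R\<^sub>0) w" "weak_lap (UNIV - cball 0 R\<^sub>0) w (\<lambda>z. - (\<kappa>\<^sup>2) * w z)" "radiating \<kappa> w"
  shows "((\<lambda>R. \<integral>z. v z * gdot w (cbump 0 R) z - w z * gdot v (cbump 0 R) z \<partial>lebesgue) \<longlongrightarrow> 0) at_top"
proof -
  obtain Cv Rv where Cv: "Cv \<ge> 0" "Rv > R\<^sub>0" "\<And>R. R \<ge> Rv \<Longrightarrow> (\<integral>z. radial_weight R z * (norm (v z))\<^sup>2 \<partial>lebesgue) \<le> Cv"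
    using radiating_annulus_bound[OF v(1) R0 v(2,3) \<kappa>] by blast
  obtain Cw Rw where Cw: "Cw \<ge> 0" "Rw > R\<^sub>0" "\<And>R. R \<ge> Rw \<Longrightarrow> (\<integral>z. radial_weight R z * (norm (w z))\<^sup>2 \<partial>lebesgue) \<le> Cw"
    using radiating_annulus_bound[OF w(1) R0 w(2,3) \<kappa>] by blast
  obtain C0 where C0: "C0 > 0" "\<And>R. R > 0 \<Longrightarrow> integrable lebesgue (annulus_weight R)"
    "\<And>R. R > 0 \<Longrightarrow> (\<integral>z. annulus_weight R z \<partial>lebesgue) \<le> C0" using integral_annulus_weight by blast
  let ?X = "UNIV - cball (0 :: real^2) R\<^sub>0"
  have X: "open ?X" by auto
  show ?thesis
  proof (rule tendstoI)
    fix r :: real assume r: "r > 0"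
    \<comment> \<open>\<open>C0\<close> is counted twice because each of the two products
      contributes a \<open>1 / norm z\<close>.\<close>
    define B where "B = Cv + Cw + 2 * C0"
    have B: "B > 0" using Cv Cw C0 by (simp add: B_def)
    define \<epsilon> where "\<epsilon> = r / B"
    have \<epsilon>: "\<epsilon> > 0" using r B by (simp add: \<epsilon>_def)
    obtain R1 where R1: "R1 > 0" "\<And>z. norm z \<ge> R1 \<Longrightarrow> norm (radial_deriv v z - \<i> * \<kappa> * v z) \<le> \<epsilon> / sqrt (norm z)"
      using radiating_bound[OF v(3) \<epsilon>] by blast
    obtain R2 where R2: "R2 > 0" "\<And>z. norm z \<ge> R2 \<Longrightarrow> norm (radial_deriv w z - \<i> * \<kappa> * w z) \<le> \<epsilon> / sqrt (norm z)"
      using radiating_bound[OF w(3) \<epsilon>] by blast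
    define M where "M = max (max Rv Rw) (max R1 R2)"
    have "norm (\<integral>z. v z * gdot w (cbump 0 R) z - w z * gdot v (cbump 0 R) z \<partial>lebesgue) < r" if R: "R \<ge> M" for R
    proof -
      have R': "R \<ge> Rv" "R \<ge> Rw" "R \<ge> R1" "R \<ge> R2" "R > 0" "R > R\<^sub>0" using R Cv(2) Cw(2) R1(1) by (auto simp: M_def)
      let ?m = "radial_weight R"
      let ?b = "\<lambda>z. \<epsilon> / 2 * (?m z * (norm (v z))\<^sup>2 + ?m z * (norm (w z))\<^sup>2 + 2 * annulus_weight R z)"
      have pt: "norm (v z * gdot w (cbump 0 R) z - w z * gdot v (cbump 0 R) z) \<le> ?b z" for z
      proof (cases "norm z \<le> R")
        case True
        then have "?m z = 0" using radial_weight_eq_0 R'(5) by blast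
        then show ?thesis unfolding gdot_cbump'[OF v(1) R0 R'(6)] gdot_cbump'[OF w(1) R0 R'(6)]
          using \<epsilon> annulus_weight_nonneg[of R z] by simp
      next
        case False
        let ?dv = "radial_deriv v z - \<i> * \<kappa> * v z" and ?dw = "radial_deriv w z - \<i> * \<kappa> * w z"
        have n: "norm z > 0" using False R' by linarith
        have amgm: "norm a * norm b \<le> \<epsilon> / 2 * ((norm a)\<^sup>2 + 1 / norm z)" if "norm b \<le> \<epsilon> / sqrt (norm z)" for a b :: complex
        proof -
          have "norm a * norm b \<le> norm a * (\<epsilon> / sqrt (norm z))" using that by (intro mult_left_mono) auto
          also have "\<dots> = \<epsilon> / 2 * (2 * norm a * (1 / sqrt (norm z)))" by simp
          also have "\<dots> \<le> \<epsilon> / 2 * ((norm a)\<^sup>2 + (1 / sqrt (norm z))\<^sup>2)"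
            using \<epsilon> sum_squares_bound[of "norm a" "1 / sqrt (norm z)"] by (intro mult_left_mono) auto
          finally show ?thesis by (simp add: power_divide)
        qed
        have "v z * gdot w (cbump 0 R) z - w z * gdot v (cbump 0 R) z = of_real (?m z) * (w z * ?dv - v z * ?dw)"
          unfolding gdot_cbump'[OF v(1) R0 R'(6)] gdot_cbump'[OF w(1) R0 R'(6)] by (simp add: algebra_simps)
        then have "norm (v z * gdot w (cbump 0 R) z - w z * gdot v (cbump 0 R) z) = ?m z * norm (w z * ?dv - v z * ?dw)"
          using radial_weight_nonneg by (simp add: norm_mult)
        also have "\<dots> \<le> ?m z * (norm (w z) * norm ?dv + norm (v z) * norm ?dw)"
          using norm_triangle_ineq4[of "w z * ?dv" "v z * ?dw"] by (intro mult_left_mono radial_weight_nonneg) (simp add: norm_mult)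
        also have "\<dots> \<le> ?m z * (\<epsilon> / 2 * ((norm (w z))\<^sup>2 + 1 / norm z) + \<epsilon> / 2 * ((norm (v z))\<^sup>2 + 1 / norm z))"
          using R1(2)[of z] R2(2)[of z] False R' by (intro mult_left_mono radial_weight_nonneg add_mono amgm) auto
        also have "\<dots> = \<epsilon> / 2 * (?m z * (norm (v z))\<^sup>2 + ?m z * (norm (w z))\<^sup>2 + 2 * (?m z / norm z))"
          by (simp add: algebra_simps)
        also have "?m z / norm z = annulus_weight R z" using n by (simp add: radial_weight_def)
        finally show ?thesis .
      qed
      have iw: "integrable lebesgue (\<lambda>z. ?m z * (norm (g z))\<^sup>2)" if "continuous_on ?X g" for g :: "real^2 \<Rightarrow> complex"
      proof (rule integrable_extend_zero[OF X, where K="cball 0 (2 * R) - ball 0 R"])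
        show "compact (cball 0 (2 * R) - ball (0 :: real^2) R)" by (intro compact_diff) auto
        show "cball 0 (2 * R) - ball (0 :: real^2) R \<subseteq> ?X" using R' by auto
        show "continuous_on ?X (\<lambda>z. ?m z * (norm (g z))\<^sup>2)"
          by (intro continuous_on_mult continuous_on_power continuous_on_norm that continuous_on_subset[OF radial_weight_continuous]) auto
        show "?m z * (norm (g z))\<^sup>2 = 0" if "z \<notin> cball 0 (2 * R) - ball 0 R" for z
          using radial_weight_eq_0[of R z] that R' by auto
      qed
      note ints = iw[OF C1_on_continuous[OF v(1)]] iw[OF C1_on_continuous[OF w(1)]] C0(2)[OF R'(5)]
      have "norm (\<integral>z. v z * gdot w (cbump 0 R) z - w z * gdot v (cbump 0 R) z \<partial>lebesgue) \<le> (\<integral>z. norm (v z * gdot w (cbump 0 R) z - w z * gdot v (cbump 0 R) z) \<partial>lebesgue)"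
        by (rule integral_norm_bound)
      also have "\<dots> \<le> (\<integral>z. ?b z \<partial>lebesgue)"
      proof (rule integral_mono_AE')
        show "integrable lebesgue ?b" using ints by auto
        show "AE z in lebesgue. norm (v z * gdot w (cbump 0 R) z - w z * gdot v (cbump 0 R) z) \<le> ?b z" using pt by auto
        show "AE z in lebesgue. 0 \<le> ?b z" using order_trans[OF norm_ge_zero pt] by auto
      qed
      also have "\<dots> = \<epsilon> / 2 * ((\<integral>z. ?m z * (norm (v z))\<^sup>2 \<partial>lebesgue) + (\<integral>z. ?m z * (norm (w z))\<^sup>2 \<partial>lebesgue) + 2 * (\<integral>z. annulus_weight R z \<partial>lebesgue))"
        using ints by simp
      also have "\<dots> \<le> \<epsilon> / 2 * B"
        unfolding B_def using Cv(3)[OF R'(1)] Cw(3)[OF R'(2)] C0(3)[OF R'(5)] \<epsilon> by (intro mult_left_mono) auto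
      also have "\<dots> < r" using r B by (simp add: \<epsilon>_def)
      finally show ?thesis .
    qed
    then show "\<forall>\<^sub>F R in at_top. dist (\<integral>z. v z * gdot w (cbump 0 R) z - w z * gdot v (cbump 0 R) z \<partial>lebesgue) 0 < r"
      unfolding eventually_at_top_linorder dist_norm diff_zero by blast
  qed
qed

section \<open>Reciprocity and the integral representation\<close>

text \<open>Minus an average, over the circles about \<open>a\<close> with radii between
  \<open>r\<close> and \<open>2 * r\<close>, of the outward flux of \<open>v\<close> times the
  gradient of \<open>w\<close> less \<open>w\<close> times the gradient of \<open>v\<close>; the
  sign arises because the cutoff decreases outwards.\<close>

definition flux :: "(real^2 \<Rightarrow> complex) \<Rightarrow> (real^2 \<Rightarrow> complex) \<Rightarrow> real^2 \<Rightarrow> real \<Rightarrow> complex" where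
  "flux v w a r = (\<integral>z. v z * gdot w (cbump a r) z - w z * gdot v (cbump a r) z \<partial>lebesgue)"

lemma cbump_C1_on: "C1_on V (cbump a r)"
  unfolding cbump_def[abs_def] by (rule C1_on_subset[OF C1_on_of_real[OF bump_C1]]) simp

lemma flux_integrable:
  assumes W: "open W" and v: "C1_on W v" and w: "C1_on W w" and r: "r > 0" and A: "cball a (2 * r) - ball a r \<subseteq> W"
  shows "integrable lebesgue (\<lambda>z. v z * gdot w (cbump a r) z - w z * gdot v (cbump a r) z)"
proof -
  have *: "integrable lebesgue (\<lambda>z. f z * gdot g (cbump a r) z)" if f: "C1_on W f" and g: "C1_on W g" for f g
  proof -
    have "integrable lebesgue (\<lambda>z. (f z * pd b g z) * pd b (cbump a r) z)" if b: "b \<in> Basis" for b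
    proof (rule C1c_mult_continuous(2)[OF W _ _ _ A])
      show "continuous_on W (\<lambda>z. f z * pd b g z)"
        using g b C1_on_continuous[OF f] by (auto simp: C1_on_def intro!: continuous_intros)
      show "continuous_on UNIV (pd b (cbump a r))" using cbump_C1_on[of UNIV a r] b by (simp add: C1_on_def)
      show "compact (cball a (2 * r) - ball a r)" by (intro compact_diff) auto
      show "pd b (cbump a r) z = 0" if "z \<notin> cball a (2 * r) - ball a r" for z
        using that pd_bump_eq_0[OF r, of a z b] by (auto simp: pd_cbump)
    qed
    then have "integrable lebesgue (\<lambda>z. \<Sum>b\<in>Basis. (f z * pd b g z) * pd b (cbump a r) z)"
      by (intro Bochner_Integration.integrable_sum)
    then show ?thesis unfolding gdot_def sum_distrib_left mult.assoc .
  qed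
  show ?thesis by (intro Bochner_Integration.integrable_diff * v w)
qed

lemma gdot_diff_right:
  assumes "\<psi>1 differentiable (at z)" "\<psi>2 differentiable (at z)"
  shows "gdot v (\<lambda>z. \<psi>1 z - \<psi>2 z) z = gdot v \<psi>1 z - gdot v \<psi>2 z"
  unfolding gdot_def by (simp add: pd_diff[OF assms] sum_subtractf right_diff_distrib)

lemma cbump_eq_1: "r > 0 \<Longrightarrow> dist a z \<le> r \<Longrightarrow> cbump a r z = 1"
  and cbump_eq_0: "r > 0 \<Longrightarrow> 2 * r \<le> dist a z \<Longrightarrow> cbump a r z = 0"
  by (simp_all add: cbump_def bump_eq_1 bump_eq_0)

lemma flux_swap: "flux w v a r = - flux v w a r"
  unfolding flux_def by (subst Bochner_Integration.integral_minus[symmetric]) simp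

text \<open>The common ground of reciprocity and of the integral representation. \<open>U\<close> is
  an open set of full measure on which the index is continuous, and beyond \<open>R\<^sub>0\<close>
  the medium has the constant wavenumber \<open>\<kappa>\<close>.\<close>

locale scattering_medium =
  fixes k :: real and q :: "real^2 \<Rightarrow> complex" and \<Omega> :: "nat \<Rightarrow> (real^2) set" and N :: nat
    and U :: "(real^2) set" and \<kappa> :: complex and R\<^sub>0 :: real
  assumes dom: "\<And>i. i \<le> N \<Longrightarrow> C2_domain (\<Omega> i)" and cover: "(\<Union>i\<le>N. closure (\<Omega> i)) = UNIV"
    and openU: "open U" and nullU: "negligible (- U)" and q: "regular_on U UNIV q"
    and \<kappa>: "Im \<kappa> \<ge> 0" "\<kappa> \<noteq> 0" and R0: "R\<^sub>0 \<ge> 0"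
    and outer: "\<And>z. z \<in> U \<Longrightarrow> norm z > R\<^sub>0 \<Longrightarrow> of_real (k\<^sup>2) * q z = \<kappa>\<^sup>2"
begin

text \<open>The complement of \<open>U\<close> is null, and completeness of Lebesgue measure makes
  the new right-hand side measurable.\<close>

lemma weak_lap_cong_AE:
  assumes "weak_lap W v f" "\<And>z. z \<in> U \<Longrightarrow> z \<in> W \<Longrightarrow> f z = g z"
    and "locally_integrable W f"
  shows "weak_lap W v g"
  unfolding weak_lap_def
proof (intro allI impI)
  fix \<psi> :: "real^2 \<Rightarrow> complex" assume \<psi>: "C1c W \<psi>"
  have ae: "AE z in lebesgue. f z * \<psi> z = g z * \<psi> z"
  proof (rule AE_U_I[OF openU nullU])
    fix z assume "z \<in> U"
    then show "f z * \<psi> z = g z * \<psi> z"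
      using assms(2)[of z] C1c_supp[OF \<psi>] not_in_supp[of z \<psi>] by (cases "z \<in> W") auto
  qed
  have m: "(\<lambda>z. f z * \<psi> z) \<in> borel_measurable lebesgue"
    by (rule borel_measurable_integrable[OF locally_integrable_mult_C1c[OF assms(3) \<psi>]])
  have "(\<integral>z. f z * \<psi> z \<partial>lebesgue) = (\<integral>z. g z * \<psi> z \<partial>lebesgue)"
    by (rule integral_cong_AE[OF m borel_measurable_AE[OF m ae] ae])
  then show "(\<integral>z. gdot v \<psi> z \<partial>lebesgue) = - (\<integral>z. g z * \<psi> z \<partial>lebesgue)"
    using weak_lapD[OF assms(1) \<psi>] by simp
qed

lemma regular_source_term:
  assumes "C1_on W v" shows "regular_on U W (\<lambda>z. - (of_real (k\<^sup>2) * q z * v z))"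
proof -
  have "regular_on U W (\<lambda>z. (of_real (- (k\<^sup>2)) * q z) * v z)"
    by (rule regular_on_mult[OF regular_on_mult[OF regular_on_continuous[OF continuous_on_const] regular_on_mono[OF q subset_UNIV]]
          regular_on_continuous[OF C1_on_continuous[OF assms]]])
  then show ?thesis by simp
qed

text \<open>Test functions supported away from \<open>y\<close> do not see the source, so each piece
  yields the homogeneous equation and the pieces are glued across the interfaces. This covers a
  source point on an interface as well.\<close>

lemma point_source_weak_lap:
  assumes "point_source_solution k q \<Omega> N y v"
  shows "C1_on (UNIV - {y}) v" "weak_lap (UNIV - {y}) v (\<lambda>z. - (of_real (k\<^sup>2) * q z * v z))"
proof -
  show v: "C1_on (UNIV - {y}) v" using assms unfolding point_source_solution_def C_on_1 by blast
  let ?f = "\<lambda>z. - (of_real (k\<^sup>2) * q z * v z)"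
  have f: "locally_integrable (UNIV - {y}) ?f"
    by (rule regular_on_locally_integrable[OF openU nullU regular_source_term[OF v]])
  show "weak_lap (UNIV - {y}) v ?f"
  proof (rule weak_lap_across_interfaces[OF dom cover _ v f])
    fix i assume i: "i \<le> N"
    let ?W = "\<Omega> i \<inter> (UNIV - {y})"
    have W: "open ?W" using dom[OF i] unfolding C2_domain_def by (intro open_Int open_Diff) auto
    have vW: "C1_on ?W v" by (rule C1_on_subset[OF v]) auto
    have fW: "locally_integrable ?W ?f" using f unfolding locally_integrable_def by blast
    show "weak_lap ?W v ?f"
    proof (rule distr_imp_weak_lap[OF W vW fW])
      fix \<phi> assume \<phi>: "test_function ?W \<phi>"
      have "test_function (\<Omega> i) \<phi>" using \<phi> unfolding test_function_def by blast
      then have "(\<integral>z. v z * (laplacian \<phi> z + of_real (k\<^sup>2) * q z * \<phi> z) \<partial>lebesgue) = - \<phi> y"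
        using assms i unfolding point_source_solution_def distr_point_source_def by blast
      moreover have "\<phi> y = 0"
        using C1c_supp[OF test_function_C1c(1)[OF \<phi>]] by (intro not_in_supp) auto
      moreover have "v z * (laplacian \<phi> z + of_real (k\<^sup>2) * q z * \<phi> z) = v z * laplacian \<phi> z - ?f z * \<phi> z" for z
        by (simp add: algebra_simps)
      moreover have "integrable lebesgue (\<lambda>z. v z * laplacian \<phi> z)" by (rule integral_laplacian_parts(2)[OF W vW \<phi>])
      moreover have "integrable lebesgue (\<lambda>z. ?f z * \<phi> z)"
        by (rule locally_integrable_mult_C1c[OF fW test_function_C1c(1)[OF \<phi>]])
      ultimately show "(\<integral>z. v z * laplacian \<phi> z \<partial>lebesgue) = (\<integral>z. ?f z * \<phi> z \<partial>lebesgue)"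
        by (simp add: eq_neg_iff_add_eq_0)
    qed
  qed auto
qed

lemma outer_weak_lap:
  assumes v: "C1_on (UNIV - cball 0 R\<^sub>1) v" and R1: "R\<^sub>1 \<ge> R\<^sub>0"
    and weak: "weak_lap (UNIV - cball 0 R\<^sub>1) v (\<lambda>z. - (of_real (k\<^sup>2) * q z * v z))"
  shows "weak_lap (UNIV - cball 0 R\<^sub>1) v (\<lambda>z. - (\<kappa>\<^sup>2) * v z)"
proof (rule weak_lap_cong_AE[OF weak])
  show "- (of_real (k\<^sup>2) * q z * v z) = - (\<kappa>\<^sup>2) * v z" if "z \<in> U" "z \<in> UNIV - cball 0 R\<^sub>1" for z
    using outer[of z] that R1 by simp
qed (rule regular_on_locally_integrable[OF openU nullU regular_source_term[OF v]])

lemma flux_tendsto_0: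
  assumes "C1_on (UNIV - cball 0 R\<^sub>1) v" "weak_lap (UNIV - cball 0 R\<^sub>1) v (\<lambda>z. - (of_real (k\<^sup>2) * q z * v z))" "radiating \<kappa> v"
    and "C1_on (UNIV - cball 0 R\<^sub>1) w" "weak_lap (UNIV - cball 0 R\<^sub>1) w (\<lambda>z. - (of_real (k\<^sup>2) * q z * w z))" "radiating \<kappa> w"
    and "R\<^sub>1 \<ge> R\<^sub>0"
  shows "(flux v w 0 \<longlongrightarrow> 0) at_top"
  unfolding flux_def
  by (rule radiating_flux_tendsto[OF _ \<kappa> assms(1) outer_weak_lap[OF assms(1,7,2)] assms(3,4) outer_weak_lap[OF assms(4,7,5)] assms(6)])
    (use R0 assms(7) in linarith)

text \<open>Stated for all sufficiently small radii, so that two source points can share one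
  radius.\<close>

lemma source_flux:
  assumes v: "point_source_solution k q \<Omega> N x v"
    and W: "open W" and w: "C1_on W w" "regular_on U W f" "weak_lap W w f" and x: "x \<in> W"
  obtains s where "s > 0" "\<And>r. r > 0 \<Longrightarrow> r \<le> s \<Longrightarrow> cball x (2 * r) \<subseteq> W \<and>
     (\<integral>z. v z * ((f z + of_real (k\<^sup>2) * q z * w z) * cbump x r z) \<partial>lebesgue) + flux v w x r = - w x"
proof -
  note v1 = point_source_weak_lap[OF v]
  obtain \<rho> where \<rho>: "\<rho> > 0" "distr_point_source k q (ball x \<rho>) x v"
    using v unfolding point_source_solution_def by blast
  obtain d where d: "d > 0" "cball x d \<subseteq> W" using open_contains_cball[of W] W x by blast
  define s where "s = min (\<rho> / 3) (d / 2)"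
  have "cball x (2 * r) \<subseteq> W \<and> (\<integral>z. v z * ((f z + of_real (k\<^sup>2) * q z * w z) * cbump x r z) \<partial>lebesgue) + flux v w x r = - w x"
    if r: "r > 0" "r \<le> s" for r
  proof -
    have 1: "cball x (2 * r) \<subseteq> W" using d r unfolding s_def by (auto simp: min_def split: if_splits)
    have 2: "2 * r < \<rho>" using r \<rho>(1) unfolding s_def by (auto simp: min_def split: if_splits)
    show ?thesis unfolding flux_def
      using source_representation[OF openU nullU q v1(1) \<rho>(2) W w(1) w(2,3) r(1) 1 2] 1 by blast
  qed
  moreover have "s > 0" using \<rho>(1) d(1) by (simp add: s_def)
  ultimately show ?thesis using that by blast
qed

text \<open>Green's second identity on a large disc without two small ones. The volume terms cancel
  because both fields solve the same equation; the fluxes about \<open>x\<close> and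
  \<open>y\<close> are \<open>- w x\<close> and \<open>v y\<close>. Hence the outer flux is
  \<open>v y - w x\<close> for every large radius, while it tends to 0.\<close>

lemma reciprocity:
  assumes v: "point_source_solution k q \<Omega> N x v" "radiating \<kappa> v"
    and w: "point_source_solution k q \<Omega> N y w" "radiating \<kappa> w" and xy: "x \<noteq> y"
  shows "v y = w x"
proof -
  note v1 = point_source_weak_lap[OF v(1)] and w1 = point_source_weak_lap[OF w(1)]
  let ?f = "\<lambda>v z. - (of_real (k\<^sup>2) * q z * v z)"
  have f0: "?f v z + of_real (k\<^sup>2) * q z * v z = 0" for v z by simp
  obtain s1 where s1: "s1 > 0" "\<And>r. r > 0 \<Longrightarrow> r \<le> s1 \<Longrightarrow> cball x (2 * r) \<subseteq> UNIV - {y} \<and> flux v w x r = - w x"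
    using source_flux[OF v(1) _ w1(1) regular_source_term[OF w1(1)] w1(2), of thesis] xy
    by (auto simp: f0)
  obtain s2 where s2: "s2 > 0" "\<And>r. r > 0 \<Longrightarrow> r \<le> s2 \<Longrightarrow> cball y (2 * r) \<subseteq> UNIV - {x} \<and> flux w v y r = - v y"
    using source_flux[OF w(1) _ v1(1) regular_source_term[OF v1(1)] v1(2), of thesis] xy
    by (auto simp: f0)
  \<comment> \<open>A fifth of the distance keeps the two annuli of outer radius
    \<open>2 * r\<close> disjoint and each cutoff 0 on the plateau of the other.\<close>
  define r where "r = min (min s1 s2) (dist x y / 5)"
  have r: "r > 0" "r \<le> s1" "r \<le> s2" "5 * r \<le> dist x y" using s1(1) s2(1) xy by (auto simp: r_def)
  have fx: "flux v w x r = - w x" and fy: "flux v w y r = v y"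
    using s1(2)[OF r(1,2)] s2(2)[OF r(1,3)] flux_swap[of w v y r] by auto
  define R1 where "R1 = max R\<^sub>0 (max (norm x + 2 * r) (norm y + 2 * r))"
  have R1: "R1 \<ge> R\<^sub>0" "norm x + 2 * r \<le> R1" "norm y + 2 * r \<le> R1" by (auto simp: R1_def)
  let ?W = "UNIV - {x, y}"
  have W: "open ?W" by auto
  have vW: "C1_on ?W v" and wW: "C1_on ?W w"
    using C1_on_subset[OF v1(1), of ?W] C1_on_subset[OF w1(1), of ?W] by auto
  have weak: "weak_lap ?W v (?f v)" "weak_lap ?W w (?f w)"
    using weak_lap_mono[OF v1(2), of ?W] weak_lap_mono[OF w1(2), of ?W] by auto
  have li: "locally_integrable ?W (?f v)" "locally_integrable ?W (?f w)"
    using regular_on_locally_integrable[OF openU nullU regular_source_term] vW wW by auto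
  have near: "norm z \<le> R1" if "dist a z \<le> 2 * r" "a \<in> {x, y}" for a z
    using that R1 norm_triangle_sub[of z a] by (auto simp: dist_norm norm_minus_commute)
  have key: "flux v w 0 R = v y - w x" if R: "R > R1" for R
  proof -
    have Rp: "R > 0" using R R1(1) R0 by linarith
    \<comment> \<open>For \<open>R > R1\<close> the large cutoff is 1 on both small discs, so the
      difference vanishes near \<open>x\<close> and \<open>y\<close> and is admissible off the two
      sources.\<close>
    define \<psi> where "\<psi> z = cbump 0 R z - cbump x r z - cbump y r z" for z
    have "C1_on UNIV \<psi>" unfolding \<psi>_def by (intro C1_on_diff cbump_C1_on)
    moreover have "compact (cball 0 (2 * R) - (ball x r \<union> ball y r))" by (intro compact_diff) auto
    moreover have "cball 0 (2 * R) - (ball x r \<union> ball y r) \<subseteq> ?W" using r(1) by auto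
    moreover have "\<psi> z = 0" if z: "z \<notin> cball 0 (2 * R) - (ball x r \<union> ball y r)" for z
    proof -
      consider "2 * R < norm z" | "dist x z < r" | "dist y z < r" using z by auto
      then show ?thesis
      proof cases
        case 1
        then have "\<not> norm z \<le> R1" using R Rp by linarith
        then have "\<not> dist x z \<le> 2 * r" "\<not> dist y z \<le> 2 * r" using near[of x z] near[of y z] by auto
        then show ?thesis using 1 cbump_eq_0[OF Rp, of 0 z] cbump_eq_0[OF r(1), of x z] cbump_eq_0[OF r(1), of y z] by (simp add: \<psi>_def)
      next
        case 2
        then have "dist y z \<ge> 2 * r" using r dist_triangle[of x y z] by (simp add: dist_commute)
        moreover have "norm z \<le> R" using near[of x z] 2 r(1) R by simp
        ultimately show ?thesis using 2 cbump_eq_1[OF Rp, of 0 z] cbump_eq_1[OF r(1), of x z] cbump_eq_0[OF r(1), of y z] by (simp add: \<psi>_def)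
      next
        case 3
        then have "dist x z \<ge> 2 * r" using r dist_triangle[of x y z] by (simp add: dist_commute)
        moreover have "norm z \<le> R" using near[of y z] 3 r(1) R by simp
        ultimately show ?thesis using 3 cbump_eq_1[OF Rp, of 0 z] cbump_eq_1[OF r(1), of y z] cbump_eq_0[OF r(1), of x z] by (simp add: \<psi>_def)
      qed
    qed
    ultimately have \<psi>: "C1c ?W \<psi>" by (rule C1cI)
    have "(\<integral>z. v z * gdot w \<psi> z - w z * gdot v \<psi> z \<partial>lebesgue) = 0"
      unfolding green_second_weak[OF W vW wW li(1) weak(1) li(2) weak(2) \<psi>] by (simp add: mult_ac)
    moreover have "v z * gdot w \<psi> z - w z * gdot v \<psi> z =
       ((v z * gdot w (cbump 0 R) z - w z * gdot v (cbump 0 R) z) - (v z * gdot w (cbump x r) z - w z * gdot v (cbump x r) z))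
       - (v z * gdot w (cbump y r) z - w z * gdot v (cbump y r) z)" for z
    proof -
      have d: "cbump a s differentiable (at z)" for a s using cbump_C1_on[of UNIV a s] by (simp add: C1_on_def)
      have g: "gdot u \<psi> z = gdot u (cbump 0 R) z - gdot u (cbump x r) z - gdot u (cbump y r) z" for u
        unfolding \<psi>_def[abs_def] by (simp add: gdot_diff_right d)
      show ?thesis unfolding g[of w] g[of v] by (simp add: algebra_simps)
    qed
    moreover have "integrable lebesgue (\<lambda>z. v z * gdot w (cbump 0 R) z - w z * gdot v (cbump 0 R) z)"
      by (rule flux_integrable[OF W vW wW Rp]) (use R R1 r in auto)
    moreover have "integrable lebesgue (\<lambda>z. v z * gdot w (cbump x r) z - w z * gdot v (cbump x r) z)"
      by (rule flux_integrable[OF W vW wW r(1)]) (use r in auto)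
    moreover have "integrable lebesgue (\<lambda>z. v z * gdot w (cbump y r) z - w z * gdot v (cbump y r) z)"
      by (rule flux_integrable[OF W vW wW r(1)]) (use r in \<open>auto simp: dist_commute\<close>)
    ultimately have "flux v w 0 R - flux v w x r - flux v w y r = 0" unfolding flux_def by simp
    then show ?thesis unfolding fx fy by (simp add: eq_diff_eq)
  qed
  have sub: "UNIV - cball 0 R1 \<subseteq> UNIV - {x}" "UNIV - cball 0 R1 \<subseteq> UNIV - {y}" using R1 r(1) by auto
  have "(flux v w 0 \<longlongrightarrow> 0) at_top"
    by (rule flux_tendsto_0[OF C1_on_subset[OF v1(1) sub(1)] weak_lap_mono[OF v1(2) sub(1)] v(2)
          C1_on_subset[OF w1(1) sub(2)] weak_lap_mono[OF w1(2) sub(2)] w(2) R1(1)])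
  moreover have "\<forall>\<^sub>F R in at_top. flux v w 0 R = v y - w x"
    using eventually_gt_at_top[of R1] by eventually_elim (rule key)
  then have "(flux v w 0 \<longlongrightarrow> v y - w x) at_top" by (rule tendsto_eventually)
  ultimately have "v y - w x = 0" using tendsto_unique[OF trivial_limit_at_top_linorder] by blast
  then show ?thesis by simp
qed

text \<open>The point \<open>x\<close> may lie in the support of \<open>p\<close>, where
  \<open>v\<close> is singular. The small cutoff splits the integral: the part near \<open>x\<close>
  comes from the point source equation, the rest from Green's second identity, and the flux about
  \<open>x\<close> drops out of the sum.\<close>

lemma radiating_representation:
  assumes v: "point_source_solution k q \<Omega> N x v" "radiating \<kappa> v"
    and p: "regular_on U UNIV p" "compact K" "\<And>z. z \<notin> K \<Longrightarrow> p z = 0"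
    and w: "C1_on UNIV w" "weak_lap UNIV w (\<lambda>z. p z - of_real (k\<^sup>2) * q z * w z)" "radiating \<kappa> w"
  shows "integrable lebesgue (\<lambda>z. v z * p z)" "w x = - (\<integral>z. v z * p z \<partial>lebesgue)"
proof -
  note v1 = point_source_weak_lap[OF v(1)]
  let ?fv = "\<lambda>z. - (of_real (k\<^sup>2) * q z * v z)" and ?fw = "\<lambda>z. p z - of_real (k\<^sup>2) * q z * w z"
  have fw: "regular_on U UNIV ?fw"
    using regular_on_add[OF p(1) regular_source_term[OF w(1)]] by simp
  obtain s where s: "s > 0" "\<And>r. r > 0 \<Longrightarrow> r \<le> s \<Longrightarrow> cball x (2 * r) \<subseteq> UNIV \<and>
     (\<integral>z. v z * ((?fw z + of_real (k\<^sup>2) * q z * w z) * cbump x r z) \<partial>lebesgue) + flux v w x r = - w x"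
    using source_flux[OF v(1) open_UNIV w(1) fw w(2) UNIV_I] by blast
  obtain \<rho> where \<rho>: "\<rho> > 0" "locally_integrable (ball x \<rho>) v"
    using v(1) unfolding point_source_solution_def distr_point_source_def by blast
  define r where "r = min s (\<rho> / 3)"
  have r: "r > 0" "r \<le> s" "2 * r < \<rho>" using s(1) \<rho>(1) by (auto simp: r_def min_def)
  have fx: "(\<integral>z. v z * (p z * cbump x r z) \<partial>lebesgue) + flux v w x r = - w x"
    using s(2)[OF r(1,2)] by simp
  have cc: "continuous_on V (cbump x r)" for V by (rule C1_on_continuous[OF cbump_C1_on])
  have i1: "integrable lebesgue (\<lambda>z. v z * (p z * cbump x r z))"
    by (rule regular_on_mult_integrable[OF openU nullU \<rho>(2) regular_on_mult[OF p(1) regular_on_continuous[OF cc]] compact_cball[of x "2 * r"]])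
      (use r cbump_eq_0[of r x] in auto)
  have Kx: "compact (K - ball x r)" "K - ball x r \<subseteq> UNIV - {x}" using p(2) r(1) by (auto intro: compact_diff)
  have i2: "integrable lebesgue (\<lambda>z. v z * (p z * (1 - cbump x r z)))"
  proof (rule regular_on_mult_integrable[OF openU nullU continuous_locally_integrable[OF C1_on_continuous[OF v1(1)]] _ Kx])
    show "regular_on U UNIV (\<lambda>z. p z * (1 - cbump x r z))"
      by (intro regular_on_mult p(1) regular_on_continuous continuous_intros cc)
    show "p z * (1 - cbump x r z) = 0" if "z \<notin> K - ball x r" for z
      using that p(3)[of z] cbump_eq_1[OF r(1), of x z] by auto
  qed
  have split: "v z * p z = v z * (p z * cbump x r z) + v z * (p z * (1 - cbump x r z))" for z
    by (simp add: algebra_simps)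
  show "integrable lebesgue (\<lambda>z. v z * p z)" unfolding split by (intro Bochner_Integration.integrable_add i1 i2)
  have vp: "(\<integral>z. v z * p z \<partial>lebesgue) = (\<integral>z. v z * (p z * cbump x r z) \<partial>lebesgue) + (\<integral>z. v z * (p z * (1 - cbump x r z)) \<partial>lebesgue)"
    unfolding split by (rule Bochner_Integration.integral_add[OF i1 i2])
  obtain RK where RK: "RK > 0" "\<And>z. z \<in> K \<Longrightarrow> norm z \<le> RK" using compact_imp_bounded[OF p(2)] unfolding bounded_pos by auto
  define R1 where "R1 = max (max R\<^sub>0 RK) (norm x + 2 * r)"
  have R1: "R1 \<ge> R\<^sub>0" "norm x + 2 * r \<le> R1" "RK \<le> R1" by (auto simp: R1_def)
  let ?W = "UNIV - {x}"
  have W: "open ?W" by auto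
  have wW: "C1_on ?W w" by (rule C1_on_subset[OF w(1)]) auto
  have weak: "weak_lap ?W w ?fw" by (rule weak_lap_mono[OF w(2)]) auto
  have li: "locally_integrable ?W ?fv" "locally_integrable ?W ?fw"
    using regular_on_locally_integrable[OF openU nullU regular_source_term[OF v1(1)]]
      regular_on_locally_integrable[OF openU nullU regular_on_mono[OF fw, of ?W]] by auto
  have near: "norm z \<le> R1" if "dist x z \<le> 2 * r" for z
    using that R1 norm_triangle_sub[of z x] by (auto simp: dist_norm norm_minus_commute)
  have key: "flux v w 0 R = - w x - (\<integral>z. v z * p z \<partial>lebesgue)" if R: "R > R1" for R
  proof -
    have Rp: "R > 0" using R R1(1) R0 by linarith
    define \<psi> where "\<psi> z = cbump 0 R z - cbump x r z" for z
    have "C1_on UNIV \<psi>" unfolding \<psi>_def by (intro C1_on_diff cbump_C1_on)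
    moreover have "compact (cball 0 (2 * R) - ball x r)" by (intro compact_diff) auto
    moreover have "cball 0 (2 * R) - ball x r \<subseteq> ?W" using r(1) by auto
    moreover have "\<psi> z = 0" if z: "z \<notin> cball 0 (2 * R) - ball x r" for z
    proof -
      consider "2 * R < norm z" | "dist x z < r" using z by auto
      then show ?thesis
      proof cases
        case 1
        then have "\<not> norm z \<le> R1" using R Rp by linarith
        then have "dist x z > 2 * r" using near[of z] not_le by blast
        then show ?thesis using 1 cbump_eq_0[OF Rp, of 0 z] cbump_eq_0[OF r(1), of x z] by (simp add: \<psi>_def)
      next
        case 2
        have "norm z \<le> R" using near[of z] 2 r(1) R by simp
        then show ?thesis using 2 cbump_eq_1[OF Rp, of 0 z] cbump_eq_1[OF r(1), of x z] by (simp add: \<psi>_def)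
      qed
    qed
    ultimately have \<psi>: "C1c ?W \<psi>" by (rule C1cI)
    \<comment> \<open>On \<open>K\<close> the large cutoff is 1 and elsewhere \<open>p\<close> is 0,
      so \<open>\<psi>\<close> acts on \<open>p\<close> as 1 minus the small cutoff.\<close>
    have pv: "v z * (p z * (1 - cbump x r z)) = v z * p z * \<psi> z" for z
      using p(3)[of z] RK(2)[of z] cbump_eq_1[OF Rp, of 0 z] R R1 by (cases "z \<in> K") (auto simp: \<psi>_def)
    have "(\<integral>z. v z * gdot w \<psi> z - w z * gdot v \<psi> z \<partial>lebesgue) = (\<integral>z. ?fv z * (w z * \<psi> z) \<partial>lebesgue) - (\<integral>z. ?fw z * (v z * \<psi> z) \<partial>lebesgue)"
      by (rule green_second_weak[OF W v1(1) wW li(1) v1(2) li(2) weak \<psi>])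
    also have "\<dots> = (\<integral>z. ?fv z * (w z * \<psi> z) - ?fw z * (v z * \<psi> z) \<partial>lebesgue)"
      by (intro Bochner_Integration.integral_diff[symmetric] locally_integrable_mult_C1c[OF li(1) C1c_mult[OF W wW \<psi>]]
          locally_integrable_mult_C1c[OF li(2) C1c_mult[OF W v1(1) \<psi>]])
    also have "\<dots> = (\<integral>z. - (v z * (p z * (1 - cbump x r z))) \<partial>lebesgue)"
      unfolding pv by (intro Bochner_Integration.integral_cong refl) (simp add: algebra_simps)
    also have "\<dots> = - (\<integral>z. v z * (p z * (1 - cbump x r z)) \<partial>lebesgue)" by simp
    finally have "(\<integral>z. v z * gdot w \<psi> z - w z * gdot v \<psi> z \<partial>lebesgue) = - (\<integral>z. v z * (p z * (1 - cbump x r z)) \<partial>lebesgue)" .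
    moreover have "v z * gdot w \<psi> z - w z * gdot v \<psi> z =
       (v z * gdot w (cbump 0 R) z - w z * gdot v (cbump 0 R) z) - (v z * gdot w (cbump x r) z - w z * gdot v (cbump x r) z)" for z
    proof -
      have d: "cbump a s differentiable (at z)" for a s using cbump_C1_on[of UNIV a s] by (simp add: C1_on_def)
      have g: "gdot u \<psi> z = gdot u (cbump 0 R) z - gdot u (cbump x r) z" for u
        unfolding \<psi>_def[abs_def] by (simp add: gdot_diff_right d)
      show ?thesis unfolding g[of w] g[of v] by (simp add: algebra_simps)
    qed
    moreover have "integrable lebesgue (\<lambda>z. v z * gdot w (cbump 0 R) z - w z * gdot v (cbump 0 R) z)"
      by (rule flux_integrable[OF W v1(1) wW Rp]) (use R R1 r in auto)
    moreover have "integrable lebesgue (\<lambda>z. v z * gdot w (cbump x r) z - w z * gdot v (cbump x r) z)"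
      by (rule flux_integrable[OF W v1(1) wW r(1)]) (use r in auto)
    ultimately have "flux v w 0 R - flux v w x r = - (\<integral>z. v z * (p z * (1 - cbump x r z)) \<partial>lebesgue)" unfolding flux_def by simp
    moreover have "a = - b - i" if "c + f = - b" "i = c + d" "a - f = - d" for a b c d f i :: complex
    proof -
      have "f = - b - c" "a = f - d" using that by (simp_all add: eq_diff_eq diff_eq_eq add.commute)
      then show ?thesis using that(2) by simp
    qed
    ultimately show ?thesis using fx vp by blast
  qed
  have sub: "UNIV - cball 0 R1 \<subseteq> UNIV - {x}" using R1 r(1) by auto
  have wout: "C1_on (UNIV - cball 0 R1) w" by (rule C1_on_subset[OF w(1)]) auto
  have "weak_lap (UNIV - cball 0 R1) w (\<lambda>z. - (of_real (k\<^sup>2) * q z * w z))"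
  proof (rule weak_lap_cong_AE[OF weak_lap_mono[OF w(2)]])
    show "?fw z = - (of_real (k\<^sup>2) * q z * w z)" if "z \<in> UNIV - cball 0 R1" for z
      using p(3)[of z] RK(2)[of z] that R1(3) by auto
    show "locally_integrable (UNIV - cball 0 R1) ?fw"
      by (rule regular_on_locally_integrable[OF openU nullU regular_on_mono[OF fw]]) simp
  qed auto
  from flux_tendsto_0[OF C1_on_subset[OF v1(1) sub] weak_lap_mono[OF v1(2) sub] v(2) wout this w(3) R1(1)]
  have "(flux v w 0 \<longlongrightarrow> 0) at_top" .
  moreover have "\<forall>\<^sub>F R in at_top. flux v w 0 R = - w x - (\<integral>z. v z * p z \<partial>lebesgue)"
    using eventually_gt_at_top[of R1] by eventually_elim (rule key)
  then have "(flux v w 0 \<longlongrightarrow> - w x - (\<integral>z. v z * p z \<partial>lebesgue)) at_top" by (rule tendsto_eventually)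
  ultimately have "- w x - (\<integral>z. v z * p z \<partial>lebesgue) = 0" using tendsto_unique[OF trivial_limit_at_top_linorder] by blast
  then have "(\<integral>z. v z * p z \<partial>lebesgue) = - w x" by simp
  then show "w x = - (\<integral>z. v z * p z \<partial>lebesgue)" by (simp only: minus_minus)
qed

end

section \<open>The pieces of the medium and the scattered field\<close>

lemma C_closure_differentiable: "C_closure 1 V a \<Longrightarrow> x \<in> V \<Longrightarrow> a differentiable (at x)"
  and C_closure_extends: "C_closure 1 V a \<Longrightarrow> extends_continuously V a"
  by simp_all

text \<open>Continuity is local to the pieces. Boundedness on a compact set comes from the
  continuous extensions to the closures, of which there are finitely many.\<close>

lemma regular_on_pieces:
  fixes N :: nat and \<Omega> :: "nat \<Rightarrow> (real^2) set"
  assumes U: "U \<subseteq> (\<Union>i\<le>N. \<Omega> i)" and a: "\<And>i. i \<le> N \<Longrightarrow> C_closure 1 (\<Omega> i) a"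
  shows "regular_on U UNIV a"
  unfolding regular_on_def
proof (intro conjI allI impI)
  show "continuous_on (U \<inter> UNIV) a"
    using U C_closure_differentiable[OF a] differentiable_imp_continuous_within
    by (intro continuous_at_imp_continuous_on) blast
  fix K :: "(real^2) set" assume K: "compact K \<and> K \<subseteq> UNIV"
  have "bounded (a ` (K \<inter> \<Omega> i))" if i: "i \<le> N" for i
  proof -
    obtain g where g: "continuous_on (closure (\<Omega> i)) g" "\<And>x. x \<in> \<Omega> i \<Longrightarrow> g x = a x"
      using C_closure_extends[OF a[OF i]] unfolding extends_continuously_def by blast
    have "compact (K \<inter> closure (\<Omega> i))" using K by (intro compact_Int_closed) auto
    then have "bounded (g ` (K \<inter> closure (\<Omega> i)))"
      by (intro compact_imp_bounded compact_continuous_image continuous_on_subset[OF g(1)]) auto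
    moreover have "a ` (K \<inter> \<Omega> i) \<subseteq> g ` (K \<inter> closure (\<Omega> i))"
    proof
      fix y assume "y \<in> a ` (K \<inter> \<Omega> i)"
      then obtain x where x: "x \<in> K" "x \<in> \<Omega> i" "y = a x" by blast
      then have "x \<in> K \<inter> closure (\<Omega> i)" using closure_subset[of "\<Omega> i"] by blast
      then show "y \<in> g ` (K \<inter> closure (\<Omega> i))" using g(2)[OF x(2)] x(3) by (metis imageI)
    qed
    ultimately show ?thesis by (rule bounded_subset)
  qed
  then have "bounded (\<Union>i\<le>N. a ` (K \<inter> \<Omega> i))" by (intro bounded_UN) auto
  moreover have "a ` (K \<inter> U) \<subseteq> (\<Union>i\<le>N. a ` (K \<inter> \<Omega> i))" using U by blast
  ultimately show "bounded (a ` (K \<inter> U))" by (rule bounded_subset)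
qed

text \<open>As the closures cover the plane, a point in no piece lies on a frontier, and frontiers
  are locally contained in graphs.\<close>

lemma negligible_interfaces:
  fixes N :: nat and \<Omega> :: "nat \<Rightarrow> (real^2) set"
  assumes "\<And>i. i \<le> N \<Longrightarrow> C2_domain (\<Omega> i)" "(\<Union>i\<le>N. closure (\<Omega> i)) = UNIV"
  shows "negligible (- ((\<Union>i\<le>N. \<Omega> i) - {x}))"
proof -
  have "- ((\<Union>i\<le>N. \<Omega> i) - {x}) \<subseteq> (\<Union>i\<le>N. frontier (\<Omega> i)) \<union> {x}"
  proof
    fix z assume z: "z \<in> - ((\<Union>i\<le>N. \<Omega> i) - {x})"
    obtain i where i: "i \<le> N" "z \<in> closure (\<Omega> i)" using assms(2) by blast
    have "interior (\<Omega> i) = \<Omega> i" using assms(1)[OF i(1)] by (simp add: C2_domain_def interior_open)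
    then show "z \<in> (\<Union>i\<le>N. frontier (\<Omega> i)) \<union> {x}" using z i unfolding frontier_def by blast
  qed
  moreover have "negligible ((\<Union>i\<le>N. frontier (\<Omega> i)) \<union> {x})"
    using assms(1) by (intro negligible_Un negligible_Union) (auto intro: C2_domain_negligible_frontier)
  ultimately show ?thesis by (rule negligible_subset[rotated])
qed

context scattering_medium
begin

text \<open>In the difference of the equations of \<open>u\<close> and \<open>g\<close> the point
  sources cancel, and replacing \<open>g\<close> by \<open>u - w\<close> leaves \<open>p\<close> as
  the source of \<open>w\<close>. The decomposition fails at most at \<open>y\<close>, so the
  integrands agree almost everywhere; as \<open>w\<close> is C^1 on the whole plane, gluing reaches
  \<open>y\<close> too.\<close>

lemma scattered_weak_lap:
  assumes G: "point_source_solution k q \<Omega> N y g"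
    and n: "regular_on U UNIV n" and u: "point_source_solution k n \<Omega> N y u"
    and w: "C1_on UNIV w" and dec: "\<And>z. z \<noteq> y \<Longrightarrow> u z = g z + w z"
    and p: "regular_on U UNIV p" "\<And>z. p z = of_real (k\<^sup>2) * (q z - n z) * u z"
  shows "weak_lap UNIV w (\<lambda>z. p z - of_real (k\<^sup>2) * q z * w z)"
proof -
  let ?f = "\<lambda>z. p z - of_real (k\<^sup>2) * q z * w z"
  have f: "regular_on U UNIV ?f" using regular_on_add[OF p(1) regular_source_term[OF w]] by simp
  note fl = regular_on_locally_integrable[OF openU nullU f]
  show ?thesis
  proof (rule weak_lap_across_interfaces[OF dom cover open_UNIV w fl])
    fix i assume i: "i \<le> N"
    have W: "open (\<Omega> i)" using dom[OF i] by (simp add: C2_domain_def)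
    have wi: "C1_on (\<Omega> i) w" by (rule C1_on_subset[OF w]) simp
    have fi: "locally_integrable (\<Omega> i) ?f" using fl unfolding locally_integrable_def by blast
    have "weak_lap (\<Omega> i) w ?f"
    proof (rule distr_imp_weak_lap[OF W wi fi])
      fix \<phi> assume \<phi>: "test_function (\<Omega> i) \<phi>"
      note C = test_function_C1c[OF \<phi>]
      have lu: "locally_integrable (\<Omega> i) u" and lg: "locally_integrable (\<Omega> i) g"
        using u G i unfolding point_source_solution_def distr_point_source_def by blast+
      have lapc: "continuous_on UNIV (laplacian \<phi>)"
        unfolding laplacian_pd[abs_def] by (intro continuous_on_sum C1c_pd_continuous[OF C(2)])
      have lap0: "laplacian \<phi> z = 0" if "z \<notin> supp \<phi>" for z
      proof -
        have "supp (pd b \<phi>) \<subseteq> supp \<phi>" for b by (rule supp_subset_closed) (auto simp: pd_not_in_supp)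
        then have "z \<notin> supp (pd b \<phi>)" for b using that by blast
        then show ?thesis by (simp add: laplacian_pd pd_not_in_supp)
      qed
      have I: "integrable lebesgue (\<lambda>z. h z * (laplacian \<phi> z + of_real (k\<^sup>2) * a z * \<phi> z))"
        if h: "locally_integrable (\<Omega> i) h" and a: "regular_on U UNIV a" for h a
      proof (rule regular_on_mult_integrable[OF openU nullU h _ C1c_compact[OF C(1)] C1c_supp[OF C(1)]])
        show "regular_on U UNIV (\<lambda>z. laplacian \<phi> z + of_real (k\<^sup>2) * a z * \<phi> z)"
          by (rule regular_on_add[OF regular_on_continuous[OF lapc] regular_on_mult[OF regular_on_mult[OF
                regular_on_continuous[OF continuous_on_const] a] regular_on_continuous[OF C1c_continuous[OF C(1)]]]])
      qed (simp add: lap0 not_in_supp)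
      have 1: "(\<integral>z. u z * (laplacian \<phi> z + of_real (k\<^sup>2) * n z * \<phi> z) \<partial>lebesgue) = - \<phi> y"
        and 2: "(\<integral>z. g z * (laplacian \<phi> z + of_real (k\<^sup>2) * q z * \<phi> z) \<partial>lebesgue) = - \<phi> y"
        using u G i \<phi> unfolding point_source_solution_def distr_point_source_def by blast+
      have "(\<integral>z. u z * (laplacian \<phi> z + of_real (k\<^sup>2) * n z * \<phi> z) - g z * (laplacian \<phi> z + of_real (k\<^sup>2) * q z * \<phi> z) \<partial>lebesgue) = 0"
        using 1 2 I[OF lu n] I[OF lg q] by simp
      moreover have "(\<integral>z. u z * (laplacian \<phi> z + of_real (k\<^sup>2) * n z * \<phi> z) - g z * (laplacian \<phi> z + of_real (k\<^sup>2) * q z * \<phi> z) \<partial>lebesgue)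
          = (\<integral>z. w z * laplacian \<phi> z - ?f z * \<phi> z \<partial>lebesgue)"
      proof (rule integral_cong_AE)
        show "(\<lambda>z. u z * (laplacian \<phi> z + of_real (k\<^sup>2) * n z * \<phi> z) - g z * (laplacian \<phi> z + of_real (k\<^sup>2) * q z * \<phi> z)) \<in> borel_measurable lebesgue"
          using I[OF lu n] I[OF lg q] by (intro borel_measurable_integrable Bochner_Integration.integrable_diff)
        show "(\<lambda>z. w z * laplacian \<phi> z - ?f z * \<phi> z) \<in> borel_measurable lebesgue"
          using integral_laplacian_parts(2)[OF W wi \<phi>] locally_integrable_mult_C1c[OF fi C(1)]
          by (intro borel_measurable_integrable Bochner_Integration.integrable_diff)
        have "{z. \<not> z \<noteq> y} = {y}" by auto
        then have "AE z in lebesgue. z \<noteq> y" unfolding AE_lebesgue_iff by (simp only: negligible_sing)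
        then show "AE z in lebesgue. u z * (laplacian \<phi> z + of_real (k\<^sup>2) * n z * \<phi> z) - g z * (laplacian \<phi> z + of_real (k\<^sup>2) * q z * \<phi> z)
            = w z * laplacian \<phi> z - ?f z * \<phi> z"
        proof eventually_elim
          case (elim z)
          show ?case unfolding p(2) dec[OF elim] by (simp add: algebra_simps)
        qed
      qed
      ultimately show "(\<integral>z. w z * laplacian \<phi> z \<partial>lebesgue) = (\<integral>z. ?f z * \<phi> z \<partial>lebesgue)"
        using integral_laplacian_parts(2)[OF W wi \<phi>] locally_integrable_mult_C1c[OF fi C(1)] by simp
    qed
    then show "weak_lap (\<Omega> i \<inter> UNIV) w ?f" by simp
  qed
qed

end

theorem theorem3p2:
  fixes \<epsilon>\<^sub>0 \<omega> c k :: real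
    and \<epsilon> \<sigma> :: "real^2 \<Rightarrow> real"
    and n\<^sub>b n m :: "real^2 \<Rightarrow> complex"
    and n\<^sub>0 k\<^sub>0 :: complex
    and N M :: nat
    and \<Omega> :: "nat \<Rightarrow> (real^2) set"
    and J\<^sub>0 :: "nat set"
    and \<Omega>t D :: "(real^2) set"
    and G :: "real^2 \<Rightarrow> real^2 \<Rightarrow> complex"
    and x\<^sub>0 :: "real^2"
    and u u\<^sub>s :: "real^2 \<Rightarrow> complex"
  assumes "\<epsilon>\<^sub>0 > 0" and "\<omega> > 0" and "c > 0" and "k = \<omega> / c"
    and "\<And>x. \<epsilon> x \<ge> 1" and "\<And>x. \<sigma> x \<ge> 0"
    and "\<And>x. n\<^sub>b x = 1 / of_real \<epsilon>\<^sub>0 * (of_real (\<epsilon> x) + \<i> * of_real (\<sigma> x / \<omega>))"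
    \<comment> \<open>geometry and background\<close>
    and "\<And>i. i \<le> N \<Longrightarrow> C2_domain (\<Omega> i)"
    and "\<And>i j. i \<le> N \<Longrightarrow> j \<le> N \<Longrightarrow> i \<noteq> j \<Longrightarrow> \<Omega> i \<inter> \<Omega> j = {}"
    and "(\<Union>i\<le>N. closure (\<Omega> i)) = UNIV"
    and "\<And>i. i \<le> N \<Longrightarrow> i \<noteq> 0 \<Longrightarrow> bounded (\<Omega> i)"
    and "\<And>i. i \<le> N \<Longrightarrow> C_closure 1 (\<Omega> i) n\<^sub>b"
    and "Im n\<^sub>0 \<ge> 0" and "\<And>x. x \<in> \<Omega> 0 \<Longrightarrow> n\<^sub>b x = n\<^sub>0"
    and "J\<^sub>0 \<subseteq> {1..N}"
    and "\<Omega>t = interior {x. n\<^sub>b x = n\<^sub>0}"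
    \<comment> \<open>equality up to interfaces: virtual interfaces inside \<open>\<Omega>t\<close> are allowed\<close>
    and "\<Omega>t - (\<Union>i\<le>N. frontier (\<Omega> i)) = \<Omega> 0 \<union> (\<Union>j\<in>J\<^sub>0. \<Omega> j)"
    and "k\<^sub>0 = of_real k * csqrt n\<^sub>0"
    \<comment> \<open>scatterer\<close>
    and "1 \<le> M" and "M \<le> N"
    and "D = (\<Union>i\<in>{1..M}. \<Omega> i)"
    and "\<And>i. i \<le> N \<Longrightarrow> C_closure 1 (\<Omega> i) n"
    and "\<And>x. x \<notin> closure D \<Longrightarrow> n x = n\<^sub>b x"
    and "\<And>x. m x = (n\<^sub>b x - n x) / n\<^sub>0"
    and "closure {x. m x \<noteq> 0} = closure D"
    and "green_function k k\<^sub>0 n\<^sub>b \<Omega> N \<Omega>t G"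
    \<comment> \<open>the scattering problem\<close>
    and "x\<^sub>0 \<in> \<Omega>t - closure (\<Omega>t \<inter> D)"
    and "C_on 1 UNIV u\<^sub>s"
    and "\<And>i. i \<le> N \<Longrightarrow> \<exists>f. C_closure 1 (\<Omega> i) f \<and> distr_laplacian (\<Omega> i) u\<^sub>s f"
    and "point_source_solution k n \<Omega> N x\<^sub>0 u"
    and "\<And>x. x \<noteq> x\<^sub>0 \<Longrightarrow> u x = G x x\<^sub>0 + u\<^sub>s x"
    and "radiating k\<^sub>0 u\<^sub>s"
  shows "\<forall>x\<in>\<Omega>t.
           integrable lebesgue (\<lambda>y. G x y * m y * u y) \<and>
           u\<^sub>s x = - k\<^sub>0\<^sup>2 * (\<integral>y. G x y * m y * u y \<partial>lebesgue)"
proof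
  fix x assume "x \<in> \<Omega>t"
  note dom = assms(8) and cover = assms(10)
  have kpos: "k > 0" using assms(2-4) by simp
  have "\<Omega> 0 \<noteq> {}" using dom[of 0] by (simp add: C2_domain_def)
  then obtain z0 where "z0 \<in> \<Omega> 0" by blast
  then have n0z: "n\<^sub>0 = n\<^sub>b z0" using assms(14) by simp
  \<comment> \<open>The bound \<open>\<epsilon> \<ge> 1\<close> forces
    \<open>n\<^sub>0 \<noteq> 0\<close>, hence a nonzero wavenumber and a genuine division in
    \<open>m\<close>.\<close>
  have "Re n\<^sub>0 = \<epsilon> z0 / \<epsilon>\<^sub>0" unfolding n0z assms(7) by (simp add: Re_divide_of_real)
  then have Re_n0: "Re n\<^sub>0 > 0" using assms(1) assms(5)[of z0] by simp
  then have n0: "n\<^sub>0 \<noteq> 0" by auto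
  have k0sq: "k\<^sub>0\<^sup>2 = of_real (k\<^sup>2) * n\<^sub>0" unfolding assms(18) by (simp add: power_mult_distrib)
  have k0: "k\<^sub>0 \<noteq> 0" using n0 kpos k0sq by auto
  have Im_k0: "Im k\<^sub>0 \<ge> 0"
  proof -
    \<comment> \<open>For \<open>Im n\<^sub>0 \<ge> 0\<close> the principal root is the branch with
      nonnegative imaginary part.\<close>
    have "0 \<le> Im (csqrt n\<^sub>0)" using assms(13) complex_Re_le_cmod[of n\<^sub>0] by (auto simp: sgn_if)
    then show ?thesis unfolding assms(18) using kpos by simp
  qed
  define U where "U = (\<Union>i\<le>N. \<Omega> i) - {x\<^sub>0}"
  have openU: "open U"
    unfolding U_def using dom by (intro open_Diff open_UN) (auto simp: C2_domain_def)
  have nullU: "negligible (- U)" unfolding U_def by (rule negligible_interfaces[OF dom cover])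
  have Usub: "U \<subseteq> (\<Union>i\<le>N. \<Omega> i)" by (auto simp: U_def)
  have q: "regular_on U UNIV n\<^sub>b" by (rule regular_on_pieces[OF Usub assms(12)])
  have n: "regular_on U UNIV n" by (rule regular_on_pieces[OF Usub assms(22)])
  have "bounded (\<Union>i\<in>{1..N}. \<Omega> i)" using assms(11) by (intro bounded_UN) auto
  then obtain R0 where R0: "R0 > 0" "\<And>z. z \<in> (\<Union>i\<in>{1..N}. \<Omega> i) \<Longrightarrow> norm z \<le> R0"
    unfolding bounded_pos by auto
  have outer: "of_real (k\<^sup>2) * n\<^sub>b z = k\<^sub>0\<^sup>2" if z: "z \<in> U" "norm z > R0" for z
  proof -
    obtain i where i: "i \<le> N" "z \<in> \<Omega> i" using z(1) Usub by blast
    have "i = 0"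
    proof (rule ccontr)
      assume "i \<noteq> 0"
      then have "z \<in> (\<Union>i\<in>{1..N}. \<Omega> i)" using i by auto
      then show False using R0(2)[of z] z(2) by simp
    qed
    then show ?thesis using assms(14) i(2) k0sq by simp
  qed
  interpret scattering_medium k n\<^sub>b \<Omega> N U k\<^sub>0 R0
    by unfold_locales (use dom cover openU nullU q Im_k0 k0 R0(1) outer in auto)
  have G: "point_source_solution k n\<^sub>b \<Omega> N y (\<lambda>z. G z y)" "radiating k\<^sub>0 (\<lambda>z. G z y)" for y
    using assms(26) unfolding green_function_def by blast+
  have us: "C1_on UNIV u\<^sub>s" using assms(28) unfolding C_on_1 .
  \<comment> \<open>Because \<open>\<Omega>t\<close> is open, keeping away from
    \<open>closure (\<Omega>t \<inter> D)\<close> means keeping away from \<open>closure D\<close>.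
    Hence \<open>u\<close> is continuous on the whole support of the contrast.\<close>
  have x0: "x\<^sub>0 \<notin> closure D"
  proof
    assume "x\<^sub>0 \<in> closure D"
    moreover have "open \<Omega>t" using assms(16) by simp
    ultimately have "x\<^sub>0 \<in> closure (\<Omega>t \<inter> D)" using assms(27) open_Int_closure_subset[of \<Omega>t D] by blast
    then show False using assms(27) by blast
  qed
  have m0: "m z = 0" if "z \<notin> closure D" for z using assms(23)[OF that] assms(24) by simp
  have D: "compact (closure D)"
  proof -
    have "bounded D" unfolding assms(21) using assms(20) by (intro bounded_UN) (auto intro!: assms(11))
    then show ?thesis by (simp add: compact_closure)
  qed
  have k0m: "k\<^sub>0\<^sup>2 * m z = of_real (k\<^sup>2) * (n\<^sub>b z - n z)" for z
    unfolding k0sq assms(24) using n0 by simp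
  \<comment> \<open>The contrast source: \<open>k\<^sub>0\<^sup>2\<close> contains the factor
    \<open>n\<^sub>0\<close> by which \<open>m\<close> is divided.\<close>
  define p where "p z = k\<^sub>0\<^sup>2 * m z * u z" for z
  have p_eq: "p z = of_real (k\<^sup>2) * (n\<^sub>b z - n z) * u z" for z unfolding p_def k0m ..
  have p0: "p z = 0" if "z \<notin> closure D" for z using m0[OF that] by (simp add: p_def)
  have p: "regular_on U UNIV p"
  proof (rule regular_on_extend_zero[OF _ openU _ D])
    show "open (UNIV - {x\<^sub>0})" "closure D \<subseteq> UNIV - {x\<^sub>0}" using x0 by auto
    have uc: "continuous_on (UNIV - {x\<^sub>0}) u"
      using assms(30) unfolding point_source_solution_def C_on_1 by (blast intro: C1_on_continuous)
    \<comment> \<open>The difference is written with a factor -1 so that closure under sums and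
      products applies.\<close>
    have "regular_on U (UNIV - {x\<^sub>0}) (\<lambda>z. of_real (k\<^sup>2) * (n\<^sub>b z + of_real (- 1) * n z) * u z)"
      by (rule regular_on_mult[OF regular_on_mult[OF regular_on_continuous[OF continuous_on_const]
            regular_on_add[OF regular_on_mono[OF q] regular_on_mult[OF regular_on_continuous[OF continuous_on_const] regular_on_mono[OF n]]]]
            regular_on_continuous[OF uc]]) auto
    then show "regular_on U (UNIV - {x\<^sub>0}) p" by (simp add: p_eq[abs_def])
  qed (rule p0)
  have weak: "weak_lap UNIV u\<^sub>s (\<lambda>z. p z - of_real (k\<^sup>2) * n\<^sub>b z * u\<^sub>s z)"
    by (rule scattered_weak_lap[OF G(1) n assms(30) us assms(31) p p_eq])
  note rep = radiating_representation[OF G p D p0 us weak assms(32), of x]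
  let ?g = "\<lambda>y. G x y * m y * u y"
  \<comment> \<open>Reciprocity exchanges the arguments except at \<open>y = x\<close>, where the
    value of \<open>G\<close> is arbitrary; a single point is null.\<close>
  have gx: "AE y in lebesgue. G y x * p y / k\<^sub>0\<^sup>2 = ?g y"
  proof -
    have "{y. \<not> y \<noteq> x} = {x}" by auto
    then have "AE y in lebesgue. y \<noteq> x" unfolding AE_lebesgue_iff by (simp only: negligible_sing)
    then show ?thesis
    proof eventually_elim
      case (elim y)
      have "G y x = G x y" by (rule reciprocity[OF G G]) (use elim in auto)
      then show ?case using k0 by (simp add: p_def)
    qed
  qed
  have i: "integrable lebesgue (\<lambda>y. G y x * p y / k\<^sub>0\<^sup>2)" using rep(1) by simp
  have gm: "?g \<in> borel_measurable lebesgue"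
    by (rule borel_measurable_AE[OF borel_measurable_integrable[OF i] gx])
  have "integrable lebesgue ?g" by (rule integrable_cong_AE_imp[OF i gm gx])
  moreover have "u\<^sub>s x = - k\<^sub>0\<^sup>2 * (\<integral>y. ?g y \<partial>lebesgue)"
  proof -
    have "(\<integral>y. ?g y \<partial>lebesgue) = (\<integral>y. G y x * p y / k\<^sub>0\<^sup>2 \<partial>lebesgue)"
      by (rule integral_cong_AE[OF borel_measurable_integrable[OF i] gm gx, symmetric])
    also have "\<dots> = (\<integral>y. G y x * p y \<partial>lebesgue) / k\<^sub>0\<^sup>2" by simp
    finally show ?thesis using rep(2) k0 by simp
  qed
  ultimately show "integrable lebesgue ?g \<and> u\<^sub>s x = - k\<^sub>0\<^sup>2 * (\<integral>y. ?g y \<partial>lebesgue)" by blast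
qed

end
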